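(* Let $n\ge 2$ and let $\Omega_\psi\subset\mathbb R^n$ be an outward cuspidal domain. Then $\Omega_\psi$ is a $p$-Poincaré domain for every $1<p<\infty$. Moreover, for $1\leq q<p<\infty$, $\Omega_\psi$ is a $(W^{1,p},W^{1,q})$-extension domain if and only if it is an $(L^{1,p},L^{1,q})$-extension domain.
   Context: Let $\psi:[0,\infty)\to[0,\infty)$ be left-continuous and nondecreasing with $\psi(0)=0$, $\psi(1)=1$. The outward cuspidal domain is $\Omega_\psi:=\{(t,z)\in(0,1)\times\mathbb R^{n-1}:|z|<\psi(t)\}\cup B^n((2,0,\dots,0),\sqrt2)$. For a domain $\Omega\subset\mathbb R^n$ and $1\leq p<\infty$: $L^{1,p}(\Omega)$ is the space of $u\in L^1_{\rm loc}(\Omega)$ that are weakly differentiable with $\nabla u\in L^p(\Omega;\mathbb R^n)$, with seminorm $\|\nabla u\|_{L^p(\Omega)}$; $W^{1,p}(\Omega)=L^{1,p}(\Omega)\cap L^p(\Omega)$ with norm $(\int_\Omega |u|^p+|\nabla u|^p)^{1/p}$. $\Omega$ is an $(\mathcal X,\mathcal Y)$-extension domain if there is an operator $E:\mathcal X(\Omega)\to\mathcal Y(\mathbb R^n)$ and $C>0$ with $E(u)|_\Omega=u$ and $\|E(u)\|_{\mathcal Y}\leq C\|u\|_{\mathcal X}$ for all $u\in\mathcal X(\Omega)$. A bounded domain $\Omega$ is a $p$-Poincaré domain if there is $C>0$ with $\int_\Omega|u-u_\Omega|^p\,dx\leq C\int_\Omega|\nabla u|^p\,dx$ for every $u\in W^{1,p}(\Omega)$,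 $u_\Omega$ denoting the mean of $u$ over $\Omega$. *)

theory Defs
  imports "HOL-Analysis.Analysis"
begin

definition dpart :: "'a::euclidean_space \<Rightarrow> ('a \<Rightarrow> real) \<Rightarrow> ('a \<Rightarrow> real)" where
  "dpart b f = (\<lambda>x. frechet_derivative f (at x) b)"

definition C_inf :: "('a::euclidean_space \<Rightarrow> real) \<Rightarrow> bool" where
  "C_inf f \<longleftrightarrow> (\<forall>bs. set bs \<subseteq> Basis \<longrightarrow> (\<forall>x. foldr dpart bs f differentiable (at x)))"

definition tsupport :: "('a::euclidean_space \<Rightarrow> real) \<Rightarrow> 'a set" where
  "tsupport f = closure {x. f x \<noteq> 0}"

definition test_fun :: "'a::euclidean_space set \<Rightarrow> ('a \<Rightarrow> real) \<Rightarrow> bool" where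
  "test_fun \<Omega> \<phi> \<longleftrightarrow> C_inf \<phi> \<and> compact (tsupport \<phi>) \<and> tsupport \<phi> \<subseteq> \<Omega>"

definition loc_integrable :: "'a::euclidean_space set \<Rightarrow> ('a \<Rightarrow> real) \<Rightarrow> bool" where
  "loc_integrable \<Omega> u \<longleftrightarrow> (\<forall>K. compact K \<and> K \<subseteq> \<Omega> \<longrightarrow> set_integrable lebesgue K u)"

definition in_Lp :: "'a::euclidean_space set \<Rightarrow> real \<Rightarrow> ('a \<Rightarrow> real) \<Rightarrow> bool" where
  "in_Lp \<Omega> p f \<longleftrightarrow> set_borel_measurable lebesgue \<Omega> f
      \<and> set_integrable lebesgue \<Omega> (\<lambda>x. \<bar>f x\<bar> powr p)"

definition has_weak_gradient :: "'a::euclidean_space set \<Rightarrow> ('a \<Rightarrow> real) \<Rightarrow> ('a \<Rightarrow> 'a) \<Rightarrow> bool" where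
  "has_weak_gradient \<Omega> u g \<longleftrightarrow>
     loc_integrable \<Omega> u \<and> (\<forall>b\<in>Basis. loc_integrable \<Omega> (\<lambda>x. g x \<bullet> b)) \<and>
     (\<forall>\<phi>. test_fun \<Omega> \<phi> \<longrightarrow> (\<forall>b\<in>Basis.
        (LINT x:\<Omega>|lebesgue. u x * dpart b \<phi> x) = - (LINT x:\<Omega>|lebesgue. (g x \<bullet> b) * \<phi> x)))"

definition weak_grad :: "'a::euclidean_space set \<Rightarrow> ('a \<Rightarrow> real) \<Rightarrow> ('a \<Rightarrow> 'a)" where
  "weak_grad \<Omega> u = (SOME g. has_weak_gradient \<Omega> u g)"

definition L1p :: "'a::euclidean_space set \<Rightarrow> real \<Rightarrow> ('a \<Rightarrow> real) set" where
  "L1p \<Omega> p = {u. \<exists>g. has_weak_gradient \<Omega> u g \<and> in_Lp \<Omega> p (\<lambda>x. norm (g x))}"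

definition L1p_norm :: "'a::euclidean_space set \<Rightarrow> real \<Rightarrow> ('a \<Rightarrow> real) \<Rightarrow> real" where
  "L1p_norm \<Omega> p u = (LINT x:\<Omega>|lebesgue. norm (weak_grad \<Omega> u x) powr p) powr (1/p)"

definition W1p :: "'a::euclidean_space set \<Rightarrow> real \<Rightarrow> ('a \<Rightarrow> real) set" where
  "W1p \<Omega> p = {u. u \<in> L1p \<Omega> p \<and> in_Lp \<Omega> p u}"

definition W1p_norm :: "'a::euclidean_space set \<Rightarrow> real \<Rightarrow> ('a \<Rightarrow> real) \<Rightarrow> real" where
  "W1p_norm \<Omega> p u =
     (LINT x:\<Omega>|lebesgue. \<bar>u x\<bar> powr p + norm (weak_grad \<Omega> u x) powr p) powr (1/p)"

definition extension_domain ::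
  "('a::euclidean_space set \<Rightarrow> ('a \<Rightarrow> real) set) \<Rightarrow> ('a set \<Rightarrow> ('a \<Rightarrow> real) \<Rightarrow> real) \<Rightarrow>
   ('a set \<Rightarrow> ('a \<Rightarrow> real) set) \<Rightarrow> ('a set \<Rightarrow> ('a \<Rightarrow> real) \<Rightarrow> real) \<Rightarrow> 'a set \<Rightarrow> bool" where
  "extension_domain X Xn Y Yn \<Omega> \<longleftrightarrow>
     (\<exists>E C. C > 0 \<and> (\<forall>u\<in>X \<Omega>. E u \<in> Y UNIV \<and> (AE x in lebesgue. x \<in> \<Omega> \<longrightarrow> E u x = u x)
                          \<and> Yn UNIV (E u) \<le> C * Xn \<Omega> u))"

definition W_extension_domain :: "'a::euclidean_space set \<Rightarrow> real \<Rightarrow> real \<Rightarrow> bool" where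
  "W_extension_domain \<Omega> p q =
     extension_domain (\<lambda>S. W1p S p) (\<lambda>S. W1p_norm S p) (\<lambda>S. W1p S q) (\<lambda>S. W1p_norm S q) \<Omega>"

definition L_extension_domain :: "'a::euclidean_space set \<Rightarrow> real \<Rightarrow> real \<Rightarrow> bool" where
  "L_extension_domain \<Omega> p q =
     extension_domain (\<lambda>S. L1p S p) (\<lambda>S. L1p_norm S p) (\<lambda>S. L1p S q) (\<lambda>S. L1p_norm S q) \<Omega>"

definition mean_value :: "'a::euclidean_space set \<Rightarrow> ('a \<Rightarrow> real) \<Rightarrow> real" where
  "mean_value \<Omega> u = (LINT x:\<Omega>|lebesgue. u x) / measure lebesgue \<Omega>"

definition poincare_domain :: "real \<Rightarrow> 'a::euclidean_space set \<Rightarrow> bool" where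
  "poincare_domain p \<Omega> \<longleftrightarrow> bounded \<Omega> \<and>
     (\<exists>C>0. \<forall>u\<in>W1p \<Omega> p.
        (LINT x:\<Omega>|lebesgue. \<bar>u x - mean_value \<Omega> u\<bar> powr p)
          \<le> C * (LINT x:\<Omega>|lebesgue. norm (weak_grad \<Omega> u x) powr p))"

text \<open>R^n is identified with R x R^(n-1), points written (t,z); n = 1 + CARD('m) >= 2.\<close>
definition cusp_domain :: "(real \<Rightarrow> real) \<Rightarrow> (real \<times> (real^'m)) set" where
  "cusp_domain \<psi> = {(t, z). 0 < t \<and> t < 1 \<and> norm z < \<psi> t} \<union> ball (2, 0) (sqrt 2)"

definition admissible_cusp :: "(real \<Rightarrow> real) \<Rightarrow> bool" where
  "admissible_cusp \<psi> \<longleftrightarrow> (\<forall>t\<ge>0. \<psi> t \<ge> 0) \<and> mono_on {0..} \<psi> \<and>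
     (\<forall>t>0. (\<psi> \<longlongrightarrow> \<psi> t) (at_left t)) \<and> \<psi> 0 = 0 \<and> \<psi> 1 = 1"

end

(*
If x + s h stays in Omega for all x in U and 0 <= s <= 1, then for almost every x in U
u(x + h) - u(x) is the integral of grad u(x + s h) . h over s in [0,1] (test with smooth functions,
use Fubini and the fundamental lemma of the calculus of variations), and Jensen's inequality gives
  int_U |u(x + h) - u(x)|^p <= |h|^p int_Omega |grad u|^p.
Integrating over h yields the Poincare inequality on a ball, indeed on every bounded convex open
set. The unit translation along the axis moves the cusp into the ball of Omega_psi inside
Omega_psi, so the inequality on the ball propagates to Omega_psi: this needs p >= 1 and
|grad u| in L^p, but not u in L^p.

Given a W-extension operator E, pick c with ||u - c||_p <= C ||grad u||_p and extend u by
E(u - c) + c. Given an L-extension operator E, multiply E u by a smooth cutoff supported in a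
large ball; the convex Poincare inequality bounds E u in L^q of that ball by its gradient and by
its values on Omega_psi.
*)

theory Submission
  imports Defs
begin

section \<open>Smooth functions\<close>

text \<open>The seminorms refer to a gradient picked by choice and to functions known up to null
  sets, while Fubini's theorem for (x, s) -> u (x + s h) calls for Borel functions. So everything is
  passed to Borel representatives, and almost everywhere uniqueness of weak gradients makes the
  picked gradient harmless. The basic estimate is therefore stated with some constant c and with
  extended nonnegative integrals; the mean enters only for functions in \<open>W1p\<close>.
  Extension operators need not be linear, so c may depend on u in any way. The profile being
  nondecreasing keeps horizontal unit segments that start in the cusp inside the domain, and its
  bound by 1 puts their endpoints in the ball: |t + 1 - 2| < 1 and |z| < 1 give squared distance
  below 2. This is what the radius sqrt 2 is for, and it makes the constant independent of how fast
  the cusp narrows.\<close>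

lemma C_inf_iff:
  "C_inf f \<longleftrightarrow> (\<forall>x. f differentiable (at x)) \<and> (\<forall>b\<in>Basis. C_inf (dpart b f))"
proof
  assume f: "C_inf f"
  have "f differentiable (at x)" for x
    using f[unfolded C_inf_def, rule_format, of "[]" x] by simp
  moreover have "C_inf (dpart b f)" if "b \<in> Basis" for b
    unfolding C_inf_def
  proof (intro allI impI)
    fix bs :: "'a list" and x assume "set bs \<subseteq> Basis"
    then show "foldr dpart bs (dpart b f) differentiable at x"
      using f[unfolded C_inf_def, rule_format, of "bs @ [b]" x] that by simp
  qed
  ultimately show "(\<forall>x. f differentiable (at x)) \<and> (\<forall>b\<in>Basis. C_inf (dpart b f))"
    by blast
next
  assume *: "(\<forall>x. f differentiable (at x)) \<and> (\<forall>b\<in>Basis. C_inf (dpart b f))"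
  show "C_inf f"
    unfolding C_inf_def
  proof (intro allI impI)
    fix bs :: "'a list" and x assume bs: "set bs \<subseteq> Basis"
    show "foldr dpart bs f differentiable at x"
    \<comment> \<open>\<open>foldr\<close> applies the last entry of the list first, so the list is
      split at its end.\<close>
    proof (cases bs rule: rev_cases)
      case Nil
      then show ?thesis using * by simp
    next
      case (snoc ys b)
      then have "C_inf (dpart b f)" "set ys \<subseteq> Basis" using * bs by auto
      then show ?thesis unfolding C_inf_def snoc by simp
    qed
  qed
qed

lemma C_inf_differentiable: "C_inf f \<Longrightarrow> f differentiable (at x)"
  using C_inf_iff by blast

lemma C_inf_dpart: "C_inf f \<Longrightarrow> b \<in> Basis \<Longrightarrow> C_inf (dpart b f)"
  using C_inf_iff by blast

text \<open>Smooth functions form the largest family of differentiable functions closed under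
  partial derivatives; exhibiting one such family replaces computing iterated derivatives.\<close>

lemma C_inf_coinduct:
  assumes "P f"
    and diff: "\<And>f x. P f \<Longrightarrow> f differentiable (at x)"
    and step: "\<And>f b. P f \<Longrightarrow> b \<in> Basis \<Longrightarrow> P (dpart b f)"
  shows "C_inf f"
proof -
  have "P (foldr dpart bs f)" if "set bs \<subseteq> Basis" for bs
    using that by (induction bs) (auto intro: step assms(1))
  then show ?thesis unfolding C_inf_def using diff by blast
qed

lemma C_inf_continuous: "C_inf f \<Longrightarrow> continuous_on S f"
  by (meson C_inf_differentiable continuous_at_imp_continuous_on differentiable_imp_continuous_within)

lemma C_inf_measurable: "C_inf f \<Longrightarrow> f \<in> borel_measurable borel"
  by (intro borel_measurable_continuous_onI C_inf_continuous)

lemma dpart_eq: "(f has_derivative f') (at x) \<Longrightarrow> dpart b f x = f' b"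
  unfolding dpart_def by (metis frechet_derivative_at)

lemma has_derivative_dpart:
  assumes "f differentiable (at x)"
  shows "(f has_derivative (\<lambda>h. \<Sum>b\<in>Basis. (h \<bullet> b) * dpart b f x)) (at x)"
proof -
  have d: "(f has_derivative frechet_derivative f (at x)) (at x)"
    using assms frechet_derivative_works by blast
  then have lin: "linear (frechet_derivative f (at x))"
    by (rule has_derivative_linear)
  have "frechet_derivative f (at x) h = (\<Sum>b\<in>Basis. (h \<bullet> b) * dpart b f x)" for h
  proof -
    have "frechet_derivative f (at x) h
        = frechet_derivative f (at x) (\<Sum>b\<in>Basis. (h \<bullet> b) *\<^sub>R b)"
      by (simp add: euclidean_representation)
    also have "\<dots> = (\<Sum>b\<in>Basis. (h \<bullet> b) * dpart b f x)"
      by (simp add: linear_sum[OF lin] linear_cmul[OF lin] dpart_def)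
    finally show ?thesis .
  qed
  then have "frechet_derivative f (at x) = (\<lambda>h. \<Sum>b\<in>Basis. (h \<bullet> b) * dpart b f x)"
    by blast
  then show ?thesis using d by simp
qed

lemma dpart_add:
  assumes "f differentiable (at x)" "g differentiable (at x)"
  shows "dpart b (\<lambda>x. f x + g x) x = dpart b f x + dpart b g x"
  using dpart_eq[OF has_derivative_add[OF assms[unfolded frechet_derivative_works]]]
  by (simp add: dpart_def)

lemma dpart_mult:
  assumes "f differentiable (at x)" "g differentiable (at x)"
  shows "dpart b (\<lambda>x. f x * g x) x = dpart b f x * g x + f x * dpart b g x"
  using dpart_eq[OF has_derivative_mult[OF assms[unfolded frechet_derivative_works]]]
  by (simp add: dpart_def)

lemma C_inf_const: "C_inf (\<lambda>x. c)"
proof (rule C_inf_coinduct[where P = "\<lambda>f. \<exists>c. f = (\<lambda>x. c)"])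
  fix f :: "'a \<Rightarrow> real" and b assume "\<exists>c. f = (\<lambda>x. c)"
  then obtain c where f: "f = (\<lambda>x. c)" by blast
  have "dpart b f = (\<lambda>x. 0)"
    using dpart_eq[OF has_derivative_const] f by fastforce
  then show "\<exists>c. dpart b f = (\<lambda>x. c)" by blast
qed auto

text \<open>A family of differentiable functions that is closed under partial derivatives consists of
  smooth functions; the two inductive predicates below are such families.\<close>

inductive product_span :: "('a::euclidean_space \<Rightarrow> real) \<Rightarrow> bool" where
  prod: "C_inf f \<Longrightarrow> C_inf g \<Longrightarrow> product_span (\<lambda>x. f x * g x)"
| add: "product_span f \<Longrightarrow> product_span g \<Longrightarrow> product_span (\<lambda>x. f x + g x)"

lemma product_span_differentiable: "product_span f \<Longrightarrow> f differentiable (at x)"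
  by (induction rule: product_span.induct)
    (simp_all add: differentiable_mult differentiable_add C_inf_differentiable)

lemma product_span_dpart: "product_span f \<Longrightarrow> b \<in> Basis \<Longrightarrow> product_span (dpart b f)"
proof (induction rule: product_span.induct)
  case (prod f g)
  have "dpart b (\<lambda>x. f x * g x) = (\<lambda>x. dpart b f x * g x + f x * dpart b g x)"
    by (rule ext) (intro dpart_mult C_inf_differentiable prod)
  moreover have "product_span (\<lambda>x. dpart b f x * g x + f x * dpart b g x)"
    by (intro product_span.add product_span.prod C_inf_dpart prod)
  ultimately show ?case by simp
next
  case (add f g)
  have "dpart b (\<lambda>x. f x + g x) = (\<lambda>x. dpart b f x + dpart b g x)"
    by (rule ext) (intro dpart_add product_span_differentiable add)
  moreover have "product_span (\<lambda>x. dpart b f x + dpart b g x)"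
    by (intro product_span.add add)
  ultimately show ?case by simp
qed

lemma C_inf_mult: "C_inf f \<Longrightarrow> C_inf g \<Longrightarrow> C_inf (\<lambda>x. f x * g x)"
  by (rule C_inf_coinduct[where P = product_span])
    (auto intro: product_span.prod product_span_differentiable product_span_dpart)

lemma C_inf_prod:
  "finite I \<Longrightarrow> (\<And>i. i \<in> I \<Longrightarrow> C_inf (f i)) \<Longrightarrow> C_inf (\<lambda>x. \<Prod>i\<in>I. f i x)"
proof (induction rule: finite_induct)
  case empty
  show ?case using C_inf_const[of 1] by simp
next
  case (insert i I)
  have "C_inf (\<lambda>x. f i x * (\<Prod>i\<in>I. f i x))"
    by (rule C_inf_mult) (use insert in auto)
  then show ?case using insert by simp
qed

lemma dpart_translate:
  assumes "f differentiable (at (x - h))"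
  shows "dpart b (\<lambda>x. f (x - h)) x = dpart b f (x - h)"
proof -
  have "((\<lambda>x. f (x - h)) has_derivative (\<lambda>k. frechet_derivative f (at (x - h)) k)) (at x)"
    by (rule has_derivative_compose[where f = "\<lambda>x. x - h" and g = f])
      (use assms frechet_derivative_works in \<open>auto intro!: derivative_eq_intros\<close>)
  from dpart_eq[OF this] show ?thesis by (simp add: dpart_def)
qed

lemma C_inf_translate:
  assumes "C_inf f"
  shows "C_inf (\<lambda>x. f (x - h))"
proof (rule C_inf_coinduct[where P = "\<lambda>g. \<exists>f. C_inf f \<and> g = (\<lambda>x. f (x - h))"])
  fix g :: "'a \<Rightarrow> real" and x assume "\<exists>f. C_inf f \<and> g = (\<lambda>x. f (x - h))"
  then obtain f where f: "C_inf f" "g = (\<lambda>x. f (x - h))" by blast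
  show "g differentiable at x"
    unfolding f(2)
    by (rule differentiable_compose[where g = "\<lambda>x. x - h" and f = f])
      (auto intro!: C_inf_differentiable f derivative_intros)
next
  fix g :: "'a \<Rightarrow> real" and b :: 'a
  assume b: "b \<in> Basis" and "\<exists>f. C_inf f \<and> g = (\<lambda>x. f (x - h))"
  then obtain f where f: "C_inf f" "g = (\<lambda>x. f (x - h))" by blast
  have "dpart b g = (\<lambda>x. dpart b f (x - h))"
    unfolding f(2) by (rule ext) (intro dpart_translate C_inf_differentiable f)
  then show "\<exists>f. C_inf f \<and> dpart b g = (\<lambda>x. f (x - h))"
    using C_inf_dpart[OF f(1) b] by blast
qed (use assms in blast)

section \<open>The functions exp(-1/t) t^(-k) on t > 0, and a smooth step built from them\<close>

definition flat :: "nat \<Rightarrow> real \<Rightarrow> real" where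
  "flat k t = (if t \<le> 0 then 0 else exp (- inverse t) * inverse t ^ k)"

text \<open>With y = 1/t the right-hand limit is that of y^k / exp y at infinity; on the left the
  function vanishes.\<close>

lemma flat_tendsto_0: "(flat k \<longlongrightarrow> 0) (at 0)"
proof -
  have 1: "((\<lambda>t::real. inverse t ^ k / exp (inverse t)) \<longlongrightarrow> 0) (at_right 0)"
    by (rule filterlim_compose[OF tendsto_power_div_exp_0 filterlim_inverse_at_top_right])
  have "(flat k \<longlongrightarrow> 0) (at_right 0)"
    by (rule Lim_transform_eventually[OF 1])
      (auto simp: eventually_at_right_field flat_def exp_minus divide_inverse mult.commute
        intro!: exI[of _ 1])
  moreover have "(flat k \<longlongrightarrow> 0) (at_left 0)"
    by (rule Lim_transform_eventually[OF tendsto_const])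
      (auto simp: eventually_at_left_field flat_def intro!: exI[of _ "-1"])
  ultimately show ?thesis by (simp add: filterlim_at_split)
qed

text \<open>Differentiating exp(-1/t) t^(-k) gives the same expression with k + 1 and k + 2 in place
  of k. The index exists because only the whole family is closed under differentiation.\<close>

lemma DERIV_flat: "(flat k has_real_derivative (flat (k + 2) t - real k * flat (k + 1) t)) (at t)"
proof -
  consider "t < 0" | "t = 0" | "t > 0" by linarith
  then show ?thesis
  proof cases
    case 1
    have "((\<lambda>_. 0) has_real_derivative (flat (k + 2) t - real k * flat (k + 1) t)) (at t)"
      using 1 by (simp add: flat_def)
    then show ?thesis
      by (rule has_field_derivative_transform_within_open[of _ _ _ "{..<0}"])
        (use 1 in \<open>auto simp: flat_def\<close>)
  next
    case 2
    \<comment> \<open>The difference quotient at 0 is the function of index k + 1, which tends to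
      0.\<close>
    have "((\<lambda>h. flat k h / h) \<longlongrightarrow> 0) (at 0)"
      by (rule Lim_transform_eventually[OF flat_tendsto_0[of "Suc k"]])
        (auto simp: eventually_at_filter flat_def field_simps)
    then show ?thesis using 2 by (simp add: DERIV_def flat_def)
  next
    case 3
    have pow: "m = 0 \<or> t * t ^ (m - Suc 0) = t ^ m" for m
      by (cases m) auto
    have "((\<lambda>t. exp (- inverse t) * inverse t ^ k) has_real_derivative
       (flat (k + 2) t - real k * flat (k + 1) t)) (at t)"
      using 3 pow[of "k - 1"] by (cases k)
        (auto intro!: derivative_eq_intros simp: flat_def power2_eq_square field_simps)
    then show ?thesis
      by (rule has_field_derivative_transform_within_open[of _ _ _ "{0<..}"])
        (use 3 in \<open>auto simp: flat_def\<close>)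
  qed
qed

lemma flat_nonneg: "0 \<le> flat k t"
  by (simp add: flat_def)

lemma flat_le_1: "flat 0 t \<le> 1"
  by (simp add: flat_def)

lemma flat_pos_iff: "0 < flat k t \<longleftrightarrow> 0 < t"
  by (simp add: flat_def)

lemma flat_eq_0_iff: "flat k t = 0 \<longleftrightarrow> t \<le> 0"
  by (simp add: flat_def)

lemma continuous_flat: "continuous_on S (flat k)"
  by (meson DERIV_flat DERIV_isCont continuous_at_imp_continuous_on)

lemma has_derivative_affine_compose:
  fixes F :: "real \<Rightarrow> real" and a :: "'a::euclidean_space"
  assumes "(F has_real_derivative F') (at (a \<bullet> x + d))"
  shows "((\<lambda>x. F (a \<bullet> x + d)) has_derivative (\<lambda>h. F' * (a \<bullet> h))) (at x)"
  by (rule has_derivative_compose[where f = "\<lambda>x. a \<bullet> x + d" and g = F])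
    (use assms in \<open>auto intro!: derivative_eq_intros simp: has_field_derivative_def\<close>)

inductive flat_span :: "('a::euclidean_space \<Rightarrow> real) \<Rightarrow> bool" where
  base: "flat_span (\<lambda>x. r * flat k (a \<bullet> x + d))"
| add: "flat_span f \<Longrightarrow> flat_span g \<Longrightarrow> flat_span (\<lambda>x. f x + g x)"

lemma flat_span_differentiable: "flat_span f \<Longrightarrow> f differentiable (at x)"
proof (induction rule: flat_span.induct)
  case (base r k a d)
  show ?case
    using has_derivative_affine_compose[OF DERIV_flat[of k]]
    by (intro differentiable_mult) (auto simp: differentiable_def)
qed (rule differentiable_add)

lemma flat_span_dpart: "flat_span f \<Longrightarrow> b \<in> Basis \<Longrightarrow> flat_span (dpart b f)"
proof (induction rule: flat_span.induct)
  case (base r k a d)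
  have "((\<lambda>x. r * flat k (a \<bullet> x + d)) has_derivative
      (\<lambda>h. r * ((flat (k + 2) (a \<bullet> x + d) - real k * flat (k + 1) (a \<bullet> x + d)) * (a \<bullet> h)))) (at x)" for x
    by (intro has_derivative_mult_right has_derivative_affine_compose DERIV_flat)
  then have "dpart b (\<lambda>x. r * flat k (a \<bullet> x + d)) x =
      (r * (a \<bullet> b)) * flat (k + 2) (a \<bullet> x + d)
      + (- r * real k * (a \<bullet> b)) * flat (k + 1) (a \<bullet> x + d)" for x
    by (subst dpart_eq) (auto simp: algebra_simps)
  then have "dpart b (\<lambda>x. r * flat k (a \<bullet> x + d)) = (\<lambda>x.
      (r * (a \<bullet> b)) * flat (k + 2) (a \<bullet> x + d)
      + (- r * real k * (a \<bullet> b)) * flat (k + 1) (a \<bullet> x + d))"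
    by blast
  then show ?case by (simp only:) (intro flat_span.intros)
next
  case (add f g)
  have "dpart b (\<lambda>x. f x + g x) = (\<lambda>x. dpart b f x + dpart b g x)"
    by (rule ext) (intro dpart_add flat_span_differentiable add)
  moreover have "flat_span (\<lambda>x. dpart b f x + dpart b g x)"
    by (rule flat_span.add) (use add in simp_all)
  ultimately show ?case by simp
qed

lemma C_inf_flat: "C_inf (\<lambda>x. flat k (a \<bullet> x + d))"
  by (rule C_inf_coinduct[where P = flat_span])
    (use flat_span.base[of 1] in \<open>auto intro: flat_span_differentiable flat_span_dpart\<close>)

text \<open>The step is the normalised antiderivative of the bump exp(-1/t) exp(-1/(1 - t)) on (0,
  1). Smoothness is recorded for compositions with affine functions, because cutoffs on the space
  are products of such compositions over the coordinates.\<close>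

lemma smooth_step_exists:
  "\<exists>s::real \<Rightarrow> real. (\<forall>t\<le>0. s t = 0) \<and> (\<forall>t\<ge>1. s t = 1) \<and> (\<forall>t. 0 \<le> s t \<and> s t \<le> 1) \<and>
     (\<forall>(a::'a::euclidean_space) d. C_inf (\<lambda>x. s (a \<bullet> x + d)))"
proof -
  define \<beta> where "\<beta> t = flat 0 t * flat 0 (1 - t)" for t
  \<comment> \<open>Starting at -1 makes 0 an interior point, so the fundamental theorem of calculus
    gives a two-sided derivative there.\<close>
  define G where "G t = integral {-1..t} \<beta>" for t
  have \<beta>_cont: "continuous_on S \<beta>" for S
    unfolding \<beta>_def
    by (intro continuous_on_mult continuous_on_compose2[OF continuous_flat[of UNIV 0]]
        continuous_on_diff continuous_on_id continuous_on_const) auto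
  have G_neg: "G t = 0" if "t \<le> 0" for t
  proof -
    have "G t = integral {-1..t} (\<lambda>_. 0)"
      unfolding G_def by (rule integral_cong) (use that in \<open>auto simp: \<beta>_def flat_def\<close>)
    then show ?thesis by simp
  qed
  have G_deriv: "(G has_real_derivative \<beta> t) (at t)" for t
  proof (cases "t < 0")
    case True
    have "((\<lambda>_. 0) has_real_derivative \<beta> t) (at t)"
      using True by (simp add: \<beta>_def flat_def)
    then show ?thesis
      by (rule has_field_derivative_transform_within_open[of _ _ _ "{..<0}"])
        (use True G_neg in auto)
  next
    case False
    have "(G has_real_derivative \<beta> t) (at t within {-1..t+1})"
      unfolding G_def by (rule integral_has_real_derivative) (use False \<beta>_cont in auto)
    then show ?thesis
      by (subst (asm) at_within_interior) (use False in auto)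
  qed
  have \<beta>_nonneg: "0 \<le> \<beta> t" for t by (simp add: \<beta>_def flat_nonneg)
  have G_mono: "G s \<le> G t" if "s \<le> t" for s t
    by (rule DERIV_nonneg_imp_nondecreasing[OF that]) (use G_deriv \<beta>_nonneg in blast)
  have G_const: "G t = G 1" if "t \<ge> 1" for t
  proof -
    have "(G has_real_derivative 0) (at x within {1..t})" if "x \<in> {1..t}" for x
      using G_deriv[of x] that has_field_derivative_at_within by (force simp: \<beta>_def flat_def)
    then have "\<exists>c. \<forall>x\<in>{1..t}. G x = c"
      by (intro has_field_derivative_zero_constant) auto
    then show ?thesis using that by fastforce
  qed
  \<comment> \<open>The bump vanishes at 0 and 1, so strict growth is taken on [1/4, 3/4]; it makes
    the normalising value \<open>G 1\<close> positive.\<close>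
  have "G (1/4) < G (3/4)"
    by (rule DERIV_pos_imp_increasing)
      (use G_deriv in \<open>auto simp: \<beta>_def flat_pos_iff intro!: exI mult_pos_pos\<close>)
  moreover have "G 0 \<le> G (1/4)" "G (3/4) \<le> G 1" by (auto intro: G_mono)
  ultimately have G1: "G 1 > 0" using G_neg[of 0] by linarith
  have bounds: "0 \<le> G t" "G t \<le> G 1" for t
    using G_mono[of "min t 0" t] G_neg[of "min t 0"] G_mono[of t "max t 1"] G_const[of "max t 1"]
    by auto
  have smooth: "C_inf (\<lambda>x. G (a \<bullet> x + d) / G 1)" for a :: 'a and d
  proof -
    have der: "((\<lambda>x. G (a \<bullet> x + d) / G 1) has_derivative (\<lambda>h. \<beta> (a \<bullet> x + d) * (a \<bullet> h) / G 1)) (at x)"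
      for x
      using has_derivative_mult_right[OF has_derivative_affine_compose[OF G_deriv], of "inverse (G 1)"]
      by (simp add: divide_inverse mult_ac)
    \<comment> \<open>One derivative turns the step into a product of flat functions, whose
      smoothness is known.\<close>
    have "C_inf (dpart b (\<lambda>x. G (a \<bullet> x + d) / G 1))" for b
    proof -
      have "dpart b (\<lambda>x. G (a \<bullet> x + d) / G 1) =
        (\<lambda>x. ((a \<bullet> b) / G 1) * (flat 0 (a \<bullet> x + d) * flat 0 ((- a) \<bullet> x + (1 - d))))"
        by (rule ext, subst dpart_eq[OF der])
          (simp add: \<beta>_def algebra_simps)
      then show ?thesis
        by (simp only:) (rule C_inf_mult[OF C_inf_const C_inf_mult[OF C_inf_flat C_inf_flat]])
    qed
    moreover have "(\<lambda>x. G (a \<bullet> x + d) / G 1) differentiable (at x)" for x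
      unfolding differentiable_def by (rule exI, rule der)
    ultimately show ?thesis by (intro C_inf_iff[THEN iffD2]) simp
  qed
  show ?thesis
  proof (intro exI[of _ "\<lambda>t. G t / G 1"] conjI allI impI)
    show "G t / G 1 = 1" if "1 \<le> t" for t
      using G_const[OF that] G1 by simp
    show "G t / G 1 \<le> 1" for t
      using bounds(2)[of t] G1 by simp
  qed (use G_neg G1 bounds smooth in simp_all)
qed

section \<open>Test functions\<close>

lemma tsupport_zero: "x \<notin> tsupport \<phi> \<Longrightarrow> \<phi> x = 0"
  unfolding tsupport_def using closure_subset[of "{x. \<phi> x \<noteq> 0}"] by auto

lemma tsupport_minimal: "closed K \<Longrightarrow> (\<And>x. x \<notin> K \<Longrightarrow> \<phi> x = 0) \<Longrightarrow> tsupport \<phi> \<subseteq> K"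
  unfolding tsupport_def by (rule closure_minimal) auto

lemma test_funI:
  assumes "C_inf \<phi>" "compact K" "K \<subseteq> \<Omega>" "\<And>x. x \<notin> K \<Longrightarrow> \<phi> x = 0"
  shows "test_fun \<Omega> \<phi>"
proof -
  have sub: "tsupport \<phi> \<subseteq> K"
    by (rule tsupport_minimal[OF compact_imp_closed[OF assms(2)] assms(4)])
  have "compact (K \<inter> tsupport \<phi>)"
    by (rule compact_Int_closed[OF assms(2)]) (simp add: tsupport_def)
  then have "compact (tsupport \<phi>)" using sub by (simp add: Int_absorb1)
  then show ?thesis unfolding test_fun_def using assms(1,3) sub by simp
qed

lemma test_fun_mono: "test_fun U \<phi> \<Longrightarrow> U \<subseteq> V \<Longrightarrow> test_fun V \<phi>"
  by (auto simp: test_fun_def)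

lemma test_fun_C_inf: "test_fun \<Omega> \<phi> \<Longrightarrow> C_inf \<phi>"
  by (simp add: test_fun_def)

lemma dpart_zero:
  assumes "closed K" "\<And>x. x \<notin> K \<Longrightarrow> \<phi> x = 0" "x \<notin> K"
  shows "dpart b \<phi> x = 0"
proof -
  have "(\<phi> has_derivative (\<lambda>_. 0)) (at x)"
    by (rule has_derivative_transform_within_open[OF has_derivative_const[of 0], of "- K"])
      (simp_all add: assms open_Compl)
  from dpart_eq[OF this] show ?thesis .
qed

lemma test_fun_dpart_zero: "test_fun \<Omega> \<phi> \<Longrightarrow> x \<notin> tsupport \<phi> \<Longrightarrow> dpart b \<phi> x = 0"
  by (rule dpart_zero[of "tsupport \<phi>"]) (simp_all add: tsupport_zero, simp add: tsupport_def)

lemma test_fun_dpart: "test_fun \<Omega> \<phi> \<Longrightarrow> b \<in> Basis \<Longrightarrow> test_fun \<Omega> (dpart b \<phi>)"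
  by (rule test_funI[where K = "tsupport \<phi>"])
    (simp_all add: test_fun_dpart_zero, simp_all add: test_fun_def C_inf_dpart)

lemma test_fun_mult: "C_inf \<eta> \<Longrightarrow> test_fun \<Omega> \<phi> \<Longrightarrow> test_fun \<Omega> (\<lambda>x. \<eta> x * \<phi> x)"
  by (rule test_funI[OF C_inf_mult, where K = "tsupport \<phi>"])
    (auto simp: test_fun_def tsupport_zero)

lemma test_fun_translate:
  assumes "test_fun U \<phi>" "\<And>x. x \<in> U \<Longrightarrow> x + h \<in> \<Omega>"
  shows "test_fun \<Omega> (\<lambda>x. \<phi> (x - h))"
proof (rule test_funI[where K = "(\<lambda>x. x + h) ` tsupport \<phi>"])
  show "C_inf (\<lambda>x. \<phi> (x - h))" by (rule C_inf_translate[OF test_fun_C_inf[OF assms(1)]])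
  show "compact ((\<lambda>x. x + h) ` tsupport \<phi>)"
    using assms(1) by (intro compact_continuous_image continuous_intros) (simp add: test_fun_def)
  show "(\<lambda>x. x + h) ` tsupport \<phi> \<subseteq> \<Omega>"
    using assms unfolding test_fun_def by blast
  show "\<phi> (x - h) = 0" if "x \<notin> (\<lambda>x. x + h) ` tsupport \<phi>" for x
    by (rule tsupport_zero)
      (use that image_eqI[of x "\<lambda>x. x + h" "x - h" "tsupport \<phi>"] in auto)
qed

lemma test_fun_bounded:
  assumes "test_fun \<Omega> \<phi>"
  obtains B where "B > 0" "\<And>x. \<bar>\<phi> x\<bar> \<le> B"
proof -
  have "compact (\<phi> ` tsupport \<phi>)"
    using assms by (intro compact_continuous_image C_inf_continuous) (auto simp: test_fun_def)
  from compact_imp_bounded[OF this] obtain B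
    where B: "B > 0" "\<And>x. x \<in> tsupport \<phi> \<Longrightarrow> \<bar>\<phi> x\<bar> \<le> B"
    unfolding bounded_pos by (metis image_eqI real_norm_def)
  have "\<bar>\<phi> x\<bar> \<le> B" for x
    using B tsupport_zero[of x \<phi>] by (cases "x \<in> tsupport \<phi>") simp_all
  then show ?thesis using that[of B] B(1) by blast
qed

text \<open>Borel measurability is demanded on the whole space so that translates and the map (x, s)
  -> u (x + s h) stay measurable; \<open>lborel\<close> is the measure to which Fubini's theorem and
  translation invariance are applied.\<close>

definition borel_loc_integrable :: "'a::euclidean_space set \<Rightarrow> ('a \<Rightarrow> real) \<Rightarrow> bool" where
  "borel_loc_integrable \<Omega> u \<longleftrightarrow>
     u \<in> borel_measurable borel \<and> (\<forall>K. compact K \<and> K \<subseteq> \<Omega> \<longrightarrow> set_integrable lborel K u)"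

lemma borel_loc_integrable_mono:
  "borel_loc_integrable V u \<Longrightarrow> U \<subseteq> V \<Longrightarrow> borel_loc_integrable U u"
  unfolding borel_loc_integrable_def by blast

lemma integrable_mult_bounded_support:
  fixes u \<phi> :: "'a::euclidean_space \<Rightarrow> real"
  assumes u: "borel_loc_integrable \<Omega> u" and [measurable]: "\<phi> \<in> borel_measurable borel"
    and K: "compact K" "K \<subseteq> \<Omega>" and 0: "\<And>x. x \<notin> K \<Longrightarrow> \<phi> x = 0" and B: "\<And>x. \<bar>\<phi> x\<bar> \<le> B"
  shows "integrable lborel (\<lambda>x. u x * \<phi> x)"
proof -
  have [measurable]: "u \<in> borel_measurable borel"
    using u by (simp add: borel_loc_integrable_def)
  have int: "integrable lborel (\<lambda>x. B * (indicator K x * u x))"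
    using u K unfolding borel_loc_integrable_def set_integrable_def by simp
  show ?thesis
  proof (rule Bochner_Integration.integrable_bound[OF int])
    have "\<bar>u x * \<phi> x\<bar> \<le> \<bar>B * (indicator K x * u x)\<bar>" for x
    proof (cases "x \<in> K")
      case True
      have "\<bar>\<phi> x\<bar> \<le> \<bar>B\<bar>" using B[of x] by linarith
      then have "\<bar>u x\<bar> * \<bar>\<phi> x\<bar> \<le> \<bar>u x\<bar> * \<bar>B\<bar>" by (rule mult_left_mono) simp
      then show ?thesis using True by (simp add: abs_mult mult_ac)
    qed (simp add: 0)
    then show "AE x in lborel. norm (u x * \<phi> x) \<le> norm (B * (indicator K x * u x))"
      by simp
  qed simp
qed

lemma integrable_mult_test_fun:
  assumes "borel_loc_integrable \<Omega> u" "test_fun \<Omega> \<phi>"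
  shows "integrable lborel (\<lambda>x. u x * \<phi> x)"
proof -
  obtain B where "\<And>x. \<bar>\<phi> x\<bar> \<le> B" using test_fun_bounded[OF assms(2)] by blast
  then show ?thesis
    using assms tsupport_zero[of _ \<phi>]
    by (intro integrable_mult_bounded_support[where K = "tsupport \<phi>" and \<Omega> = \<Omega> and B = B] C_inf_measurable)
      (auto simp: test_fun_def)
qed

subsection \<open>The fundamental lemma of the calculus of variations\<close>

text \<open>Inside the open box the approximant is the product over the coordinates of exp(-1/(k
  (x_i - a_i))) exp(-1/(k (b_i - x_i))), and it vanishes elsewhere. Each factor tends to 1 as k
  grows; the indicator of the compact box is the dominating function for later limits.\<close>

lemma box_indicator_test_approximation:
  fixes a b :: "'a::euclidean_space"
  assumes "cbox a b \<subseteq> \<Omega>"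
  obtains \<phi> where "\<And>k. test_fun \<Omega> (\<phi> k)" "\<And>k x. 0 \<le> \<phi> k x" "\<And>k x. \<phi> k x \<le> indicator (cbox a b) x"
    "\<And>x. (\<lambda>k::nat. \<phi> k x) \<longlonglongrightarrow> indicator (box a b) x"
proof
  define f where "f k x i = flat 0 ((real k *\<^sub>R i) \<bullet> x + - real k * (a \<bullet> i))
    * flat 0 ((- real k *\<^sub>R i) \<bullet> x + real k * (b \<bullet> i))" for k :: nat and x i :: 'a
  define \<phi> where "\<phi> k x = (\<Prod>i\<in>Basis. f k x i)" for k x
  have f01: "0 \<le> f k x i" "f k x i \<le> 1" for k x i
    unfolding f_def by (auto intro!: mult_nonneg_nonneg flat_nonneg mult_le_one flat_le_1)
  have f0: "f k x i = 0" if "x \<bullet> i \<le> a \<bullet> i \<or> b \<bullet> i \<le> x \<bullet> i" for k x i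
    using that mult_left_mono[of "x \<bullet> i" "a \<bullet> i" "real k"] mult_left_mono[of "b \<bullet> i" "x \<bullet> i" "real k"]
    by (auto simp: f_def flat_eq_0_iff inner_commute)
  have out: "\<phi> k x = 0" if "x \<notin> box a b" for k x
    using that f0[of x _ k] unfolding \<phi>_def by (force simp: box_def not_less)
  show "test_fun \<Omega> (\<phi> k)" for k
  proof (rule test_funI[where K = "cbox a b"])
    show "C_inf (\<phi> k)"
      unfolding \<phi>_def f_def
      by (rule C_inf_prod[OF finite_Basis]) (rule C_inf_mult[OF C_inf_flat C_inf_flat])
    show "\<phi> k x = 0" if "x \<notin> cbox a b" for x
      using out that box_subset_cbox by blast
  qed (use assms in auto)
  show "0 \<le> \<phi> k x" for k x
    unfolding \<phi>_def by (intro prod_nonneg) (use f01 in blast)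
  show "\<phi> k x \<le> indicator (cbox a b) x" for k x
  proof (cases "x \<in> cbox a b")
    case True
    then show ?thesis unfolding \<phi>_def using f01 by (simp add: prod_le_1)
  next
    case False
    then show ?thesis using out[of x k] box_subset_cbox by fastforce
  qed
  have lim: "(\<lambda>k. flat 0 (real k * c)) \<longlonglongrightarrow> 1" if "c > 0" for c
  proof -
    have "(\<lambda>k. exp (- inverse (real k * c))) \<longlonglongrightarrow> exp (- 0)"
      by (intro tendsto_exp tendsto_minus tendsto_inverse_0_at_top
          filterlim_at_top_mult_tendsto_pos[OF tendsto_const that] filterlim_real_sequentially)
    moreover have "\<forall>\<^sub>F k in sequentially. exp (- inverse (real k * c)) = flat 0 (real k * c)"
    proof (rule eventually_sequentiallyI[of 1])
      fix k :: nat assume "1 \<le> k"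
      then have "real k * c > 0" using that by simp
      then show "exp (- inverse (real k * c)) = flat 0 (real k * c)" by (simp add: flat_def)
    qed
    ultimately have "(\<lambda>k. flat 0 (real k * c)) \<longlonglongrightarrow> exp (- 0)"
      by (rule Lim_transform_eventually)
    then show ?thesis by simp
  qed
  show "(\<lambda>k. \<phi> k x) \<longlonglongrightarrow> indicator (box a b) x" for x
  proof (cases "x \<in> box a b")
    case True
    have "(\<lambda>k. \<phi> k x) \<longlonglongrightarrow> (\<Prod>i\<in>(Basis::'a set). 1 * 1)"
      unfolding \<phi>_def
    proof (rule tendsto_prod)
      fix i :: 'a assume "i \<in> Basis"
      then have i: "a \<bullet> i < x \<bullet> i" "x \<bullet> i < b \<bullet> i" using True by (auto simp: box_def)
      have "f k x i = flat 0 (real k * (x \<bullet> i - a \<bullet> i)) * flat 0 (real k * (b \<bullet> i - x \<bullet> i))" for k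
        by (simp add: f_def algebra_simps inner_commute)
      then show "(\<lambda>k. f k x i) \<longlonglongrightarrow> 1 * 1"
        by (simp only:) (intro tendsto_mult lim; use i in simp)
    qed
    then show ?thesis using True by simp
  next
    case False
    then show ?thesis using out by simp
  qed
qed

text \<open>Open boxes are stable under intersection and generate the Borel sets, while the sets on
  which the integral vanishes are closed under complements and countable disjoint unions. So the
  integral vanishes on every Borel set.\<close>

lemma integral_zero_on_boxes_imp_AE_zero:
  fixes f :: "'a::euclidean_space \<Rightarrow> real"
  assumes int: "set_integrable lborel (box a b) f"
    and 0: "\<And>c d. box c d \<subseteq> box a b \<Longrightarrow> (LINT x:box c d|lborel. f x) = 0"
  shows "AE x in lborel. x \<in> box a b \<longrightarrow> f x = 0"
proof -
  define F where "F x = indicator (box a b) x * f x" for x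
  have F: "integrable lborel F"
    using int unfolding set_integrable_def F_def by simp
  have box: "(LINT x:box c d|lborel. F x) = 0" for c d
  proof -
    obtain c' d' where eq: "box a b \<inter> box c d = box c' d'"
      using that[OF box_Int_box] by blast
    have "(LINT x:box c d|lborel. F x) = (LINT x:box c' d'|lborel. f x)"
      unfolding set_lebesgue_integral_def F_def eq[symmetric]
      by (rule Bochner_Integration.integral_cong) (auto simp: indicator_def)
    then show ?thesis using 0 eq by auto
  qed
  \<comment> \<open>This starts the complement case: the integral over a complement is the total
    minus the integral over the set.\<close>
  have total: "integral\<^sup>L lborel F = 0"
    using 0[of a b] by (simp add: set_lebesgue_integral_def F_def[abs_def])
  have FI: "set_integrable lborel A F" if "A \<in> sets borel" for A
    unfolding set_integrable_def using that F by (intro integrable_mult_indicator) auto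
  have "(LINT x:A|lborel. F x) = 0" if "A \<in> sets lborel" for A
  proof -
    have "Int_stable (range (\<lambda>(a, b). box a b :: 'a set))"
      by (auto simp: Int_stable_def box_Int_box)
    moreover have "range (\<lambda>(a, b). box a b :: 'a set) \<subseteq> Pow UNIV" by simp
    moreover have "A \<in> sigma_sets UNIV (range (\<lambda>(a, b). box a b :: 'a set))"
      using that by (simp add: borel_eq_box)
    ultimately show ?thesis
    proof (induction rule: sigma_sets_induct_disjoint)
      case (basic A)
      then show ?case using box by auto
    next
      case empty
      show ?case by (simp add: set_lebesgue_integral_def)
    next
      case (compl A)
      then have [measurable]: "A \<in> sets borel" by (simp add: borel_eq_box)
      have "integral\<^sup>L lborel F = (LINT x:(A \<union> (UNIV - A))|lborel. F x)"
        by (simp add: set_lebesgue_integral_def Un_Diff_cancel)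
      also have "\<dots> = (LINT x:A|lborel. F x) + (LINT x:UNIV - A|lborel. F x)"
        by (intro set_integral_Un FI) auto
      finally show ?case using compl total by simp
    next
      case (union A)
      then have [measurable]: "A i \<in> sets borel" for i by (auto simp: borel_eq_box)
      have "(LINT x:(\<Union>i. A i)|lborel. F x) = (\<Sum>i. (LINT x:A i|lborel. F x))"
        using union(1) by (intro lebesgue_integral_countable_add FI) (auto simp: disjoint_family_on_def)
      then show ?case using union by simp
    qed
  qed
  then have "AE x in lborel. F x = 0" by (rule sigma_finite_measure.density_zero[OF sigma_finite_lborel F])
  then show ?thesis by eventually_elim (simp add: F_def indicator_def split: if_splits)
qed

text \<open>Dominated convergence carries the hypothesis from test functions to indicators of open
  boxes whose closure lies in \<open>\<Omega>\<close>; sub-boxes of one such box then force f to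
  vanish almost everywhere on it.\<close>

lemma du_Bois_Reymond:
  fixes f :: "'a::euclidean_space \<Rightarrow> real"
  assumes \<Omega>: "open \<Omega>" and f: "borel_loc_integrable \<Omega> f"
    and 0: "\<And>\<phi>. test_fun \<Omega> \<phi> \<Longrightarrow> (LINT x|lborel. f x * \<phi> x) = 0"
  shows "AE x in lborel. x \<in> \<Omega> \<longrightarrow> f x = 0"
proof -
  have [measurable]: "f \<in> borel_measurable borel"
    using f by (simp add: borel_loc_integrable_def)
  have box0: "(LINT x:box a b|lborel. f x) = 0" if ab: "cbox a b \<subseteq> \<Omega>" for a b
  proof -
    obtain \<phi> where \<phi>: "\<And>k. test_fun \<Omega> (\<phi> k)" "\<And>k x. 0 \<le> \<phi> k x"
      "\<And>k x. \<phi> k x \<le> indicator (cbox a b) x" "\<And>x. (\<lambda>k::nat. \<phi> k x) \<longlonglongrightarrow> indicator (box a b) x"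
      by (rule box_indicator_test_approximation[OF ab]) (rule that; assumption)
    have [measurable]: "\<phi> k \<in> borel_measurable borel" for k
      using \<phi>(1) by (intro C_inf_measurable) (simp add: test_fun_def)
    have "(\<lambda>k. LINT x|lborel. f x * \<phi> k x) \<longlonglongrightarrow> (LINT x|lborel. f x * indicator (box a b) x)"
    proof (rule integral_dominated_convergence[where w = "\<lambda>x. \<bar>indicator (cbox a b) x * f x\<bar>"])
      show "integrable lborel (\<lambda>x. \<bar>indicator (cbox a b) x * f x\<bar>)"
        using f that unfolding borel_loc_integrable_def set_integrable_def
        by (intro integrable_abs) auto
      show "AE x in lborel. (\<lambda>k. f x * \<phi> k x) \<longlonglongrightarrow> f x * indicator (box a b) x"
        by (intro AE_I2 tendsto_mult tendsto_const \<phi>)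
      show "AE x in lborel. norm (f x * \<phi> k x) \<le> \<bar>indicator (cbox a b) x * f x\<bar>" for k
      proof (rule AE_I2)
        fix x
        have "\<bar>f x\<bar> * \<phi> k x \<le> \<bar>f x\<bar> * indicator (cbox a b) x"
          by (rule mult_left_mono[OF \<phi>(3)]) simp
        then show "norm (f x * \<phi> k x) \<le> \<bar>indicator (cbox a b) x * f x\<bar>"
          using \<phi>(2)[of k x] by (simp add: abs_mult mult.commute)
      qed
    qed auto
    then show ?thesis
      using 0[OF \<phi>(1)] by (simp add: set_lebesgue_integral_def mult.commute LIMSEQ_const_iff)
  qed
  have AE_box: "AE x in lborel. x \<in> box a b \<longrightarrow> f x = 0" if ab: "cbox a b \<subseteq> \<Omega>" for a b
  proof (rule integral_zero_on_boxes_imp_AE_zero)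
    have "set_integrable lborel (cbox a b) f"
      using f ab by (simp add: borel_loc_integrable_def)
    then show "set_integrable lborel (box a b) f"
      by (rule set_integrable_subset) (auto simp: box_subset_cbox)
    show "(LINT x:box c d|lborel. f x) = 0" if "box c d \<subseteq> box a b" for c d
    proof (cases "box c d = {}")
      case False
      \<comment> \<open>The closure of a nonempty open box is the closed box, so the inclusion
        passes to the closed boxes.\<close>
      then have "cbox c d \<subseteq> cbox a b"
        using closure_mono[OF that] by (cases "box a b = {}") (auto simp: closure_box)
      then show ?thesis using box0[of c d] ab by blast
    qed (simp add: set_lebesgue_integral_def)
  qed
  \<comment> \<open>Countably many of these boxes already cover \<open>\<Omega>\<close>, so the
    exceptional null sets can be united.\<close>
  define \<F> where "\<F> = {box a b | a b. cbox a b \<subseteq> \<Omega>}"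
  have "\<And>S. S \<in> \<F> \<Longrightarrow> open S" by (auto simp: \<F>_def)
  then obtain \<F>' where \<F>': "\<F>' \<subseteq> \<F>" "countable \<F>'" "\<Union>\<F>' = \<Union>\<F>"
    using Lindelof[of \<F>] by blast
  have cover: "\<Omega> \<subseteq> \<Union>\<F>"
  proof
    fix x assume "x \<in> \<Omega>"
    with \<Omega> obtain a b where "cbox a b \<subseteq> \<Omega>" "x \<in> box a b"
      by (meson open_contains_cbox)
    then show "x \<in> \<Union>\<F>" by (auto simp: \<F>_def)
  qed
  have "AE x in lborel. \<forall>S\<in>\<F>'. x \<in> S \<longrightarrow> f x = 0"
    using \<F>'(1) AE_box by (subst AE_ball_countable[OF \<F>'(2)]) (auto simp: \<F>_def)
  then show ?thesis
    by eventually_elim (use cover \<F>'(3) in blast)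
qed

section \<open>Borel representatives of weakly differentiable functions\<close>

text \<open>Local integrability gives measurability only on compact subsets; the truncations to a
  compact exhaustion converge pointwise.\<close>

lemma loc_integrable_set_measurable:
  assumes "open \<Omega>" "loc_integrable \<Omega> u"
  shows "set_borel_measurable lebesgue \<Omega> u"
proof -
  obtain C where C: "\<And>n. compact (C n)" "\<And>n. C n \<subseteq> \<Omega>"
    "\<And>n. C n \<subseteq> interior (C (Suc n))" "\<Union>(range C) = \<Omega>"
    "\<And>K. \<lbrakk>compact K; K \<subseteq> \<Omega>\<rbrakk> \<Longrightarrow> \<exists>N. \<forall>n\<ge>N. K \<subseteq> C n"
    by (rule open_Union_compact_subsets[OF assms(1)]) (rule that; assumption)
  have m: "(\<lambda>x. indicator (C n) x * u x) \<in> borel_measurable lebesgue" for n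
    using assms(2) C(1,2)[of n] unfolding loc_integrable_def set_integrable_def
    by (auto dest: borel_measurable_integrable)
  have lim: "(\<lambda>n. indicator (C n) x * u x) \<longlonglongrightarrow> indicator \<Omega> x * u x" for x
  proof (cases "x \<in> \<Omega>")
    case True
    then obtain N where "\<forall>n\<ge>N. {x} \<subseteq> C n" using C(5)[of "{x}"] by auto
    then show ?thesis
      using True by (intro tendsto_eventually eventually_sequentiallyI[of N]) auto
  next
    case False
    then have "x \<notin> C n" for n using C(2) by blast
    then show ?thesis using False by simp
  qed
  have "(\<lambda>x. indicator \<Omega> x * u x) \<in> borel_measurable lebesgue"
    by (rule borel_measurable_LIMSEQ_real[OF lim m])
  then show ?thesis by (simp add: set_borel_measurable_def)
qed

lemma set_integrable_borel_rep:
  fixes f f' :: "'a::euclidean_space \<Rightarrow> real"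
  assumes f: "set_borel_measurable lebesgue K f" and [measurable]: "f' \<in> borel_measurable borel"
    and K[measurable]: "K \<in> sets borel" and ae: "AE x in lborel. x \<in> K \<longrightarrow> f x = f' x"
  shows "set_integrable lebesgue K f \<longleftrightarrow> set_integrable lborel K f'"
    and "(LINT x:K|lebesgue. f x) = (LINT x:K|lborel. f' x)"
proof -
  have m: "(\<lambda>x. indicator K x *\<^sub>R f' x) \<in> borel_measurable lborel" by simp
  then have m': "(\<lambda>x. indicator K x *\<^sub>R f' x) \<in> borel_measurable lebesgue"
    by (rule measurable_completion)
  have ae': "AE x in lebesgue. indicator K x *\<^sub>R f x = indicator K x *\<^sub>R f' x"
    unfolding AE_completion_iff using ae by eventually_elim (simp add: indicator_def)
  show "set_integrable lebesgue K f \<longleftrightarrow> set_integrable lborel K f'"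
    unfolding set_integrable_def
    using integrable_cong_AE[OF f[unfolded set_borel_measurable_def] m' ae'] integrable_completion[OF m]
    by simp
  show "(LINT x:K|lebesgue. f x) = (LINT x:K|lborel. f' x)"
    unfolding set_lebesgue_integral_def
    using integral_cong_AE[OF f[unfolded set_borel_measurable_def] m' ae'] integral_completion[OF m]
    by simp
qed

text \<open>A function measurable for the completed measure agrees almost everywhere with a Borel
  function, which inherits integrability on compact sets.\<close>

lemma borel_rep_exists:
  assumes "open \<Omega>" "loc_integrable \<Omega> u"
  obtains u' where "borel_loc_integrable \<Omega> u'" "AE x in lborel. x \<in> \<Omega> \<longrightarrow> u x = u' x"
proof -
  have "(\<lambda>x. indicator \<Omega> x * u x) \<in> borel_measurable lebesgue"
    using loc_integrable_set_measurable[OF assms] by (simp add: set_borel_measurable_def)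
  from completion_ex_borel_measurable_real[OF this] obtain u'
    where u': "u' \<in> borel_measurable lborel" and ae: "AE x in lborel. indicator \<Omega> x * u x = u' x"
    by auto
  from ae have ae': "AE x in lborel. x \<in> \<Omega> \<longrightarrow> u x = u' x"
    by eventually_elim (auto simp: indicator_def)
  have "set_integrable lborel K u'" if K: "compact K" "K \<subseteq> \<Omega>" for K
  proof -
    have int: "set_integrable lebesgue K u" using assms K by (simp add: loc_integrable_def)
    have aeK: "AE x in lborel. x \<in> K \<longrightarrow> u x = u' x"
      using ae' by eventually_elim (use K in blast)
    have "set_borel_measurable lebesgue K u"
      using int unfolding set_integrable_def set_borel_measurable_def
      by (rule borel_measurable_integrable)
    moreover have "u' \<in> borel_measurable borel" using u' by simp
    moreover have "K \<in> sets borel" using K by (simp add: compact_imp_closed)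
    ultimately show ?thesis
      using set_integrable_borel_rep(1)[OF _ _ _ aeK] int by simp
  qed
  then have "borel_loc_integrable \<Omega> u'"
    using u' by (simp add: borel_loc_integrable_def)
  then show ?thesis using ae' by (rule that)
qed

lemma borel_loc_integrable_imp_loc_integrable:
  assumes "borel_loc_integrable \<Omega> u"
  shows "loc_integrable \<Omega> u"
  unfolding loc_integrable_def
proof (intro allI impI)
  fix K assume K: "compact K \<and> K \<subseteq> \<Omega>"
  have u: "u \<in> borel_measurable lborel" "set_integrable lborel K u"
    using assms K by (simp_all add: borel_loc_integrable_def)
  have "K \<in> sets borel" using K by (simp add: compact_imp_closed)
  then have "(\<lambda>x. indicator K x *\<^sub>R u x) \<in> borel_measurable lborel" using u(1) by simp
  from integrable_completion[OF this] show "set_integrable lebesgue K u"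
    using u(2) by (simp add: set_integrable_def)
qed

text \<open>Test functions vanish outside \<open>\<Omega>\<close>, so the integrals may run over the whole space.\<close>

definition borel_weak_gradient :: "'a::euclidean_space set \<Rightarrow> ('a \<Rightarrow> real) \<Rightarrow> ('a \<Rightarrow> 'a) \<Rightarrow> bool" where
  "borel_weak_gradient \<Omega> u g \<longleftrightarrow>
     borel_loc_integrable \<Omega> u \<and> g \<in> borel_measurable borel \<and>
     (\<forall>b\<in>Basis. borel_loc_integrable \<Omega> (\<lambda>x. g x \<bullet> b)) \<and>
     (\<forall>\<phi>. test_fun \<Omega> \<phi> \<longrightarrow> (\<forall>b\<in>Basis.
        (LINT x|lborel. u x * dpart b \<phi> x) = - (LINT x|lborel. (g x \<bullet> b) * \<phi> x)))"

lemma borel_weak_gradientD: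
  assumes "borel_weak_gradient \<Omega> u g"
  shows "borel_loc_integrable \<Omega> u" "g \<in> borel_measurable borel" "u \<in> borel_measurable borel"
    "b \<in> Basis \<Longrightarrow> borel_loc_integrable \<Omega> (\<lambda>x. g x \<bullet> b)"
    "test_fun \<Omega> \<phi> \<Longrightarrow> b \<in> Basis \<Longrightarrow>
      (LINT x|lborel. u x * dpart b \<phi> x) = - (LINT x|lborel. (g x \<bullet> b) * \<phi> x)"
  using assms unfolding borel_weak_gradient_def borel_loc_integrable_def by simp_all

lemma borel_weak_gradient_mono:
  "borel_weak_gradient V u g \<Longrightarrow> U \<subseteq> V \<Longrightarrow> borel_weak_gradient U u g"
  unfolding borel_weak_gradient_def
  by (intro conjI ballI allI impI borel_loc_integrable_mono[of V _ U])
    (simp_all add: test_fun_mono[of U _ V])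

lemma LINT_test_rep:
  fixes u u' :: "'a::euclidean_space \<Rightarrow> real"
  assumes \<Omega>: "open \<Omega>" and u: "loc_integrable \<Omega> u" and u': "borel_loc_integrable \<Omega> u'"
    and ae: "AE x in lborel. x \<in> \<Omega> \<longrightarrow> u x = u' x" and \<phi>: "test_fun \<Omega> \<phi>"
  shows "(LINT x:\<Omega>|lebesgue. u x * \<phi> x) = (LINT x|lborel. u' x * \<phi> x)"
proof -
  have [measurable]: "u' \<in> borel_measurable borel" "\<phi> \<in> borel_measurable borel" "\<Omega> \<in> sets borel"
    using u' \<Omega> C_inf_measurable[OF test_fun_C_inf[OF \<phi>]] by (simp_all add: borel_loc_integrable_def)
  have m: "\<phi> \<in> borel_measurable lebesgue"
    by (rule measurable_completion) simp
  have "(\<lambda>x. (indicator \<Omega> x *\<^sub>R u x) * \<phi> x) \<in> borel_measurable lebesgue"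
    using loc_integrable_set_measurable[OF \<Omega> u] m
    unfolding set_borel_measurable_def by (rule borel_measurable_times)
  then have m1: "set_borel_measurable lebesgue \<Omega> (\<lambda>x. u x * \<phi> x)"
    by (simp add: set_borel_measurable_def mult.assoc)
  have "(LINT x:\<Omega>|lebesgue. u x * \<phi> x) = (LINT x:\<Omega>|lborel. u' x * \<phi> x)"
    by (rule set_integrable_borel_rep(2)[OF m1])
      (measurable, use ae in \<open>eventually_elim, simp\<close>)
  also have "\<dots> = (LINT x|lborel. u' x * \<phi> x)"
    unfolding set_lebesgue_integral_def
  proof (rule Bochner_Integration.integral_cong)
    fix x
    have "\<phi> x = 0" if "x \<notin> \<Omega>"
      using that \<phi> by (intro tsupport_zero) (auto simp: test_fun_def)
    then show "indicator \<Omega> x *\<^sub>R (u' x * \<phi> x) = u' x * \<phi> x"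
      by (cases "x \<in> \<Omega>") simp_all
  qed simp
  finally show ?thesis .
qed

lemma borel_weak_gradient_imp_has_weak_gradient:
  assumes "open \<Omega>" and g: "borel_weak_gradient \<Omega> u g"
  shows "has_weak_gradient \<Omega> u g"
  unfolding has_weak_gradient_def
proof (intro conjI ballI allI impI)
  show u: "loc_integrable \<Omega> u"
    by (rule borel_loc_integrable_imp_loc_integrable[OF borel_weak_gradientD(1)[OF g]])
  fix b :: 'a assume b: "b \<in> Basis"
  show gb: "loc_integrable \<Omega> (\<lambda>x. g x \<bullet> b)"
    by (rule borel_loc_integrable_imp_loc_integrable[OF borel_weak_gradientD(4)[OF g b]])
  fix \<phi> assume \<phi>: "test_fun \<Omega> \<phi>"
  have "(LINT x:\<Omega>|lebesgue. u x * dpart b \<phi> x) = (LINT x|lborel. u x * dpart b \<phi> x)"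
    by (rule LINT_test_rep[OF assms(1) u borel_weak_gradientD(1)[OF g] _ test_fun_dpart[OF \<phi> b]]) simp
  moreover have "(LINT x:\<Omega>|lebesgue. (g x \<bullet> b) * \<phi> x) = (LINT x|lborel. (g x \<bullet> b) * \<phi> x)"
    by (rule LINT_test_rep[OF assms(1) gb borel_weak_gradientD(4)[OF g b] _ \<phi>]) simp
  ultimately show "(LINT x:\<Omega>|lebesgue. u x * dpart b \<phi> x)
      = - (LINT x:\<Omega>|lebesgue. (g x \<bullet> b) * \<phi> x)"
    using borel_weak_gradientD(5)[OF g \<phi> b] by simp
qed

text \<open>Local integrability is known for the coordinates of g only, so each coordinate gets its
  own representative; the basis is finite, so the null sets can be united.\<close>

lemma has_weak_gradient_borel_rep:
  fixes g :: "'a::euclidean_space \<Rightarrow> 'a"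
  assumes \<Omega>: "open \<Omega>" and g: "has_weak_gradient \<Omega> u g"
  obtains u' g' where "borel_weak_gradient \<Omega> u' g'" "AE x in lborel. x \<in> \<Omega> \<longrightarrow> u x = u' x"
    "AE x in lborel. x \<in> \<Omega> \<longrightarrow> g x = g' x"
proof -
  have u: "loc_integrable \<Omega> u" and gb: "\<And>b. b \<in> Basis \<Longrightarrow> loc_integrable \<Omega> (\<lambda>x. g x \<bullet> b)"
    and parts: "\<And>\<phi> b. test_fun \<Omega> \<phi> \<Longrightarrow> b \<in> Basis \<Longrightarrow>
      (LINT x:\<Omega>|lebesgue. u x * dpart b \<phi> x) = - (LINT x:\<Omega>|lebesgue. (g x \<bullet> b) * \<phi> x)"
    using g by (simp_all add: has_weak_gradient_def)
  obtain u' where u': "borel_loc_integrable \<Omega> u'" "AE x in lborel. x \<in> \<Omega> \<longrightarrow> u x = u' x"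
    by (rule borel_rep_exists[OF \<Omega> u])
  have "\<forall>b\<in>Basis. \<exists>h. borel_loc_integrable \<Omega> h \<and> (AE x in lborel. x \<in> \<Omega> \<longrightarrow> g x \<bullet> b = h x)"
  proof
    fix b :: 'a assume "b \<in> Basis"
    show "\<exists>h. borel_loc_integrable \<Omega> h \<and> (AE x in lborel. x \<in> \<Omega> \<longrightarrow> g x \<bullet> b = h x)"
      by (rule borel_rep_exists[OF \<Omega> gb[OF \<open>b \<in> Basis\<close>]]) (rule exI, rule conjI)
  qed
  from bchoice[OF this] obtain h
    where h: "\<forall>b\<in>Basis. borel_loc_integrable \<Omega> (h b) \<and> (AE x in lborel. x \<in> \<Omega> \<longrightarrow> g x \<bullet> b = h b x)"
    ..
  define g' where "g' x = (\<Sum>b\<in>Basis. h b x *\<^sub>R b)" for x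
  have g'b: "g' x \<bullet> b = h b x" if "b \<in> Basis" for x b
    using that by (simp add: g'_def inner_sum_left_Basis)
  have "AE x in lborel. \<forall>b\<in>Basis. x \<in> \<Omega> \<longrightarrow> g x \<bullet> b = h b x"
    by (rule AE_finite_allI[OF finite_Basis]) (use h in simp)
  then have ae: "AE x in lborel. x \<in> \<Omega> \<longrightarrow> g x = g' x"
    by eventually_elim (simp add: euclidean_eq_iff[where 'a = 'a] g'b)
  have "borel_weak_gradient \<Omega> u' g'"
    unfolding borel_weak_gradient_def
  proof (intro conjI ballI allI impI)
    have "h b \<in> borel_measurable borel" if "b \<in> Basis" for b
      using h that by (simp add: borel_loc_integrable_def)
    then show "g' \<in> borel_measurable borel"
      unfolding g'_def by simp
    fix b :: 'a assume b: "b \<in> Basis"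
    show hb: "borel_loc_integrable \<Omega> (\<lambda>x. g' x \<bullet> b)"
      using h b g'b by simp
    fix \<phi> assume \<phi>: "test_fun \<Omega> \<phi>"
    have "(LINT x:\<Omega>|lebesgue. u x * dpart b \<phi> x) = (LINT x|lborel. u' x * dpart b \<phi> x)"
      by (rule LINT_test_rep[OF \<Omega> u u' test_fun_dpart[OF \<phi> b]])
    moreover have "(LINT x:\<Omega>|lebesgue. (g x \<bullet> b) * \<phi> x) = (LINT x|lborel. (g' x \<bullet> b) * \<phi> x)"
      by (rule LINT_test_rep[OF \<Omega> gb[OF b] hb _ \<phi>]) (use ae in eventually_elim, simp)
    ultimately show "(LINT x|lborel. u' x * dpart b \<phi> x) = - (LINT x|lborel. (g' x \<bullet> b) * \<phi> x)"
      using parts[OF \<phi> b] by simp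
  qed (rule u')
  then show ?thesis using u'(2) ae by (rule that)
qed

text \<open>Every test function integrates to zero against the difference of the gradients,
  coordinate by coordinate. This is why the choice hidden in \<open>weak_grad\<close> does not
  affect the seminorms.\<close>

lemma borel_weak_gradient_unique:
  fixes g1 g2 :: "'a::euclidean_space \<Rightarrow> 'a"
  assumes \<Omega>: "open \<Omega>" and g1: "borel_weak_gradient \<Omega> u1 g1" and g2: "borel_weak_gradient \<Omega> u2 g2"
    and ae: "AE x in lborel. x \<in> \<Omega> \<longrightarrow> u1 x = u2 x"
  shows "AE x in lborel. x \<in> \<Omega> \<longrightarrow> g1 x = g2 x"
proof -
  have "AE x in lborel. x \<in> \<Omega> \<longrightarrow> g1 x \<bullet> b = g2 x \<bullet> b" if b: "b \<in> Basis" for b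
  proof -
    note l1 = borel_weak_gradientD(4)[OF g1 b] and l2 = borel_weak_gradientD(4)[OF g2 b]
    have "AE x in lborel. x \<in> \<Omega> \<longrightarrow> g1 x \<bullet> b - g2 x \<bullet> b = 0"
    proof (rule du_Bois_Reymond[OF \<Omega>])
      show "borel_loc_integrable \<Omega> (\<lambda>x. g1 x \<bullet> b - g2 x \<bullet> b)"
        using l1 l2 by (simp add: borel_loc_integrable_def set_integral_diff borel_measurable_diff)
      fix \<phi> assume \<phi>: "test_fun \<Omega> \<phi>"
      have "(LINT x|lborel. (g1 x \<bullet> b - g2 x \<bullet> b) * \<phi> x)
        = (LINT x|lborel. (g1 x \<bullet> b) * \<phi> x) - (LINT x|lborel. (g2 x \<bullet> b) * \<phi> x)"
        unfolding left_diff_distrib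
        by (rule Bochner_Integration.integral_diff)
          (rule integrable_mult_test_fun[OF l1 \<phi>], rule integrable_mult_test_fun[OF l2 \<phi>])
      also have "\<dots> = (LINT x|lborel. u2 x * dpart b \<phi> x) - (LINT x|lborel. u1 x * dpart b \<phi> x)"
        using borel_weak_gradientD(5)[OF g1 \<phi> b] borel_weak_gradientD(5)[OF g2 \<phi> b] by simp
      also have "(LINT x|lborel. u1 x * dpart b \<phi> x) = (LINT x|lborel. u2 x * dpart b \<phi> x)"
      proof (rule integral_cong_AE)
        show "(\<lambda>x. u1 x * dpart b \<phi> x) \<in> borel_measurable lborel"
          by (rule borel_measurable_integrable)
            (rule integrable_mult_test_fun[OF borel_weak_gradientD(1)[OF g1] test_fun_dpart[OF \<phi> b]])
        show "(\<lambda>x. u2 x * dpart b \<phi> x) \<in> borel_measurable lborel"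
          by (rule borel_measurable_integrable)
            (rule integrable_mult_test_fun[OF borel_weak_gradientD(1)[OF g2] test_fun_dpart[OF \<phi> b]])
        have out: "dpart b \<phi> x = 0" if "x \<notin> \<Omega>" for x
          using that \<phi> by (intro test_fun_dpart_zero[OF \<phi>]) (auto simp: test_fun_def)
        show "AE x in lborel. u1 x * dpart b \<phi> x = u2 x * dpart b \<phi> x"
          using ae
        proof eventually_elim
          case (elim x)
          then show ?case using out[of x] by (cases "x \<in> \<Omega>") simp_all
        qed
      qed
      finally show "(LINT x|lborel. (g1 x \<bullet> b - g2 x \<bullet> b) * \<phi> x) = 0" by simp
    qed
    then show ?thesis by eventually_elim simp
  qed
  then have "AE x in lborel. \<forall>b\<in>Basis. x \<in> \<Omega> \<longrightarrow> g1 x \<bullet> b = g2 x \<bullet> b"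
    by (rule AE_finite_allI[OF finite_Basis])
  then show ?thesis
    by eventually_elim (simp add: euclidean_eq_iff[where 'a = 'a])
qed

section \<open>Sobolev seminorms in terms of Borel representatives\<close>

text \<open>This is the p-th power of the p-norm, without the root and possibly infinite, so that
  estimates can be written before any integrability is known.\<close>

definition Lp_int :: "real \<Rightarrow> 'a::euclidean_space set \<Rightarrow> ('a \<Rightarrow> 'b::real_normed_vector) \<Rightarrow> ennreal" where
  "Lp_int p A f = (\<integral>\<^sup>+x\<in>A. ennreal (norm (f x) powr p) \<partial>lborel)"

lemma Lp_int_cong_AE:
  assumes "AE x in lborel. x \<in> A \<longrightarrow> f x = g x"
  shows "Lp_int p A f = Lp_int p A g"
  unfolding Lp_int_def
  by (rule nn_integral_cong_AE) (use assms in \<open>eventually_elim, auto simp: indicator_def\<close>)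

lemma Lp_int_mono_set: "A \<subseteq> B \<Longrightarrow> Lp_int p A f \<le> Lp_int p B f"
  unfolding Lp_int_def by (intro nn_integral_mono) (auto simp: indicator_def)

lemma Lp_int_Un_le:
  fixes f :: "'a::euclidean_space \<Rightarrow> 'b::euclidean_space"
  assumes [measurable]: "f \<in> borel_measurable borel" "A \<in> sets borel" "B \<in> sets borel"
  shows "Lp_int p (A \<union> B) f \<le> Lp_int p A f + Lp_int p B f"
proof -
  have "Lp_int p (A \<union> B) f \<le> (\<integral>\<^sup>+x. ennreal (norm (f x) powr p) * indicator A x
      + ennreal (norm (f x) powr p) * indicator B x \<partial>lborel)"
    unfolding Lp_int_def by (intro nn_integral_mono) (auto simp: indicator_def)
  also have "\<dots> = Lp_int p A f + Lp_int p B f"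
    unfolding Lp_int_def by (rule nn_integral_add) measurable
  finally show ?thesis .
qed

text \<open>One of the two norms is at least half the norm of the sum.\<close>

lemma norm_add_powr_le:
  fixes a b :: "'a::real_normed_vector"
  assumes "p \<ge> 0"
  shows "norm (a + b) powr p \<le> 2 powr p * (norm a powr p + norm b powr p)"
proof -
  have "norm (a + b) \<le> 2 * max (norm a) (norm b)"
    using norm_triangle_ineq[of a b] by linarith
  then have "norm (a + b) powr p \<le> (2 * max (norm a) (norm b)) powr p"
    by (intro powr_mono2 assms) simp_all
  also have "\<dots> = 2 powr p * max (norm a) (norm b) powr p"
    by (rule powr_mult)
  also have "\<dots> \<le> 2 powr p * (norm a powr p + norm b powr p)"
    by (intro mult_left_mono) (simp_all add: max_def)
  finally show ?thesis .
qed

lemma Lp_int_add_le: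
  fixes f g :: "'a::euclidean_space \<Rightarrow> 'b::euclidean_space"
  assumes [measurable]: "f \<in> borel_measurable borel" "g \<in> borel_measurable borel" "A \<in> sets borel"
    and "p \<ge> 0"
  shows "Lp_int p A (\<lambda>x. f x + g x) \<le> ennreal (2 powr p) * (Lp_int p A f + Lp_int p A g)"
proof -
  have "Lp_int p A (\<lambda>x. f x + g x) \<le> (\<integral>\<^sup>+x. ennreal (2 powr p) * (ennreal (norm (f x) powr p) * indicator A x
      + ennreal (norm (g x) powr p) * indicator A x) \<partial>lborel)"
    unfolding Lp_int_def
  proof (rule nn_integral_mono)
    fix x
    have "ennreal (norm (f x + g x) powr p) \<le> ennreal (2 powr p * (norm (f x) powr p + norm (g x) powr p))"
      by (intro ennreal_leI norm_add_powr_le assms)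
    also have "\<dots> = ennreal (2 powr p) * (ennreal (norm (f x) powr p) + ennreal (norm (g x) powr p))"
      by (simp add: ennreal_mult)
    finally show "ennreal (norm (f x + g x) powr p) * indicator A x
      \<le> ennreal (2 powr p) * (ennreal (norm (f x) powr p) * indicator A x
      + ennreal (norm (g x) powr p) * indicator A x)"
      by (cases "x \<in> A") simp_all
  qed
  also have "\<dots> = ennreal (2 powr p) * (\<integral>\<^sup>+x. ennreal (norm (f x) powr p) * indicator A x
      + ennreal (norm (g x) powr p) * indicator A x \<partial>lborel)"
    by (rule nn_integral_cmult) measurable
  also have "(\<integral>\<^sup>+x. ennreal (norm (f x) powr p) * indicator A x
      + ennreal (norm (g x) powr p) * indicator A x \<partial>lborel) = Lp_int p A f + Lp_int p A g"
    unfolding Lp_int_def by (rule nn_integral_add) measurable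
  finally show ?thesis .
qed

lemma Lp_int_const:
  assumes "A \<in> sets borel"
  shows "Lp_int p A (\<lambda>x. c) = ennreal (norm c powr p) * emeasure lborel A"
  unfolding Lp_int_def using assms by (simp add: nn_integral_cmult_indicator)

lemma Lp_int_rep:
  fixes f f' :: "'a::euclidean_space \<Rightarrow> 'b::euclidean_space"
  assumes f: "set_borel_measurable lebesgue \<Omega> f" and [measurable]: "f' \<in> borel_measurable borel"
    and \<Omega>[measurable]: "\<Omega> \<in> sets borel" and ae: "AE x in lborel. x \<in> \<Omega> \<longrightarrow> f x = f' x"
  shows "set_integrable lebesgue \<Omega> (\<lambda>x. norm (f x) powr p) \<longleftrightarrow> Lp_int p \<Omega> f' < \<infinity>"
    and "(LINT x:\<Omega>|lebesgue. norm (f x) powr p) = enn2real (Lp_int p \<Omega> f')"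
    and "set_borel_measurable lebesgue \<Omega> (\<lambda>x. norm (f x) powr p)"
proof -
  have "(\<lambda>x. indicator \<Omega> x :: real) \<in> borel_measurable lborel" by simp
  then have ind: "(\<lambda>x. indicator \<Omega> x :: real) \<in> borel_measurable lebesgue"
    by (rule measurable_completion)
  \<comment> \<open>Only the product of f with the indicator is known to be measurable, so the power
    is formed of that product and cut off again.\<close>
  have "(\<lambda>x. norm (indicator \<Omega> x *\<^sub>R f x) powr p) \<in> borel_measurable lebesgue"
    by (rule powr_real_measurable[OF
          measurable_compose[OF f[unfolded set_borel_measurable_def] borel_measurable_norm]
          borel_measurable_const])
  from borel_measurable_times[OF ind this]
  have "(\<lambda>x. indicator \<Omega> x * norm (indicator \<Omega> x *\<^sub>R f x) powr p) \<in> borel_measurable lebesgue" .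
  also have "(\<lambda>x. indicator \<Omega> x * norm (indicator \<Omega> x *\<^sub>R f x) powr p)
      = (\<lambda>x. indicator \<Omega> x *\<^sub>R norm (f x) powr p)"
    by (rule ext) (simp add: indicator_def)
  finally show m: "set_borel_measurable lebesgue \<Omega> (\<lambda>x. norm (f x) powr p)"
    by (simp add: set_borel_measurable_def)
  have ae': "AE x in lborel. x \<in> \<Omega> \<longrightarrow> norm (f x) powr p = norm (f' x) powr p"
    using ae by eventually_elim simp
  have m': "(\<lambda>x. norm (f' x) powr p) \<in> borel_measurable borel" by simp
  have nn: "(\<integral>\<^sup>+x. ennreal (indicator \<Omega> x *\<^sub>R norm (f' x) powr p) \<partial>lborel) = Lp_int p \<Omega> f'"
    unfolding Lp_int_def by (rule nn_integral_cong) (simp add: indicator_def)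
  have "set_integrable lborel \<Omega> (\<lambda>x. norm (f' x) powr p) \<longleftrightarrow> Lp_int p \<Omega> f' < \<infinity>"
    unfolding set_integrable_def integrable_iff_bounded using nn by simp
  then show "set_integrable lebesgue \<Omega> (\<lambda>x. norm (f x) powr p) \<longleftrightarrow> Lp_int p \<Omega> f' < \<infinity>"
    using set_integrable_borel_rep(1)[OF m m' \<Omega> ae'] by simp
  have "(LINT x:\<Omega>|lborel. norm (f' x) powr p) = enn2real (Lp_int p \<Omega> f')"
    unfolding set_lebesgue_integral_def nn[symmetric]
    by (rule integral_eq_nn_integral) simp_all
  then show "(LINT x:\<Omega>|lebesgue. norm (f x) powr p) = enn2real (Lp_int p \<Omega> f')"
    using set_integrable_borel_rep(2)[OF m m' \<Omega> ae'] by simp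
qed

lemma has_weak_gradient_measurable:
  assumes "open \<Omega>" "has_weak_gradient \<Omega> u g"
  shows "set_borel_measurable lebesgue \<Omega> u" "set_borel_measurable lebesgue \<Omega> g"
proof -
  show "set_borel_measurable lebesgue \<Omega> u"
    using assms by (simp add: has_weak_gradient_def loc_integrable_set_measurable)
  show "set_borel_measurable lebesgue \<Omega> g"
    unfolding set_borel_measurable_def
  proof (subst borel_measurable_euclidean_space, rule ballI)
    fix b :: 'a assume "b \<in> Basis"
    then have "loc_integrable \<Omega> (\<lambda>x. g x \<bullet> b)"
      using assms by (simp add: has_weak_gradient_def)
    from loc_integrable_set_measurable[OF assms(1) this]
    show "(\<lambda>x. (indicator \<Omega> x *\<^sub>R g x) \<bullet> b) \<in> borel_measurable lebesgue"
      by (simp add: set_borel_measurable_def)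
  qed
qed

text \<open>Membership in \<open>L1p\<close> supplies one gradient with finite p-integral, whereas
  \<open>weak_grad\<close> may pick another. Both get Borel representatives, and uniqueness
  transfers finiteness to the picked one.\<close>

lemma L1p_borel_rep:
  fixes u :: "'a::euclidean_space \<Rightarrow> real"
  assumes \<Omega>: "open \<Omega>" and u: "u \<in> L1p \<Omega> p"
  obtains u' g' where "borel_weak_gradient \<Omega> u' g'" "AE x in lborel. x \<in> \<Omega> \<longrightarrow> u x = u' x"
    "Lp_int p \<Omega> g' < \<infinity>"
    "(LINT x:\<Omega>|lebesgue. norm (weak_grad \<Omega> u x) powr p) = enn2real (Lp_int p \<Omega> g')"
    "in_Lp \<Omega> p u \<longleftrightarrow> Lp_int p \<Omega> u' < \<infinity>"
    "in_Lp \<Omega> p u \<Longrightarrow> (LINT x:\<Omega>|lebesgue. \<bar>u x\<bar> powr p + norm (weak_grad \<Omega> u x) powr p)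
        = enn2real (Lp_int p \<Omega> u') + enn2real (Lp_int p \<Omega> g')"
proof -
  have \<Omega>b: "\<Omega> \<in> sets borel" using \<Omega> by simp
  obtain g1 where g1: "has_weak_gradient \<Omega> u g1" and Lp: "in_Lp \<Omega> p (\<lambda>x. norm (g1 x))"
    using u by (auto simp: L1p_def)
  define g where "g = weak_grad \<Omega> u"
  have g: "has_weak_gradient \<Omega> u g"
    unfolding g_def weak_grad_def by (rule someI[of _ g1]) (rule g1)
  obtain u1 g1' where 1: "borel_weak_gradient \<Omega> u1 g1'" "AE x in lborel. x \<in> \<Omega> \<longrightarrow> u x = u1 x"
    "AE x in lborel. x \<in> \<Omega> \<longrightarrow> g1 x = g1' x"
    by (rule has_weak_gradient_borel_rep[OF \<Omega> g1])
  obtain u2 g2 where 2: "borel_weak_gradient \<Omega> u2 g2" "AE x in lborel. x \<in> \<Omega> \<longrightarrow> u x = u2 x"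
    "AE x in lborel. x \<in> \<Omega> \<longrightarrow> g x = g2 x"
    by (rule has_weak_gradient_borel_rep[OF \<Omega> g])
  have "AE x in lborel. x \<in> \<Omega> \<longrightarrow> u2 x = u1 x"
    using 1(2) 2(2) by eventually_elim simp
  then have "AE x in lborel. x \<in> \<Omega> \<longrightarrow> g2 x = g1' x"
    by (rule borel_weak_gradient_unique[OF \<Omega> 2(1) 1(1)])
  then have eq: "Lp_int p \<Omega> g2 = Lp_int p \<Omega> g1'"
    by (rule Lp_int_cong_AE)
  have "set_integrable lebesgue \<Omega> (\<lambda>x. norm (g1 x) powr p)"
    using Lp by (simp add: in_Lp_def)
  then have fin: "Lp_int p \<Omega> g2 < \<infinity>"
    unfolding eq
    using Lp_int_rep(1)[OF has_weak_gradient_measurable(2)[OF \<Omega> g1] borel_weak_gradientD(2)[OF 1(1)] \<Omega>b 1(3)]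
    by simp
  note ru = Lp_int_rep[OF has_weak_gradient_measurable(1)[OF \<Omega> g] borel_weak_gradientD(3)[OF 2(1)] \<Omega>b 2(2), of p]
  note rg = Lp_int_rep[OF has_weak_gradient_measurable(2)[OF \<Omega> g] borel_weak_gradientD(2)[OF 2(1)] \<Omega>b 2(3), of p]
  have inLp: "in_Lp \<Omega> p u \<longleftrightarrow> Lp_int p \<Omega> u2 < \<infinity>"
    using ru(1) has_weak_gradient_measurable(1)[OF \<Omega> g] by (simp add: in_Lp_def)
  show ?thesis
  proof (rule that[OF 2(1,2) fin _ inLp])
    show "(LINT x:\<Omega>|lebesgue. norm (weak_grad \<Omega> u x) powr p) = enn2real (Lp_int p \<Omega> g2)"
      using rg(2) by (simp add: g_def)
    assume "in_Lp \<Omega> p u"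
    then have "set_integrable lebesgue \<Omega> (\<lambda>x. norm (u x) powr p)"
      using inLp ru(1) by simp
    moreover have "set_integrable lebesgue \<Omega> (\<lambda>x. norm (g x) powr p)"
      using fin rg(1) by simp
    ultimately show "(LINT x:\<Omega>|lebesgue. \<bar>u x\<bar> powr p + norm (weak_grad \<Omega> u x) powr p)
        = enn2real (Lp_int p \<Omega> u2) + enn2real (Lp_int p \<Omega> g2)"
      using set_integral_add(2)[of lebesgue \<Omega> "\<lambda>x. norm (u x) powr p" "\<lambda>x. norm (g x) powr p"] ru(2) rg(2)
      by (simp add: g_def)
  qed
qed

text \<open>The way back from Borel representatives: the gradient picked in the norms has the same
  p-integral as g, again by uniqueness.\<close>

lemma borel_weak_gradient_L1p:
  fixes u :: "'a::euclidean_space \<Rightarrow> real"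
  assumes \<Omega>: "open \<Omega>" and g: "borel_weak_gradient \<Omega> u g" and fin: "Lp_int p \<Omega> g < \<infinity>"
  shows "u \<in> L1p \<Omega> p"
    and "L1p_norm \<Omega> p u = enn2real (Lp_int p \<Omega> g) powr (1/p)"
    and "Lp_int p \<Omega> u < \<infinity> \<Longrightarrow> u \<in> W1p \<Omega> p"
    and "Lp_int p \<Omega> u < \<infinity> \<Longrightarrow>
      W1p_norm \<Omega> p u = (enn2real (Lp_int p \<Omega> u) + enn2real (Lp_int p \<Omega> g)) powr (1/p)"
proof -
  have \<Omega>b: "\<Omega> \<in> sets borel" using \<Omega> by simp
  have w: "has_weak_gradient \<Omega> u g"
    by (rule borel_weak_gradient_imp_has_weak_gradient[OF \<Omega> g])
  \<comment> \<open>The second fact is the measurability clause at exponent 1, where the power of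
    the norm is the norm itself.\<close>
  have rg: "set_integrable lebesgue \<Omega> (\<lambda>x. norm (g x) powr p)"
    "set_borel_measurable lebesgue \<Omega> (\<lambda>x. norm (g x))"
    using Lp_int_rep(1)[OF has_weak_gradient_measurable(2)[OF \<Omega> w] borel_weak_gradientD(2)[OF g] \<Omega>b, of p]
      Lp_int_rep(3)[OF has_weak_gradient_measurable(2)[OF \<Omega> w] borel_weak_gradientD(2)[OF g] \<Omega>b, of 1] fin
    by simp_all
  show u: "u \<in> L1p \<Omega> p"
    unfolding L1p_def in_Lp_def using w rg by auto
  obtain u' g' where r: "borel_weak_gradient \<Omega> u' g'" "AE x in lborel. x \<in> \<Omega> \<longrightarrow> u x = u' x"
    "(LINT x:\<Omega>|lebesgue. norm (weak_grad \<Omega> u x) powr p) = enn2real (Lp_int p \<Omega> g')"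
    "in_Lp \<Omega> p u \<longleftrightarrow> Lp_int p \<Omega> u' < \<infinity>"
    "in_Lp \<Omega> p u \<Longrightarrow> (LINT x:\<Omega>|lebesgue. \<bar>u x\<bar> powr p + norm (weak_grad \<Omega> u x) powr p)
        = enn2real (Lp_int p \<Omega> u') + enn2real (Lp_int p \<Omega> g')"
    by (rule L1p_borel_rep[OF \<Omega> u]) (rule that; assumption)
  have gg: "Lp_int p \<Omega> g' = Lp_int p \<Omega> g"
    by (rule Lp_int_cong_AE[OF borel_weak_gradient_unique[OF \<Omega> r(1) g]])
      (use r(2) in \<open>eventually_elim, simp\<close>)
  have uu: "Lp_int p \<Omega> u' = Lp_int p \<Omega> u"
    by (rule Lp_int_cong_AE) (use r(2) in \<open>eventually_elim, simp\<close>)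
  show "L1p_norm \<Omega> p u = enn2real (Lp_int p \<Omega> g) powr (1/p)"
    unfolding L1p_norm_def r(3) gg ..
  assume "Lp_int p \<Omega> u < \<infinity>"
  then have inu: "in_Lp \<Omega> p u" using r(4) uu by simp
  then show "u \<in> W1p \<Omega> p" using u by (simp add: W1p_def)
  show "W1p_norm \<Omega> p u = (enn2real (Lp_int p \<Omega> u) + enn2real (Lp_int p \<Omega> g)) powr (1/p)"
    unfolding W1p_norm_def r(5)[OF inu] gg uu ..
qed

section \<open>Jensen's inequality for powers\<close>

text \<open>Convexity of the power on the open half-line covers x > 0; at x = 0 the tangent has the
  value (1 - p) m^p, which is nonpositive.\<close>

lemma powr_tangent:
  fixes p m x :: real
  assumes "p \<ge> 1" "m > 0" "x \<ge> 0"
  shows "m powr p + p * m powr (p - 1) * (x - m) \<le> x powr p"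
proof (cases "x = 0")
  case True
  have "m powr p = m powr (p - 1) * m"
    using assms powr_add[of m "p - 1" 1] by simp
  then have "m powr p + p * m powr (p - 1) * (x - m) = (1 - p) * m powr p"
    using True by (simp add: algebra_simps)
  also have "\<dots> \<le> 0" using assms by (intro mult_nonpos_nonneg) simp_all
  finally show ?thesis using True by simp
next
  case False
  have "x powr p - m powr p \<ge> (p * m powr (p - 1)) * (x - m)"
  proof (rule convex_on_imp_above_tangent[of "{0<..}"])
    show "convex_on {0<..} (\<lambda>x. x powr p)" by (rule powr_convex[OF assms(1)])
    show "((\<lambda>x. x powr p) has_real_derivative p * m powr (p - 1)) (at m within {0<..})"
      using has_real_derivative_powr[OF assms(2), of p] by (rule has_field_derivative_at_within)
  qed (use assms False in \<open>simp_all add: interior_open\<close>)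
  then show ?thesis by linarith
qed

text \<open>For y >= 0 and p >= 1 one has y <= 1 + y^p, and constants are integrable over a set of
  finite measure.\<close>

lemma set_integrable_if_powr:
  fixes f :: "'a \<Rightarrow> real"
  assumes p: "p \<ge> 1" and f[measurable]: "f \<in> borel_measurable M" and A[measurable]: "A \<in> sets M"
    and fin: "emeasure M A < \<infinity>" and powr: "(\<integral>\<^sup>+x\<in>A. ennreal (\<bar>f x\<bar> powr p) \<partial>M) < \<infinity>"
  shows "set_integrable M A f"
proof -
  have nn: "(\<integral>\<^sup>+x. ennreal (indicator A x * \<bar>f x\<bar> powr p) \<partial>M) = (\<integral>\<^sup>+x\<in>A. ennreal (\<bar>f x\<bar> powr p) \<partial>M)"
    by (rule nn_integral_cong) (simp add: indicator_def)
  have int_p: "integrable M (\<lambda>x. indicator A x * \<bar>f x\<bar> powr p)"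
    using powr nn by (intro integrableI_bounded) simp_all
  have int_1: "integrable M (\<lambda>x. indicator A x :: real)"
    using fin by (intro integrable_real_indicator) simp_all
  show ?thesis
    unfolding set_integrable_def
  proof (rule Bochner_Integration.integrable_bound[OF Bochner_Integration.integrable_add[OF int_1 int_p]])
    have "y \<le> 1 + y powr p" if "y \<ge> 0" for y :: real
    proof (cases "y \<le> 1")
      case True
      then show ?thesis using powr_ge_zero[of y p] by linarith
    next
      case False
      then have "y powr 1 \<le> y powr p" using p by (intro powr_mono) simp_all
      then show ?thesis using False by simp
    qed
    then have "norm (indicator A x *\<^sub>R f x) \<le> norm (indicator A x + indicator A x * \<bar>f x\<bar> powr p)" for x
      by (cases "x \<in> A") simp_all
    then show "AE x in M. norm (indicator A x *\<^sub>R f x) \<le> norm (indicator A x + indicator A x * \<bar>f x\<bar> powr p)"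
      by simp
  qed simp
qed

text \<open>Let m be the average of |f| over A. Integrating the tangent inequality at m makes the
  linear terms cancel and leaves V m^p. The case m = 0 is separate because the point of contact must
  be positive, and an infinite right-hand side leaves nothing to prove.\<close>

lemma jensen_powr:
  fixes f :: "'a \<Rightarrow> real"
  assumes p: "p \<ge> 1" and f[measurable]: "f \<in> borel_measurable M" and A[measurable]: "A \<in> sets M"
    and fin: "emeasure M A < \<infinity>" and V: "V = measure M A" "V > 0"
  shows "ennreal (V * \<bar>(LINT x:A|M. f x) / V\<bar> powr p) \<le> (\<integral>\<^sup>+x\<in>A. ennreal (\<bar>f x\<bar> powr p) \<partial>M)"
proof (cases "(\<integral>\<^sup>+x\<in>A. ennreal (\<bar>f x\<bar> powr p) \<partial>M) = \<infinity>")
  case False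
  have nn: "(\<integral>\<^sup>+x. ennreal (indicator A x * \<bar>f x\<bar> powr p) \<partial>M) = (\<integral>\<^sup>+x\<in>A. ennreal (\<bar>f x\<bar> powr p) \<partial>M)"
    by (rule nn_integral_cong) (simp add: indicator_def)
  have int_p: "integrable M (\<lambda>x. indicator A x * \<bar>f x\<bar> powr p)"
    using False nn by (intro integrableI_bounded) (simp_all add: less_top)
  have int_1: "integrable M (\<lambda>x. indicator A x :: real)"
    using fin by (intro integrable_real_indicator) simp_all
  have "set_integrable M A f"
    using False by (intro set_integrable_if_powr[OF p f A fin]) (simp add: less_top)
  from integrable_abs[OF this[unfolded set_integrable_def]]
  have int_f: "integrable M (\<lambda>x. indicator A x * \<bar>f x\<bar>)"
    by (simp add: abs_mult)
  define m where "m = (\<integral>x. indicator A x * \<bar>f x\<bar> \<partial>M) / V"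
  have m0: "m \<ge> 0" unfolding m_def using V(2) by (intro divide_nonneg_pos integral_nonneg_AE) simp_all
  have "\<bar>LINT x:A|M. f x\<bar> \<le> (\<integral>x. indicator A x * \<bar>f x\<bar> \<partial>M)"
    unfolding set_lebesgue_integral_def
    using integral_norm_bound[of M "\<lambda>x. indicator A x *\<^sub>R f x"] by (simp add: abs_mult)
  then have "\<bar>(LINT x:A|M. f x) / V\<bar> \<le> m"
    unfolding m_def using V(2) by (simp add: divide_right_mono)
  then have "V * \<bar>(LINT x:A|M. f x) / V\<bar> powr p \<le> V * m powr p"
    using V(2) p by (intro mult_left_mono powr_mono2) simp_all
  also have "V * m powr p \<le> (\<integral>x. indicator A x * \<bar>f x\<bar> powr p \<partial>M)"
  proof (cases "m = 0")
    case True
    then show ?thesis by (simp add: integral_nonneg_AE)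
  next
    case False
    with m0 have m: "m > 0" by simp
    have mV: "(\<integral>x. indicator A x * \<bar>f x\<bar> \<partial>M) = m * V" using V(2) by (simp add: m_def)
    have "(\<integral>x. (m powr p - p * m powr (p - 1) * m) * indicator A x
          + (p * m powr (p - 1)) * (indicator A x * \<bar>f x\<bar>) \<partial>M)
        \<le> (\<integral>x. indicator A x * \<bar>f x\<bar> powr p \<partial>M)"
    proof (rule integral_mono[OF _ int_p])
      show "integrable M (\<lambda>x. (m powr p - p * m powr (p - 1) * m) * indicator A x
          + (p * m powr (p - 1)) * (indicator A x * \<bar>f x\<bar>))"
        by (intro Bochner_Integration.integrable_add integrable_mult_right int_1 int_f)
      show "(m powr p - p * m powr (p - 1) * m) * indicator A x
          + (p * m powr (p - 1)) * (indicator A x * \<bar>f x\<bar>) \<le> indicator A x * \<bar>f x\<bar> powr p" for x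
        using powr_tangent[OF p m, of "\<bar>f x\<bar>"] by (cases "x \<in> A") (simp_all add: algebra_simps)
    qed
    also have "(\<integral>x. (m powr p - p * m powr (p - 1) * m) * indicator A x
          + (p * m powr (p - 1)) * (indicator A x * \<bar>f x\<bar>) \<partial>M)
        = (m powr p - p * m powr (p - 1) * m) * V + (p * m powr (p - 1)) * (m * V)"
      using Bochner_Integration.integral_add[OF integrable_mult_right[OF int_1] integrable_mult_right[OF int_f],
          of "m powr p - p * m powr (p - 1) * m" "p * m powr (p - 1)"] mV V(1) sets.sets_into_space[OF A]
      by (simp add: Int_absorb2)
    finally show ?thesis by (simp add: algebra_simps)
  qed
  finally have "ennreal (V * \<bar>(LINT x:A|M. f x) / V\<bar> powr p)
      \<le> ennreal (\<integral>x. indicator A x * \<bar>f x\<bar> powr p \<partial>M)"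
    by (rule ennreal_leI)
  also have "\<dots> = (\<integral>\<^sup>+x\<in>A. ennreal (\<bar>f x\<bar> powr p) \<partial>M)"
    unfolding nn[symmetric] by (rule nn_integral_eq_integral[symmetric, OF int_p]) simp
  finally show ?thesis .
qed simp

section \<open>Translates of weakly differentiable functions\<close>

lemma nn_integral_translate:
  fixes f :: "'a::euclidean_space \<Rightarrow> ennreal"
  assumes [measurable]: "f \<in> borel_measurable borel"
  shows "(\<integral>\<^sup>+x. f (x + c) \<partial>lborel) = (\<integral>\<^sup>+x. f x \<partial>lborel)"
proof -
  have "(\<integral>\<^sup>+x. f x \<partial>lborel) = (\<integral>\<^sup>+x. f x \<partial>distr lborel borel ((+) c))"
    by (simp only: lborel_distr_plus)
  also have "\<dots> = (\<integral>\<^sup>+x. f (c + x) \<partial>lborel)"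
    by (rule nn_integral_distr) simp_all
  finally show ?thesis by (simp add: add.commute)
qed

lemma integral_translate:
  fixes f :: "'a::euclidean_space \<Rightarrow> real"
  assumes [measurable]: "f \<in> borel_measurable borel"
  shows "(LINT x|lborel. f (x + c)) = (LINT x|lborel. f x)"
proof -
  have "(LINT x|lborel. f x) = (LINT x|distr lborel borel ((+) c). f x)"
    by (simp only: lborel_distr_plus)
  also have "\<dots> = (LINT x|lborel. f (c + x))"
    by (rule integral_distr) simp_all
  finally show ?thesis by (simp add: add.commute)
qed

section \<open>Fubini's theorem along a segment of translates\<close>

lemma compact_sweep:
  fixes h :: "'a::euclidean_space"
  assumes "compact K"
  shows "compact ((\<lambda>(x, s). x + s *\<^sub>R h) ` (K \<times> {0..1}))"
  using assms
  by (intro compact_continuous_image compact_Times)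
    (auto simp: case_prod_unfold intro!: continuous_intros)

text \<open>For each s in [0, 1] the inner integral is at most B times the integral of |w| over the
  compact set swept out by K, a bound independent of s. The second form follows from the first by
  the substitution x = y + s h.\<close>

lemma shear_integrable:
  fixes w \<psi> :: "'a::euclidean_space \<Rightarrow> real"
  assumes w: "borel_loc_integrable \<Omega> w" and [measurable]: "\<psi> \<in> borel_measurable borel"
    and B: "\<And>x. \<bar>\<psi> x\<bar> \<le> B" and K: "compact K" and off: "\<And>x. x \<notin> K \<Longrightarrow> \<psi> x = 0"
    and sweep: "\<And>x s. x \<in> K \<Longrightarrow> 0 \<le> s \<Longrightarrow> s \<le> 1 \<Longrightarrow> x + s *\<^sub>R h \<in> \<Omega>"
  shows "integrable (lborel \<Otimes>\<^sub>M lborel) (\<lambda>(y, s). indicator {0..1::real} s * (w (y + s *\<^sub>R h) * \<psi> y))"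
    and "integrable (lborel \<Otimes>\<^sub>M lborel) (\<lambda>(x, s). indicator {0..1::real} s * (w x * \<psi> (x - s *\<^sub>R h)))"
proof -
  have [measurable]: "w \<in> borel_measurable borel" using w by (simp add: borel_loc_integrable_def)
  have B0: "B \<ge> 0" using B[of 0] by linarith
  define K' where "K' = (\<lambda>(x, s). x + s *\<^sub>R h) ` (K \<times> {0..1})"
  have K': "compact K'" unfolding K'_def by (rule compact_sweep[OF K])
  then have [measurable]: "K' \<in> sets borel" by (simp add: compact_imp_closed)
  have "K' \<subseteq> \<Omega>" using sweep by (auto simp: K'_def)
  with w K' have "integrable lborel (\<lambda>x. indicator K' x * w x)"
    by (simp add: borel_loc_integrable_def set_integrable_def)
  define C where "C = ennreal B * (\<integral>\<^sup>+x. ennreal (norm (indicator K' x * w x)) \<partial>lborel)"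
  have C: "C < \<infinity>"
    unfolding C_def using \<open>integrable lborel (\<lambda>x. indicator K' x * w x)\<close>
    by (simp add: integrable_iff_bounded ennreal_mult_less_top)
  have bound: "(\<integral>\<^sup>+y. ennreal (norm (indicator {0..1} s * (w (y + s *\<^sub>R h) * \<psi> y))) \<partial>lborel)
      \<le> indicator {0..1} s * C" for s :: real
  proof (cases "s \<in> {0..1}")
    case s: True
    have "(\<integral>\<^sup>+y. ennreal (norm (indicator {0..1} s * (w (y + s *\<^sub>R h) * \<psi> y))) \<partial>lborel)
      \<le> (\<integral>\<^sup>+y. ennreal B * ennreal (norm (indicator K' (y + s *\<^sub>R h) * w (y + s *\<^sub>R h))) \<partial>lborel)"
    proof (rule nn_integral_mono)
      fix y
      have "\<bar>w (y + s *\<^sub>R h)\<bar> * \<bar>\<psi> y\<bar> \<le> B * \<bar>indicator K' (y + s *\<^sub>R h) * w (y + s *\<^sub>R h)\<bar>"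
      proof (cases "y \<in> K")
        case True
        then have "y + s *\<^sub>R h \<in> K'" unfolding K'_def using s by force
        then show ?thesis using mult_left_mono[OF B[of y], of "\<bar>w (y + s *\<^sub>R h)\<bar>"]
          by (simp add: mult.commute)
      next
        case False
        then show ?thesis using off B0 by simp
      qed
      then show "ennreal (norm (indicator {0..1} s * (w (y + s *\<^sub>R h) * \<psi> y)))
        \<le> ennreal B * ennreal (norm (indicator K' (y + s *\<^sub>R h) * w (y + s *\<^sub>R h)))"
        using s B0 by (simp add: abs_mult ennreal_mult[symmetric])
    qed
    also have "\<dots> = (\<integral>\<^sup>+y. ennreal B * ennreal (norm (indicator K' y * w y)) \<partial>lborel)"
      by (rule nn_integral_translate[where f = "\<lambda>y. ennreal B * ennreal (norm (indicator K' y * w y))"]) measurable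
    also have "\<dots> = C"
      unfolding C_def by (rule nn_integral_cmult) measurable
    finally show ?thesis using s by simp
  qed simp
  have "(\<integral>\<^sup>+s. indicator {0..1::real} s * C \<partial>lborel) = C"
    by (subst nn_integral_multc) (simp_all)
  note total = this
  show "integrable (lborel \<Otimes>\<^sub>M lborel) (\<lambda>(y, s). indicator {0..1::real} s * (w (y + s *\<^sub>R h) * \<psi> y))"
  proof (rule integrableI_bounded)
    have "(\<integral>\<^sup>+z. ennreal (norm (case z of (y, s) \<Rightarrow> indicator {0..1::real} s * (w (y + s *\<^sub>R h) * \<psi> y)))
        \<partial>(lborel \<Otimes>\<^sub>M lborel))
      = (\<integral>\<^sup>+s. (\<integral>\<^sup>+y. ennreal (norm (indicator {0..1} s * (w (y + s *\<^sub>R h) * \<psi> y))) \<partial>lborel) \<partial>lborel)"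
      by (subst lborel_pair.nn_integral_snd[symmetric]) simp_all
    also have "\<dots> \<le> (\<integral>\<^sup>+s. indicator {0..1::real} s * C \<partial>lborel)"
      by (rule nn_integral_mono) (rule bound)
    also have "\<dots> < \<infinity>" using total C by simp
    finally show "(\<integral>\<^sup>+z. ennreal (norm (case z of (y, s) \<Rightarrow> indicator {0..1::real} s * (w (y + s *\<^sub>R h) * \<psi> y)))
        \<partial>(lborel \<Otimes>\<^sub>M lborel)) < \<infinity>" .
  qed measurable
  have bound': "(\<integral>\<^sup>+x. ennreal (norm (indicator {0..1} s * (w x * \<psi> (x - s *\<^sub>R h)))) \<partial>lborel)
      \<le> indicator {0..1} s * C" for s :: real
    using bound[of s] nn_integral_translate[where c = "s *\<^sub>R h" and
      f = "\<lambda>x. ennreal (norm (indicator {0..1} s * (w x * \<psi> (x - s *\<^sub>R h))))"]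
    by simp
  show "integrable (lborel \<Otimes>\<^sub>M lborel) (\<lambda>(x, s). indicator {0..1::real} s * (w x * \<psi> (x - s *\<^sub>R h)))"
  proof (rule integrableI_bounded)
    have "(\<integral>\<^sup>+z. ennreal (norm (case z of (x, s) \<Rightarrow> indicator {0..1::real} s * (w x * \<psi> (x - s *\<^sub>R h))))
        \<partial>(lborel \<Otimes>\<^sub>M lborel))
      = (\<integral>\<^sup>+s. (\<integral>\<^sup>+x. ennreal (norm (indicator {0..1} s * (w x * \<psi> (x - s *\<^sub>R h)))) \<partial>lborel) \<partial>lborel)"
      by (subst lborel_pair.nn_integral_snd[symmetric]) simp_all
    also have "\<dots> \<le> (\<integral>\<^sup>+s. indicator {0..1::real} s * C \<partial>lborel)"
      by (rule nn_integral_mono) (rule bound')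
    also have "\<dots> < \<infinity>" using total C by simp
    finally show "(\<integral>\<^sup>+z. ennreal (norm (case z of (x, s) \<Rightarrow> indicator {0..1::real} s * (w x * \<psi> (x - s *\<^sub>R h))))
        \<partial>(lborel \<Otimes>\<^sub>M lborel)) < \<infinity>" .
  qed measurable
qed

text \<open>By the chain rule the integrand is the derivative of -\<open>\<phi>\<close> (x - s h) in
  s, so the fundamental theorem of calculus applies.\<close>

lemma C_inf_line_integral:
  fixes \<phi> :: "'a::euclidean_space \<Rightarrow> real"
  assumes "C_inf \<phi>"
  shows "(LINT s|lborel. indicator {0..1} s * (\<Sum>b\<in>Basis. (h \<bullet> b) * dpart b \<phi> (x - s *\<^sub>R h)))
    = \<phi> x - \<phi> (x - h)"
proof -
  have "((\<lambda>s. - \<phi> (x - s *\<^sub>R h)) has_vector_derivative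
      (\<Sum>b\<in>Basis. (h \<bullet> b) * dpart b \<phi> (x - s *\<^sub>R h))) (at s within {0..1})" for s
  proof -
    have "((\<lambda>s. x - s *\<^sub>R h) has_derivative (\<lambda>t. - t *\<^sub>R h)) (at s)"
      by (auto intro!: derivative_eq_intros)
    from has_derivative_compose[OF this has_derivative_dpart[OF C_inf_differentiable[OF assms]]]
    have "((\<lambda>s. \<phi> (x - s *\<^sub>R h)) has_derivative
        (\<lambda>t. \<Sum>b\<in>Basis. (- t *\<^sub>R h \<bullet> b) * dpart b \<phi> (x - s *\<^sub>R h))) (at s)" .
    from has_derivative_minus[OF this]
    have "((\<lambda>s. - \<phi> (x - s *\<^sub>R h)) has_derivative
        (\<lambda>t. t *\<^sub>R (\<Sum>b\<in>Basis. (h \<bullet> b) * dpart b \<phi> (x - s *\<^sub>R h)))) (at s)"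
      by (simp add: sum_distrib_left sum_negf mult.assoc)
    then show ?thesis
      unfolding has_vector_derivative_def by (rule has_derivative_at_withinI)
  qed
  moreover have "continuous_on {0..1} (\<lambda>s. \<Sum>b\<in>Basis. (h \<bullet> b) * dpart b \<phi> (x - s *\<^sub>R h))"
    by (intro continuous_on_sum continuous_on_mult continuous_on_const
        continuous_on_compose2[OF C_inf_continuous[OF C_inf_dpart[OF assms], of _ UNIV]])
      (auto intro!: continuous_intros)
  ultimately show ?thesis
    using integral_FTC_Icc[of 0 1 "\<lambda>s. - \<phi> (x - s *\<^sub>R h)"
        "\<lambda>s. \<Sum>b\<in>Basis. (h \<bullet> b) * dpart b \<phi> (x - s *\<^sub>R h)"] by simp
qed

text \<open>The fundamental theorem of calculus is applied to the smooth \<open>\<phi>\<close>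
  rather than to u, and Fubini's theorem then pulls the segment parameter outside. The translated
  supports stay in \<open>\<Omega>\<close>, which keeps the inner integrals finite.\<close>

lemma integral_difference_test_fun:
  fixes u \<phi> :: "'a::euclidean_space \<Rightarrow> real"
  assumes u: "borel_loc_integrable \<Omega> u" and \<phi>: "test_fun U \<phi>"
    and sweep: "\<And>x s. x \<in> U \<Longrightarrow> 0 \<le> s \<Longrightarrow> s \<le> 1 \<Longrightarrow> x + s *\<^sub>R h \<in> \<Omega>"
  shows "(LINT x|lborel. u x * (\<phi> x - \<phi> (x - h)))
    = (LINT s|lborel. indicator {0..1} s *
        (\<Sum>b\<in>Basis. (h \<bullet> b) * (LINT x|lborel. u x * dpart b \<phi> (x - s *\<^sub>R h))))"
proof -
  define f where "f b x s = indicator {0..1} s * (u x * dpart b \<phi> (x - s *\<^sub>R h))" for b x and s :: real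
  have int: "integrable (lborel \<Otimes>\<^sub>M lborel) (\<lambda>(x, s). f b x s)" if b: "b \<in> Basis" for b
  proof -
    have t: "test_fun U (dpart b \<phi>)" by (rule test_fun_dpart[OF \<phi> b])
    obtain B where B: "\<And>x. \<bar>dpart b \<phi> x\<bar> \<le> B" using test_fun_bounded[OF t] by auto
    show ?thesis
      unfolding f_def
    proof (rule shear_integrable(2)[OF u C_inf_measurable[OF test_fun_C_inf[OF t]] B])
      show "compact (tsupport (dpart b \<phi>))" using t by (simp add: test_fun_def)
      show "dpart b \<phi> x = 0" if "x \<notin> tsupport (dpart b \<phi>)" for x
        by (rule tsupport_zero[OF that])
      show "x + s *\<^sub>R h \<in> \<Omega>" if "x \<in> tsupport (dpart b \<phi>)" "0 \<le> s" "s \<le> 1" for x s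
        using sweep[OF _ that(2,3)] that(1) t by (auto simp: test_fun_def)
    qed
  qed
  have int_sum: "integrable (lborel \<Otimes>\<^sub>M lborel) (\<lambda>(x, s). \<Sum>b\<in>Basis. (h \<bullet> b) * f b x s)"
    using Bochner_Integration.integrable_sum[of Basis "lborel \<Otimes>\<^sub>M lborel" "\<lambda>b z. (h \<bullet> b) * (case z of (x, s) \<Rightarrow> f b x s)"]
      integrable_mult_right[OF int]
    by (simp add: case_prod_unfold)
  have "(LINT x|lborel. u x * (\<phi> x - \<phi> (x - h)))
      = (LINT x|lborel. (LINT s|lborel. (\<Sum>b\<in>Basis. (h \<bullet> b) * f b x s)))"
  proof (rule Bochner_Integration.integral_cong)
    fix x
    have "(LINT s|lborel. (\<Sum>b\<in>Basis. (h \<bullet> b) * f b x s))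
        = (LINT s|lborel. u x * (indicator {0..1} s * (\<Sum>b\<in>Basis. (h \<bullet> b) * dpart b \<phi> (x - s *\<^sub>R h))))"
      by (rule Bochner_Integration.integral_cong) (simp_all add: f_def sum_distrib_left mult_ac)
    also have "\<dots> = u x * (\<phi> x - \<phi> (x - h))"
      by (simp only: integral_mult_right_zero C_inf_line_integral[OF test_fun_C_inf[OF \<phi>]])
    finally show "u x * (\<phi> x - \<phi> (x - h)) = (LINT s|lborel. (\<Sum>b\<in>Basis. (h \<bullet> b) * f b x s))" ..
  qed simp
  also have "\<dots> = (LINT s|lborel. (LINT x|lborel. (\<Sum>b\<in>Basis. (h \<bullet> b) * f b x s)))"
    by (rule lborel_pair.Fubini_integral[OF int_sum, symmetric])
  also have "\<dots> = (LINT s|lborel. indicator {0..1} s *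
        (\<Sum>b\<in>Basis. (h \<bullet> b) * (LINT x|lborel. u x * dpart b \<phi> (x - s *\<^sub>R h))))"
  proof (rule Bochner_Integration.integral_cong)
    fix s :: real
    show "(LINT x|lborel. (\<Sum>b\<in>Basis. (h \<bullet> b) * f b x s)) = indicator {0..1} s *
        (\<Sum>b\<in>Basis. (h \<bullet> b) * (LINT x|lborel. u x * dpart b \<phi> (x - s *\<^sub>R h)))"
    proof (cases "s \<in> {0..1}")
      case s: True
      have "integrable lborel (\<lambda>x. f b x s)" if b: "b \<in> Basis" for b
      proof -
        have "test_fun \<Omega> (\<lambda>x. dpart b \<phi> (x - s *\<^sub>R h))"
          by (rule test_fun_translate[OF test_fun_dpart[OF \<phi> b]]) (use sweep s in simp)
        from integrable_mult_test_fun[OF u this] show ?thesis using s by (simp add: f_def)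
      qed
      then have "(LINT x|lborel. (\<Sum>b\<in>Basis. (h \<bullet> b) * f b x s))
          = (\<Sum>b\<in>Basis. (LINT x|lborel. (h \<bullet> b) * f b x s))"
        by (intro Bochner_Integration.integral_sum integrable_mult_right)
      then show ?thesis using s by (simp add: f_def)
    qed (simp add: f_def)
  qed simp
  finally show ?thesis .
qed

lemma borel_loc_integrable_one: "borel_loc_integrable \<Omega> (\<lambda>x. 1)"
  unfolding borel_loc_integrable_def set_integrable_def
proof (intro conjI allI impI)
  fix K :: "'a set" assume "compact K \<and> K \<subseteq> \<Omega>"
  then have K: "compact K" by simp
  then have "K \<in> sets lborel" by (simp add: compact_imp_closed)
  moreover have "emeasure lborel K < \<infinity>"
    by (rule emeasure_bounded_finite[OF compact_imp_bounded[OF K]])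
  ultimately show "integrable lborel (\<lambda>x. indicator K x *\<^sub>R (1 :: real))"
    using integrable_real_indicator[of K lborel] by simp
qed simp

text \<open>The preceding identity is used with u = 1 and h = b: its left side vanishes by
  translation invariance, and each inner integral on its right side is the integral of the partial
  derivative in direction b.\<close>

lemma integral_dpart_zero:
  fixes \<phi> :: "'a::euclidean_space \<Rightarrow> real"
  assumes \<phi>: "test_fun \<Omega> \<phi>" and b: "b \<in> Basis"
  shows "(LINT x|lborel. dpart b \<phi> x) = 0"
proof -
  have meas: "\<phi> \<in> borel_measurable borel"
    by (rule C_inf_measurable[OF test_fun_C_inf[OF \<phi>]])
  have intb: "(LINT x|lborel. dpart c \<phi> (x - v)) = (LINT x|lborel. dpart c \<phi> x)" if "c \<in> Basis" for c v
    using integral_translate[OF C_inf_measurable[OF C_inf_dpart[OF test_fun_C_inf[OF \<phi>] that]], of "- v"] by simp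
  have i1: "integrable lborel \<phi>"
    using integrable_mult_test_fun[OF borel_loc_integrable_one \<phi>] by simp
  have i2: "integrable lborel (\<lambda>x. \<phi> (x - b))"
    using integrable_mult_test_fun[OF borel_loc_integrable_one test_fun_translate[OF test_fun_mono[OF \<phi> subset_UNIV], of b UNIV]]
    by simp
  have "(LINT x|lborel. \<phi> x - \<phi> (x - b)) = (LINT x|lborel. \<phi> x) - (LINT x|lborel. \<phi> (x - b))"
    by (rule Bochner_Integration.integral_diff[OF i1 i2])
  also have "\<dots> = 0"
    using integral_translate[OF meas, of "- b"] by simp
  finally have "0 = (LINT x|lborel. 1 * (\<phi> x - \<phi> (x - b)))" by simp
  also have "\<dots> = (LINT s|lborel. indicator {0..1::real} s *
        (\<Sum>c\<in>Basis. (b \<bullet> c) * (LINT x|lborel. 1 * dpart c \<phi> (x - s *\<^sub>R b))))"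
    by (rule integral_difference_test_fun[OF borel_loc_integrable_one[of UNIV] \<phi>]) simp
  also have "\<dots> = (LINT s|lborel. indicator {0..1::real} s * (LINT x|lborel. dpart b \<phi> x))"
  proof (rule Bochner_Integration.integral_cong)
    fix s :: real
    have "(\<Sum>c\<in>Basis. (b \<bullet> c) * (LINT x|lborel. 1 * dpart c \<phi> (x - s *\<^sub>R b)))
        = (\<Sum>c\<in>Basis. if c = b then (LINT x|lborel. dpart b \<phi> x) else 0)"
      by (rule sum.cong) (use b intb in \<open>simp_all add: inner_Basis\<close>)
    also have "\<dots> = (LINT x|lborel. dpart b \<phi> x)" using b by simp
    finally show "indicator {0..1} s * (\<Sum>c\<in>Basis. (b \<bullet> c) * (LINT x|lborel. 1 * dpart c \<phi> (x - s *\<^sub>R b)))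
        = indicator {0..1} s * (LINT x|lborel. dpart b \<phi> x)" by simp
  qed simp
  also have "\<dots> = (LINT x|lborel. dpart b \<phi> x)" by simp
  finally show ?thesis ..
qed

lemma borel_weak_gradient_inner:
  assumes "borel_weak_gradient \<Omega> u g"
  shows "borel_loc_integrable \<Omega> (\<lambda>x. g x \<bullet> h)"
proof -
  have [measurable]: "g \<in> borel_measurable borel" by (rule borel_weak_gradientD(2)[OF assms])
  have eq: "(\<lambda>x. g x \<bullet> h) = (\<lambda>x. \<Sum>b\<in>Basis. (h \<bullet> b) * (g x \<bullet> b))"
    by (rule ext, subst euclidean_inner) (simp add: mult.commute)
  have "set_integrable lborel K (\<lambda>x. g x \<bullet> h)" if "compact K" "K \<subseteq> \<Omega>" for K
  proof -
    have "integrable lborel (\<lambda>x. indicator K x *\<^sub>R (g x \<bullet> b))" if "b \<in> Basis" for b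
      using borel_weak_gradientD(4)[OF assms that] \<open>compact K\<close> \<open>K \<subseteq> \<Omega>\<close>
      by (simp add: borel_loc_integrable_def set_integrable_def)
    then have "integrable lborel (\<lambda>x. \<Sum>b\<in>Basis. (h \<bullet> b) * (indicator K x *\<^sub>R (g x \<bullet> b)))"
      by (intro Bochner_Integration.integrable_sum integrable_mult_right)
    then show ?thesis
      unfolding set_integrable_def eq by (simp add: sum_distrib_left mult_ac)
  qed
  then show ?thesis unfolding borel_loc_integrable_def by simp
qed

text \<open>The translation is moved from u to the test function, whose difference is a line
  integral of derivatives; the weak gradient identity is used for each s, and translating back moves
  the shift to g. Both sides are locally integrable on U, so the fundamental lemma removes the test
  function.\<close>

lemma weak_difference_formula:
  fixes u :: "'a::euclidean_space \<Rightarrow> real"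
  assumes g: "borel_weak_gradient \<Omega> u g" and U: "open U"
    and sweep: "\<And>x s. x \<in> U \<Longrightarrow> 0 \<le> s \<Longrightarrow> s \<le> 1 \<Longrightarrow> x + s *\<^sub>R h \<in> \<Omega>"
  shows "AE x in lborel. x \<in> U \<longrightarrow>
    u (x + h) - u x = (LINT s|lborel. indicator {0..1} s * (g (x + s *\<^sub>R h) \<bullet> h))"
proof -
  define w where "w x = g x \<bullet> h" for x
  define G where "G x = (LINT s|lborel. indicator {0..1} s * w (x + s *\<^sub>R h))" for x
  have u: "borel_loc_integrable \<Omega> u" by (rule borel_weak_gradientD(1)[OF g])
  have w: "borel_loc_integrable \<Omega> w" unfolding w_def by (rule borel_weak_gradient_inner[OF g])
  have [measurable]: "u \<in> borel_measurable borel" "w \<in> borel_measurable borel"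
    using u w by (simp_all add: borel_loc_integrable_def)
  have G_meas[measurable]: "G \<in> borel_measurable borel"
    unfolding G_def by (rule lborel.borel_measurable_lebesgue_integral) measurable
  have G_loc: "borel_loc_integrable U G"
    unfolding borel_loc_integrable_def
  proof (intro conjI allI impI G_meas)
    fix K assume K: "compact K \<and> K \<subseteq> U"
    then have [measurable]: "K \<in> sets borel" by (simp add: compact_imp_closed)
    \<comment> \<open>The indicator of K takes the place of the bounded multiplier, since
      \<open>G\<close> has to be integrated over K.\<close>
    have "integrable (lborel \<Otimes>\<^sub>M lborel)
        (\<lambda>(y, s). indicator {0..1::real} s * (w (y + s *\<^sub>R h) * indicator K y))"
      by (rule shear_integrable(1)[OF w, where K = K and B = 1])
        (use K sweep in \<open>auto simp: indicator_def\<close>)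
    from lborel_pair.integrable_fst'[OF this]
    have "integrable lborel (\<lambda>y. LINT s|lborel. indicator {0..1::real} s * (w (y + s *\<^sub>R h) * indicator K y))"
      by simp
    also have "(\<lambda>y. LINT s|lborel. indicator {0..1::real} s * (w (y + s *\<^sub>R h) * indicator K y))
      = (\<lambda>y. indicator K y *\<^sub>R G y)"
      by (rule ext) (simp add: G_def indicator_def)
    finally show "set_integrable lborel K G" by (simp add: set_integrable_def)
  qed
  have u_shift: "borel_loc_integrable U (\<lambda>x. u (x + h))"
    unfolding borel_loc_integrable_def
  proof (intro conjI allI impI)
    fix K assume K: "compact K \<and> K \<subseteq> U"
    have "compact ((\<lambda>x. x + h) ` K)" using K by (intro compact_continuous_image continuous_intros) simp
    moreover have "(\<lambda>x. x + h) ` K \<subseteq> \<Omega>" using K sweep[of _ 1] by auto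
    ultimately have "integrable lborel (\<lambda>x. indicator ((\<lambda>x. x + h) ` K) x * u x)"
      using u by (simp add: borel_loc_integrable_def set_integrable_def)
    then have "integrable (distr lborel borel ((+) h)) (\<lambda>x. indicator ((\<lambda>x. x + h) ` K) x * u x)"
      by (simp only: lborel_distr_plus)
    then have "integrable lborel (\<lambda>x. indicator ((\<lambda>x. x + h) ` K) (h + x) * u (h + x))"
      by (rule integrable_distr[rotated]) simp
    also have "(\<lambda>x. indicator ((\<lambda>x. x + h) ` K) (h + x) * u (h + x)) = (\<lambda>x. indicator K x *\<^sub>R u (x + h))"
      by (rule ext) (auto simp: indicator_def image_iff add.commute)
    finally show "set_integrable lborel K (\<lambda>x. u (x + h))" by (simp add: set_integrable_def)
  qed simp
  have "AE x in lborel. x \<in> U \<longrightarrow> u (x + h) - u x - G x = 0"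
  proof (rule du_Bois_Reymond[OF U])
    have uU: "borel_loc_integrable U u"
      by (rule borel_loc_integrable_mono[OF u]) (use sweep[of _ 0] in auto)
    show "borel_loc_integrable U (\<lambda>x. u (x + h) - u x - G x)"
      using u_shift uU G_loc
      by (simp add: borel_loc_integrable_def set_integral_diff)
    fix \<phi> assume \<phi>: "test_fun U \<phi>"
    have [measurable]: "\<phi> \<in> borel_measurable borel"
      by (rule C_inf_measurable[OF test_fun_C_inf[OF \<phi>]])
    have shift: "test_fun \<Omega> (\<lambda>x. \<phi> (x - s *\<^sub>R h))" if "0 \<le> s" "s \<le> 1" for s
      by (rule test_fun_translate[OF \<phi>]) (rule sweep[OF _ that])
    note i1 = integrable_mult_test_fun[OF u_shift \<phi>] and i2 = integrable_mult_test_fun[OF uU \<phi>]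
      and i3 = integrable_mult_test_fun[OF G_loc \<phi>]
    have i4: "integrable lborel (\<lambda>x. u x * \<phi> (x - h))"
      using integrable_mult_test_fun[OF u shift[of 1]] by simp
    have "(LINT x|lborel. (u (x + h) - u x - G x) * \<phi> x)
      = (LINT x|lborel. u (x + h) * \<phi> x) - (LINT x|lborel. u x * \<phi> x) - (LINT x|lborel. G x * \<phi> x)"
      unfolding left_diff_distrib
      using Bochner_Integration.integral_diff[OF Bochner_Integration.integrable_diff[OF i1 i2] i3]
        Bochner_Integration.integral_diff[OF i1 i2] by simp
    also have "(LINT x|lborel. u (x + h) * \<phi> x) = (LINT x|lborel. u x * \<phi> (x - h))"
      using integral_translate[of "\<lambda>x. u x * \<phi> (x - h)" h] by simp
    also have "(LINT x|lborel. u x * \<phi> (x - h)) - (LINT x|lborel. u x * \<phi> x)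
      = - (LINT x|lborel. u x * (\<phi> x - \<phi> (x - h)))"
      unfolding right_diff_distrib using Bochner_Integration.integral_diff[OF i2 i4] by simp
    also have "(LINT x|lborel. u x * (\<phi> x - \<phi> (x - h))) = (LINT s|lborel. indicator {0..1} s *
        (\<Sum>b\<in>Basis. (h \<bullet> b) * (LINT x|lborel. u x * dpart b \<phi> (x - s *\<^sub>R h))))"
      by (rule integral_difference_test_fun[OF u \<phi> sweep])
    also have "\<dots> = (LINT s|lborel. - (LINT y|lborel. indicator {0..1::real} s * (w (y + s *\<^sub>R h) * \<phi> y)))"
    proof (rule Bochner_Integration.integral_cong)
      fix s :: real
      show "indicator {0..1} s * (\<Sum>b\<in>Basis. (h \<bullet> b) * (LINT x|lborel. u x * dpart b \<phi> (x - s *\<^sub>R h)))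
        = - (LINT y|lborel. indicator {0..1::real} s * (w (y + s *\<^sub>R h) * \<phi> y))"
      proof (cases "s \<in> {0..1}")
        case s: True
        \<comment> \<open>The translate by s h has its support in \<open>\<Omega>\<close>, so it may
          be tested against the weak gradient there.\<close>
        then have t: "test_fun \<Omega> (\<lambda>x. \<phi> (x - s *\<^sub>R h))" by (intro shift) simp_all
        have "(LINT x|lborel. u x * dpart b \<phi> (x - s *\<^sub>R h))
            = - (LINT x|lborel. (g x \<bullet> b) * \<phi> (x - s *\<^sub>R h))" if b: "b \<in> Basis" for b
          using borel_weak_gradientD(5)[OF g t b]
            dpart_translate[OF C_inf_differentiable[OF test_fun_C_inf[OF \<phi>]], of b "s *\<^sub>R h"]
          by simp
        then have "(\<Sum>b\<in>Basis. (h \<bullet> b) * (LINT x|lborel. u x * dpart b \<phi> (x - s *\<^sub>R h)))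
            = - (\<Sum>b\<in>Basis. (LINT x|lborel. (h \<bullet> b) * ((g x \<bullet> b) * \<phi> (x - s *\<^sub>R h))))"
          by (simp add: sum_negf)
        also have "(\<Sum>b\<in>Basis. (LINT x|lborel. (h \<bullet> b) * ((g x \<bullet> b) * \<phi> (x - s *\<^sub>R h))))
            = (LINT x|lborel. (\<Sum>b\<in>Basis. (h \<bullet> b) * ((g x \<bullet> b) * \<phi> (x - s *\<^sub>R h))))"
          by (rule Bochner_Integration.integral_sum[symmetric])
            (rule integrable_mult_right, rule integrable_mult_test_fun[OF borel_weak_gradientD(4)[OF g] t])
        also have "(\<lambda>x. \<Sum>b\<in>Basis. (h \<bullet> b) * ((g x \<bullet> b) * \<phi> (x - s *\<^sub>R h)))
            = (\<lambda>x. w x * \<phi> (x - s *\<^sub>R h))"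
          by (rule ext) (simp add: w_def euclidean_inner[of _ h] sum_distrib_left sum_distrib_right mult_ac)
        also have "(LINT x|lborel. w x * \<phi> (x - s *\<^sub>R h)) = (LINT y|lborel. w (y + s *\<^sub>R h) * \<phi> y)"
          using integral_translate[of "\<lambda>x. w x * \<phi> (x - s *\<^sub>R h)" "s *\<^sub>R h"] by simp
        finally show ?thesis using s by simp
      qed simp
    qed simp
    also have "\<dots> = - (LINT s|lborel. (LINT y|lborel. indicator {0..1::real} s * (w (y + s *\<^sub>R h) * \<phi> y)))"
      by simp
    also have "(LINT s|lborel. (LINT y|lborel. indicator {0..1::real} s * (w (y + s *\<^sub>R h) * \<phi> y)))
      = (LINT y|lborel. (LINT s|lborel. indicator {0..1::real} s * (w (y + s *\<^sub>R h) * \<phi> y)))"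
    proof (rule lborel_pair.Fubini_integral)
      obtain B where B: "\<And>x. \<bar>\<phi> x\<bar> \<le> B" using test_fun_bounded[OF \<phi>] by auto
      have "x + s *\<^sub>R h \<in> \<Omega>" if "x \<in> tsupport \<phi>" "0 \<le> s" "s \<le> 1" for x s
        using sweep[OF _ that(2,3)] that(1) \<phi> by (auto simp: test_fun_def)
      then show "integrable (lborel \<Otimes>\<^sub>M lborel)
          (\<lambda>(y, s). indicator {0..1::real} s * (w (y + s *\<^sub>R h) * \<phi> y))"
        using \<phi> B
        by (intro shear_integrable(1)[OF w, where K = "tsupport \<phi>" and B = B])
          (simp_all add: test_fun_def tsupport_zero)
    qed
    also have "\<dots> = (LINT y|lborel. G y * \<phi> y)"
      unfolding G_def integral_mult_left_zero[symmetric] by (simp add: mult.assoc)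
    finally show "(LINT x|lborel. (u (x + h) - u x - G x) * \<phi> x) = 0" by simp
  qed
  then show ?thesis
    by eventually_elim (simp add: G_def w_def)
qed

text \<open>Jensen's inequality is applied in s on [0, 1], an interval of measure 1, and
  Cauchy-Schwarz yields the factor |h|^p. After exchanging the integrals, translation invariance
  removes the shift for each s.\<close>

lemma Lp_int_difference_le:
  fixes u :: "'a::euclidean_space \<Rightarrow> real"
  assumes g: "borel_weak_gradient \<Omega> u g" and U: "open U" and \<Omega>: "open \<Omega>" and p: "p \<ge> 1"
    and sweep: "\<And>x s. x \<in> U \<Longrightarrow> 0 \<le> s \<Longrightarrow> s \<le> 1 \<Longrightarrow> x + s *\<^sub>R h \<in> \<Omega>"
  shows "Lp_int p U (\<lambda>x. u (x + h) - u x) \<le> ennreal (norm h powr p) * Lp_int p \<Omega> g"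
proof -
  have [measurable]: "g \<in> borel_measurable borel" by (rule borel_weak_gradientD(2)[OF g])
  have [measurable]: "U \<in> sets borel" "\<Omega> \<in> sets borel" using U \<Omega> by simp_all
  \<comment> \<open>The indicator is taken at x + s h, so that after the translation the integral
    runs over \<open>\<Omega>\<close> exactly.\<close>
  define F where "F x s = ennreal (norm h powr p) *
    (ennreal (norm (g (x + s *\<^sub>R h)) powr p) * indicator \<Omega> (x + s *\<^sub>R h)) * indicator {0..1} s"
    for x and s :: real
  have "Lp_int p U (\<lambda>x. u (x + h) - u x)
      = Lp_int p U (\<lambda>x. LINT s|lborel. indicator {0..1} s * (g (x + s *\<^sub>R h) \<bullet> h))"
    by (rule Lp_int_cong_AE[OF weak_difference_formula[OF g U sweep]])
  also have "\<dots> \<le> (\<integral>\<^sup>+x. (\<integral>\<^sup>+s. F x s \<partial>lborel) \<partial>lborel)"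
    unfolding Lp_int_def
  proof (rule nn_integral_mono)
    fix x
    show "ennreal (norm (LINT s|lborel. indicator {0..1} s * (g (x + s *\<^sub>R h) \<bullet> h)) powr p) * indicator U x
      \<le> (\<integral>\<^sup>+s. F x s \<partial>lborel)"
    proof (cases "x \<in> U")
      case x: True
      have "ennreal (norm (LINT s|lborel. indicator {0..1} s * (g (x + s *\<^sub>R h) \<bullet> h)) powr p)
          \<le> (\<integral>\<^sup>+s\<in>{0..1}. ennreal (\<bar>g (x + s *\<^sub>R h) \<bullet> h\<bar> powr p) \<partial>lborel)"
        using jensen_powr[OF p, of "\<lambda>s. g (x + s *\<^sub>R h) \<bullet> h" lborel "{0..1}" 1]
        by (simp add: set_lebesgue_integral_def)
      also have "\<dots> \<le> (\<integral>\<^sup>+s. F x s \<partial>lborel)"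
      proof (rule nn_integral_mono)
        fix s :: real
        show "ennreal (\<bar>g (x + s *\<^sub>R h) \<bullet> h\<bar> powr p) * indicator {0..1} s \<le> F x s"
        proof (cases "s \<in> {0..1}")
          case s: True
          have "\<bar>g (x + s *\<^sub>R h) \<bullet> h\<bar> powr p \<le> (norm (g (x + s *\<^sub>R h)) * norm h) powr p"
            using p by (intro powr_mono2 Cauchy_Schwarz_ineq2) simp_all
          also have "\<dots> = norm h powr p * norm (g (x + s *\<^sub>R h)) powr p"
            by (subst powr_mult) (simp add: mult.commute)
          finally have "ennreal (\<bar>g (x + s *\<^sub>R h) \<bullet> h\<bar> powr p)
              \<le> ennreal (norm h powr p) * ennreal (norm (g (x + s *\<^sub>R h)) powr p)"
            by (simp add: ennreal_mult[symmetric] ennreal_leI)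
          then show ?thesis using s x sweep[of x s] by (simp add: F_def)
        qed simp
      qed
      finally show ?thesis using x by simp
    qed simp
  qed
  also have "\<dots> = (\<integral>\<^sup>+s. (\<integral>\<^sup>+x. F x s \<partial>lborel) \<partial>lborel)"
    by (rule lborel_pair.Fubini'[symmetric]) (unfold F_def, measurable)
  also have "\<dots> = (\<integral>\<^sup>+s. ennreal (norm h powr p) * Lp_int p \<Omega> g * indicator {0..1::real} s \<partial>lborel)"
  proof (rule nn_integral_cong)
    fix s :: real
    have "(\<integral>\<^sup>+x. F x s \<partial>lborel) = (\<integral>\<^sup>+x. ennreal (norm h powr p) *
        (ennreal (norm (g x) powr p) * indicator \<Omega> x) * indicator {0..1} s \<partial>lborel)"
      unfolding F_def
      by (rule nn_integral_translate[where f = "\<lambda>x. ennreal (norm h powr p) *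
        (ennreal (norm (g x) powr p) * indicator \<Omega> x) * indicator {0..1} s"]) measurable
    also have "\<dots> = ennreal (norm h powr p) * Lp_int p \<Omega> g * indicator {0..1::real} s"
      unfolding Lp_int_def by (subst nn_integral_multc, measurable, subst nn_integral_cmult, measurable)
    finally show "(\<integral>\<^sup>+x. F x s \<partial>lborel) = ennreal (norm h powr p) * Lp_int p \<Omega> g * indicator {0..1} s" .
  qed
  also have "\<dots> = ennreal (norm h powr p) * Lp_int p \<Omega> g"
    by (subst nn_integral_cmult_indicator) simp_all
  finally show ?thesis .
qed

section \<open>Calculus of weak gradients\<close>

lemma borel_loc_integrable_add:
  "borel_loc_integrable \<Omega> u \<Longrightarrow> borel_loc_integrable \<Omega> v \<Longrightarrow> borel_loc_integrable \<Omega> (\<lambda>x. u x + v x)"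
  by (simp add: borel_loc_integrable_def set_integral_add borel_measurable_add)

lemma borel_loc_integrable_mult_continuous:
  fixes u \<eta> :: "'a::euclidean_space \<Rightarrow> real"
  assumes u: "borel_loc_integrable \<Omega> u" and \<eta>: "continuous_on UNIV \<eta>"
  shows "borel_loc_integrable \<Omega> (\<lambda>x. \<eta> x * u x)"
  unfolding borel_loc_integrable_def
proof (intro conjI allI impI)
  have [measurable]: "u \<in> borel_measurable borel" "\<eta> \<in> borel_measurable borel"
    using u \<eta> by (simp_all add: borel_loc_integrable_def borel_measurable_continuous_onI)
  show "(\<lambda>x. \<eta> x * u x) \<in> borel_measurable borel" by simp
  fix K assume K: "compact K \<and> K \<subseteq> \<Omega>"
  then have [measurable]: "K \<in> sets borel" by (simp add: compact_imp_closed)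
  have "compact (\<eta> ` K)"
    using K \<eta> by (intro compact_continuous_image) (auto intro: continuous_on_subset)
  from compact_imp_bounded[OF this] obtain B where B: "B > 0" "\<forall>y\<in>\<eta> ` K. norm y \<le> B"
    unfolding bounded_pos by blast
  have int: "integrable lborel (\<lambda>x. B * (indicator K x * u x))"
    using u K by (simp add: borel_loc_integrable_def set_integrable_def)
  show "set_integrable lborel K (\<lambda>x. \<eta> x * u x)"
    unfolding set_integrable_def
  proof (rule Bochner_Integration.integrable_bound[OF int])
    have "norm (indicator K x *\<^sub>R (\<eta> x * u x)) \<le> norm (B * (indicator K x * u x))" for x
    proof (cases "x \<in> K")
      case True
      then have "\<bar>\<eta> x\<bar> \<le> B" using B(2) by simp
      then have "\<bar>\<eta> x\<bar> * \<bar>u x\<bar> \<le> B * \<bar>u x\<bar>" by (rule mult_right_mono) simp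
      then show ?thesis using True B(1) by (simp add: abs_mult)
    qed simp
    then show "AE x in lborel. norm (indicator K x *\<^sub>R (\<eta> x * u x)) \<le> norm (B * (indicator K x * u x))"
      by simp
  qed simp
qed

text \<open>The constant contributes c times the integral of a partial derivative of a test
  function, which is zero.\<close>

lemma borel_weak_gradient_add_const:
  assumes g: "borel_weak_gradient \<Omega> u g"
  shows "borel_weak_gradient \<Omega> (\<lambda>x. u x + c) g"
  unfolding borel_weak_gradient_def
proof (intro conjI ballI allI impI)
  have one: "borel_loc_integrable \<Omega> (\<lambda>x. c * 1)"
    by (rule borel_loc_integrable_mult_continuous[OF borel_loc_integrable_one]) simp
  have u: "borel_loc_integrable \<Omega> u" by (rule borel_weak_gradientD(1)[OF g])
  show "borel_loc_integrable \<Omega> (\<lambda>x. u x + c)"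
    using borel_loc_integrable_add[OF u one] by simp
  show "g \<in> borel_measurable borel" by (rule borel_weak_gradientD(2)[OF g])
  fix b :: 'a assume b: "b \<in> Basis"
  show "borel_loc_integrable \<Omega> (\<lambda>x. g x \<bullet> b)" by (rule borel_weak_gradientD(4)[OF g b])
  fix \<phi> assume \<phi>: "test_fun \<Omega> \<phi>"
  note t = test_fun_dpart[OF \<phi> b]
  have "(LINT x|lborel. (u x + c) * dpart b \<phi> x)
      = (LINT x|lborel. u x * dpart b \<phi> x) + (LINT x|lborel. c * 1 * dpart b \<phi> x)"
    using Bochner_Integration.integral_add[OF integrable_mult_test_fun[OF u t] integrable_mult_test_fun[OF one t]]
    by (simp add: distrib_right)
  also have "\<dots> = - (LINT x|lborel. (g x \<bullet> b) * \<phi> x)"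
    using integral_dpart_zero[OF \<phi> b] borel_weak_gradientD(5)[OF g \<phi> b] by simp
  finally show "(LINT x|lborel. (u x + c) * dpart b \<phi> x) = - (LINT x|lborel. (g x \<bullet> b) * \<phi> x)" .
qed

text \<open>Testing u with \<open>\<eta>\<close> \<open>\<phi>\<close> splits by the classical
  product rule, and the term carrying the derivative of \<open>\<eta>\<close> moves to the gradient
  side. The sum over \<open>Basis\<close> is the classical gradient of
  \<open>\<eta>\<close>.\<close>

lemma borel_weak_gradient_mult:
  fixes u \<eta> :: "'a::euclidean_space \<Rightarrow> real"
  assumes g: "borel_weak_gradient \<Omega> u g" and \<eta>: "C_inf \<eta>"
  shows "borel_weak_gradient \<Omega> (\<lambda>x. \<eta> x * u x)
    (\<lambda>x. \<eta> x *\<^sub>R g x + u x *\<^sub>R (\<Sum>b\<in>Basis. dpart b \<eta> x *\<^sub>R b))"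
  unfolding borel_weak_gradient_def
proof (intro conjI ballI allI impI)
  have u: "borel_loc_integrable \<Omega> u" by (rule borel_weak_gradientD(1)[OF g])
  have [measurable]: "g \<in> borel_measurable borel" "u \<in> borel_measurable borel"
    by (rule borel_weak_gradientD(2)[OF g], rule borel_weak_gradientD(3)[OF g])
  have [measurable]: "\<eta> \<in> borel_measurable borel" by (rule C_inf_measurable[OF \<eta>])
  have [measurable]: "dpart b \<eta> \<in> borel_measurable borel" if "b \<in> Basis" for b
    by (rule C_inf_measurable[OF C_inf_dpart[OF \<eta> that]])
  show "borel_loc_integrable \<Omega> (\<lambda>x. \<eta> x * u x)"
    by (rule borel_loc_integrable_mult_continuous[OF u C_inf_continuous[OF \<eta>]])
  show "(\<lambda>x. \<eta> x *\<^sub>R g x + u x *\<^sub>R (\<Sum>b\<in>Basis. dpart b \<eta> x *\<^sub>R b)) \<in> borel_measurable borel"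
    by measurable
  fix b :: 'a assume b: "b \<in> Basis"
  have comp: "(\<eta> x *\<^sub>R g x + u x *\<^sub>R (\<Sum>b\<in>Basis. dpart b \<eta> x *\<^sub>R b)) \<bullet> b
      = \<eta> x * (g x \<bullet> b) + dpart b \<eta> x * u x" for x
    using b by (simp add: inner_add_left inner_sum_left_Basis)
  have gb: "borel_loc_integrable \<Omega> (\<lambda>x. g x \<bullet> b)" by (rule borel_weak_gradientD(4)[OF g b])
  have l1: "borel_loc_integrable \<Omega> (\<lambda>x. \<eta> x * (g x \<bullet> b))"
    by (rule borel_loc_integrable_mult_continuous[OF gb C_inf_continuous[OF \<eta>]])
  have l2: "borel_loc_integrable \<Omega> (\<lambda>x. dpart b \<eta> x * u x)"
    by (rule borel_loc_integrable_mult_continuous[OF u C_inf_continuous[OF C_inf_dpart[OF \<eta> b]]])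
  show "borel_loc_integrable \<Omega> (\<lambda>x. (\<eta> x *\<^sub>R g x + u x *\<^sub>R (\<Sum>b\<in>Basis. dpart b \<eta> x *\<^sub>R b)) \<bullet> b)"
    unfolding comp by (rule borel_loc_integrable_add[OF l1 l2])
  fix \<phi> assume \<phi>: "test_fun \<Omega> \<phi>"
  have t: "test_fun \<Omega> (\<lambda>x. \<eta> x * \<phi> x)" by (rule test_fun_mult[OF \<eta> \<phi>])
  have d: "dpart b (\<lambda>x. \<eta> x * \<phi> x) x = dpart b \<eta> x * \<phi> x + \<eta> x * dpart b \<phi> x" for x
    by (rule dpart_mult[OF C_inf_differentiable[OF \<eta>] C_inf_differentiable[OF test_fun_C_inf[OF \<phi>]]])
  note i1 = integrable_mult_test_fun[OF u test_fun_mult[OF C_inf_dpart[OF \<eta> b] \<phi>]]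
  note i2 = integrable_mult_test_fun[OF u test_fun_mult[OF \<eta> test_fun_dpart[OF \<phi> b]]]
  note i3 = integrable_mult_test_fun[OF gb t]
  have "(LINT x|lborel. u x * (dpart b \<eta> x * \<phi> x)) + (LINT x|lborel. u x * (\<eta> x * dpart b \<phi> x))
      = (LINT x|lborel. u x * dpart b (\<lambda>x. \<eta> x * \<phi> x) x)"
    unfolding d distrib_left by (rule Bochner_Integration.integral_add[OF i1 i2, symmetric])
  also have "\<dots> = - (LINT x|lborel. (g x \<bullet> b) * (\<eta> x * \<phi> x))"
    by (rule borel_weak_gradientD(5)[OF g t b])
  finally have "(LINT x|lborel. u x * (\<eta> x * dpart b \<phi> x))
      = - ((LINT x|lborel. (g x \<bullet> b) * (\<eta> x * \<phi> x)) + (LINT x|lborel. u x * (dpart b \<eta> x * \<phi> x)))"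
    by simp
  also have "\<dots> = - (LINT x|lborel. (g x \<bullet> b) * (\<eta> x * \<phi> x) + u x * (dpart b \<eta> x * \<phi> x))"
    using Bochner_Integration.integral_add[OF i3 i1] by simp
  finally show "(LINT x|lborel. \<eta> x * u x * dpart b \<phi> x)
      = - (LINT x|lborel. (\<eta> x *\<^sub>R g x + u x *\<^sub>R (\<Sum>b\<in>Basis. dpart b \<eta> x *\<^sub>R b)) \<bullet> b * \<phi> x)"
    unfolding comp by (simp add: algebra_simps)
qed

section \<open>Poincare inequalities\<close>

lemma emeasure_open_bounded:
  fixes D :: "'a::euclidean_space set"
  assumes "open D" "bounded D"
  shows "emeasure lborel D = ennreal (measure lborel D)"
  using emeasure_bounded_finite[OF assms(2)] by (intro emeasure_eq_ennreal_measure) simp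

lemma measure_open_bounded_pos:
  fixes D :: "'a::euclidean_space set"
  assumes "open D" "bounded D" "D \<noteq> {}"
  shows "measure lborel D > 0"
proof (rule ccontr)
  assume "\<not> measure lborel D > 0"
  then have "measure lborel D = 0" using measure_nonneg[of lborel D] by linarith
  then have "D \<in> null_sets lborel"
    using emeasure_open_bounded[OF assms(1,2)] assms(1) by (simp add: null_sets_def)
  then have "negligible D" by (simp add: negligible_iff_null_sets null_sets_completionI)
  then show False using open_not_negligible[OF assms(1,3)] by simp
qed

text \<open>Integrating the bound for the differences \<open>u(x + h) - u(x)\<close> over all \<open>h\<close> controls the
  double integral of \<open>u(x) - u(y)\<close>; convexity keeps the segment from \<open>x\<close> to \<open>x + h\<close> inside \<open>D\<close>.\<close>

lemma convex_double_integral_le: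
  fixes D :: "'a::euclidean_space set"
  assumes D: "open D" "convex D" "bounded D" and p: "p \<ge> 1"
  obtains K where "K > 0" "\<And>u g. borel_weak_gradient D u g \<Longrightarrow>
    (\<integral>\<^sup>+y\<in>D. Lp_int p D (\<lambda>x. u x - u y) \<partial>lborel) \<le> ennreal K * Lp_int p D g"
proof -
  obtain R where R: "R > 0" "\<forall>x\<in>D. norm x \<le> R" using D(3) unfolding bounded_pos by blast
  \<comment> \<open>Differences of points of D have norm at most 2 R, so only shifts h in this ball
    contribute.\<close>
  define B where "B = cball (0::'a) (2 * R)"
  have [measurable]: "B \<in> sets borel" unfolding B_def by simp
  have "emeasure lborel B < \<infinity>" unfolding B_def by (rule emeasure_bounded_finite) simp
  then have mB: "emeasure lborel B = ennreal (measure lborel B)"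
    by (intro emeasure_eq_ennreal_measure) simp
  \<comment> \<open>The summand 1 makes K positive without computing the measure of the
    ball.\<close>
  define K where "K = (2 * R) powr p * measure lborel B + 1"
  have K: "K > 0" unfolding K_def by (intro add_nonneg_pos) simp_all
  have [measurable]: "D \<in> sets borel" using D by simp
  show ?thesis
  proof (rule that[OF K])
    fix u g assume g: "borel_weak_gradient D u g"
    have [measurable]: "u \<in> borel_measurable borel" by (rule borel_weak_gradientD(3)[OF g])
    define F where "F y h = ennreal (norm (u (y + h) - u y) powr p) * indicator D (y + h) * indicator D y"
      for y h
    have "(\<integral>\<^sup>+y\<in>D. Lp_int p D (\<lambda>x. u x - u y) \<partial>lborel) = (\<integral>\<^sup>+y. (\<integral>\<^sup>+h. F y h \<partial>lborel) \<partial>lborel)"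
    proof (rule nn_integral_cong)
      fix y
      have "Lp_int p D (\<lambda>x. u x - u y) * indicator D y
          = (\<integral>\<^sup>+x. ennreal (norm (u x - u y) powr p) * indicator D x * indicator D y \<partial>lborel)"
        unfolding Lp_int_def by (rule nn_integral_multc[symmetric]) measurable
      also have "\<dots> = (\<integral>\<^sup>+h. ennreal (norm (u (h + y) - u y) powr p) * indicator D (h + y) * indicator D y \<partial>lborel)"
        by (rule nn_integral_translate[symmetric, where
              f = "\<lambda>x. ennreal (norm (u x - u y) powr p) * indicator D x * indicator D y"]) measurable
      finally show "Lp_int p D (\<lambda>x. u x - u y) * indicator D y = (\<integral>\<^sup>+h. F y h \<partial>lborel)"
        by (simp add: F_def add.commute)
    qed
    also have "\<dots> = (\<integral>\<^sup>+h. (\<integral>\<^sup>+y. F y h \<partial>lborel) \<partial>lborel)"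
      by (rule lborel_pair.Fubini'[symmetric]) (unfold F_def, measurable)
    also have "\<dots> \<le> (\<integral>\<^sup>+h. ennreal ((2 * R) powr p) * Lp_int p D g * indicator B h \<partial>lborel)"
    proof (rule nn_integral_mono)
      fix h :: 'a
      \<comment> \<open>For fixed h these are the y for which both ends of the segment from y to y +
        h lie in D.\<close>
      define U where "U = D \<inter> (\<lambda>y. y + h) -` D"
      have U: "open U" unfolding U_def
        by (intro open_Int D continuous_open_vimage) (auto intro!: continuous_intros)
      have eq: "(\<integral>\<^sup>+y. F y h \<partial>lborel) = Lp_int p U (\<lambda>y. u (y + h) - u y)"
        unfolding Lp_int_def by (rule nn_integral_cong) (auto simp: F_def U_def indicator_def)
      show "(\<integral>\<^sup>+y. F y h \<partial>lborel) \<le> ennreal ((2 * R) powr p) * Lp_int p D g * indicator B h"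
      proof (cases "U = {}")
        case True
        then show ?thesis unfolding eq by (simp add: Lp_int_def)
      next
        case False
        then obtain y where y: "y \<in> D" "y + h \<in> D" by (auto simp: U_def)
        have "norm h \<le> norm (y + h) + norm y"
          using norm_triangle_ineq4[of "y + h" y] by simp
        then have h: "norm h \<le> 2 * R" using R(2)[rule_format, OF y(1)] R(2)[rule_format, OF y(2)] by linarith
        have sweep: "x + s *\<^sub>R h \<in> D" if "x \<in> U" "0 \<le> s" "s \<le> 1" for x s
        proof -
          have "(1 - s) *\<^sub>R x + s *\<^sub>R (x + h) \<in> D"
            using D(2) that by (intro convexD) (auto simp: U_def)
          then show ?thesis by (simp add: algebra_simps)
        qed
        have "Lp_int p U (\<lambda>y. u (y + h) - u y) \<le> ennreal (norm h powr p) * Lp_int p D g"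
          by (rule Lp_int_difference_le[OF g U D(1) p sweep])
        also have "\<dots> \<le> ennreal ((2 * R) powr p) * Lp_int p D g"
          using h p by (intro mult_right_mono ennreal_leI powr_mono2) simp_all
        finally show ?thesis unfolding eq using h by (simp add: B_def)
      qed
    qed
    also have "\<dots> = ennreal ((2 * R) powr p) * Lp_int p D g * emeasure lborel B"
      by (rule nn_integral_cmult_indicator) simp
    also have "\<dots> = ennreal ((2 * R) powr p * measure lborel B) * Lp_int p D g"
      unfolding mB by (simp add: ennreal_mult mult_ac)
    also have "\<dots> \<le> ennreal K * Lp_int p D g"
      unfolding K_def by (intro mult_right_mono ennreal_leI) simp_all
    finally show "(\<integral>\<^sup>+y\<in>D. Lp_int p D (\<lambda>x. u x - u y) \<partial>lborel) \<le> ennreal K * Lp_int p D g" .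
  qed
qed

text \<open>A Poincare inequality with a free constant c in place of the mean, for every u with a
  weak gradient and without assuming u p-integrable. This generality is what lets it act on all of
  \<open>L1p\<close>.\<close>

definition oscillation_bound :: "real \<Rightarrow> 'a::euclidean_space set \<Rightarrow> real \<Rightarrow> bool" where
  "oscillation_bound p \<Omega> K \<longleftrightarrow> K > 0 \<and> (\<forall>u g. borel_weak_gradient \<Omega> u g \<longrightarrow>
     (\<exists>c. Lp_int p \<Omega> (\<lambda>x. u x - c) \<le> ennreal K * Lp_int p \<Omega> g))"

text \<open>Some \<open>y\<close> does at least as well as the average in the double integral; take \<open>c = u(y)\<close>.\<close>

lemma convex_oscillation_bound:
  fixes D :: "'a::euclidean_space set"
  assumes D: "open D" "convex D" "bounded D" "D \<noteq> {}" and p: "p \<ge> 1"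
  obtains K where "oscillation_bound p D K"
proof -
  obtain K where K: "K > 0" "\<And>u g. borel_weak_gradient D u g \<Longrightarrow>
    (\<integral>\<^sup>+y\<in>D. Lp_int p D (\<lambda>x. u x - u y) \<partial>lborel) \<le> ennreal K * Lp_int p D g"
    by (rule convex_double_integral_le[OF D(1-3) p]) (rule that; assumption)
  have [measurable]: "D \<in> sets borel" using D by simp
  define V where "V = measure lborel D"
  have mD: "emeasure lborel D = ennreal V" and V: "V > 0"
    unfolding V_def by (rule emeasure_open_bounded[OF D(1,3)], rule measure_open_bounded_pos[OF D(1,3,4)])
  have "oscillation_bound p D (K / V)"
    unfolding oscillation_bound_def
  proof (intro conjI allI impI)
    show "K / V > 0" using K(1) V by simp
    fix u g assume g: "borel_weak_gradient D u g"
    have [measurable]: "u \<in> borel_measurable borel" by (rule borel_weak_gradientD(3)[OF g])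
    define M where "M = ennreal (K / V) * Lp_int p D g"
    define F where "F y = Lp_int p D (\<lambda>x. u x - u y)" for y
    have F_meas[measurable]: "F \<in> borel_measurable borel"
      unfolding F_def Lp_int_def by measurable
    show "\<exists>c. Lp_int p D (\<lambda>x. u x - c) \<le> ennreal (K / V) * Lp_int p D g"
    \<comment> \<open>An infinite gradient integral makes the bound trivial for any c; a finite one
      is required for the strict comparison of integrals below.\<close>
    proof (cases "Lp_int p D g = \<infinity>")
      case True
      then show ?thesis using K(1) V by (simp add: ennreal_mult_top)
    next
      case fin: False
      have MV: "M * emeasure lborel D = ennreal K * Lp_int p D g"
      proof -
        have "M * emeasure lborel D = (ennreal (K / V) * ennreal V) * Lp_int p D g"
          unfolding M_def mD by (simp add: mult_ac)
        also have "ennreal (K / V) * ennreal V = ennreal K"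
          using K(1) V by (simp add: ennreal_mult[symmetric])
        finally show ?thesis .
      qed
      \<comment> \<open>If F exceeded M at every point of D, its integral would strictly exceed M
        times the measure of D, which is the known upper bound.\<close>
      have "\<exists>y\<in>D. F y \<le> M"
      proof (rule ccontr)
        assume "\<not> (\<exists>y\<in>D. F y \<le> M)"
        then have big: "M < F y" if "y \<in> D" for y using that by (simp add: not_le)
        have "(\<integral>\<^sup>+y\<in>D. M \<partial>lborel) < (\<integral>\<^sup>+y\<in>D. F y \<partial>lborel)"
        proof (rule nn_integral_less)
          show "(\<integral>\<^sup>+y\<in>D. M \<partial>lborel) \<noteq> \<infinity>"
            using MV fin by (simp add: nn_integral_cmult_indicator ennreal_mult_eq_top_iff)
          show "AE y in lborel. M * indicator D y \<le> F y * indicator D y"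
            using big by (intro AE_I2) (simp add: indicator_def less_imp_le)
          show "\<not> (AE y in lborel. F y * indicator D y \<le> M * indicator D y)"
          proof
            assume "AE y in lborel. F y * indicator D y \<le> M * indicator D y"
            then have "AE y in lborel. y \<notin> D"
              by eventually_elim (use big in \<open>auto simp: indicator_def not_le[symmetric]\<close>)
            then have "emeasure lborel D = 0"
              using AE_iff_measurable[of D lborel "\<lambda>y. y \<notin> D"] by simp
            then show False using mD V by simp
          qed
        qed simp_all
        also have "\<dots> \<le> M * emeasure lborel D"
          using K(2)[OF g] MV by (simp add: F_def)
        finally show False by (simp add: nn_integral_cmult_indicator)
      qed
      then show ?thesis unfolding F_def M_def by blast
    qed
  qed
  then show ?thesis by (rule that)
qed

text \<open>Attaching \<open>U\<close> to \<open>D\<close> costs one translation: \<open>u(x) - c = (u(x + h) - c) - (u(x + h) - u(x))\<close>.\<close>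

lemma oscillation_bound_attach:
  fixes D U :: "'a::euclidean_space set"
  assumes D: "open D" "oscillation_bound p D K" and U: "open U" and p: "p \<ge> 1"
    and sweep: "\<And>x s. x \<in> U \<Longrightarrow> 0 \<le> s \<Longrightarrow> s \<le> 1 \<Longrightarrow> x + s *\<^sub>R h \<in> U \<union> D"
    and into: "\<And>x. x \<in> U \<Longrightarrow> x + h \<in> D"
  obtains K' where "oscillation_bound p (U \<union> D) K'"
proof -
  define N where "N = norm h powr p"
  have N: "N \<ge> 0" by (simp add: N_def)
  have K: "K > 0" using D(2) by (simp add: oscillation_bound_def)
  have [measurable]: "D \<in> sets borel" "U \<in> sets borel" using D U by simp_all
  \<comment> \<open>The first summand pays for U, where N bounds the translation and K the values
    after it; the second pays for D.\<close>
  have "oscillation_bound p (U \<union> D) (2 powr p * (N + K) + K)"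
    unfolding oscillation_bound_def
  proof (intro conjI allI impI)
    show "0 < 2 powr p * (N + K) + K" using K N by (intro add_nonneg_pos) simp_all
    fix u g assume g: "borel_weak_gradient (U \<union> D) u g"
    have [measurable]: "u \<in> borel_measurable borel" by (rule borel_weak_gradientD(3)[OF g])
    define G where "G = Lp_int p (U \<union> D) g"
    have "borel_weak_gradient D u g" by (rule borel_weak_gradient_mono[OF g]) simp
    then obtain c where "Lp_int p D (\<lambda>x. u x - c) \<le> ennreal K * Lp_int p D g"
      using D(2) unfolding oscillation_bound_def by blast
    also have "\<dots> \<le> ennreal K * G" unfolding G_def
      by (intro mult_left_mono Lp_int_mono_set) simp_all
    finally have c: "Lp_int p D (\<lambda>x. u x - c) \<le> ennreal K * G" .
    have "Lp_int p U (\<lambda>x. u (x + h) - c)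
        \<le> (\<integral>\<^sup>+x. ennreal (norm (u (x + h) - c) powr p) * indicator D (x + h) \<partial>lborel)"
      unfolding Lp_int_def using into by (intro nn_integral_mono) (simp add: indicator_def)
    also have "\<dots> = Lp_int p D (\<lambda>x. u x - c)"
      unfolding Lp_int_def
      by (rule nn_integral_translate[where f = "\<lambda>x. ennreal (norm (u x - c) powr p) * indicator D x"]) measurable
    also note c
    finally have 1: "Lp_int p U (\<lambda>x. u (x + h) - c) \<le> ennreal K * G" .
    have "Lp_int p U (\<lambda>x. - (u (x + h) - u x)) = Lp_int p U (\<lambda>x. u (x + h) - u x)"
      unfolding Lp_int_def norm_minus_cancel ..
    also have "\<dots> \<le> ennreal N * G"
      unfolding N_def G_def using D U
      by (intro Lp_int_difference_le[OF g U _ p sweep]) (simp_all add: open_Un)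
    finally have 2: "Lp_int p U (\<lambda>x. - (u (x + h) - u x)) \<le> ennreal N * G" .
    have "Lp_int p U (\<lambda>x. u x - c) = Lp_int p U (\<lambda>x. - (u (x + h) - u x) + (u (x + h) - c))"
      by simp
    also have "\<dots> \<le> ennreal (2 powr p) *
        (Lp_int p U (\<lambda>x. - (u (x + h) - u x)) + Lp_int p U (\<lambda>x. u (x + h) - c))"
      by (rule Lp_int_add_le) (use p in simp_all)
    also have "\<dots> \<le> ennreal (2 powr p) * (ennreal N * G + ennreal K * G)"
      by (intro mult_left_mono add_mono 1 2) simp
    finally have 3: "Lp_int p U (\<lambda>x. u x - c) \<le> ennreal (2 powr p) * (ennreal N * G + ennreal K * G)" .
    have "Lp_int p (U \<union> D) (\<lambda>x. u x - c) \<le> Lp_int p U (\<lambda>x. u x - c) + Lp_int p D (\<lambda>x. u x - c)"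
      by (rule Lp_int_Un_le) simp_all
    also have "\<dots> \<le> ennreal (2 powr p) * (ennreal N * G + ennreal K * G) + ennreal K * G"
      by (rule add_mono[OF 3 c])
    also have "\<dots> = ennreal (2 powr p * (N + K) + K) * G"
      using N K by (simp add: ennreal_mult ennreal_plus distrib_right distrib_left mult.assoc)
    finally show "\<exists>c. Lp_int p (U \<union> D) (\<lambda>x. u x - c)
        \<le> ennreal (2 powr p * (N + K) + K) * Lp_int p (U \<union> D) g"
      unfolding G_def by blast
  qed
  then show ?thesis by (rule that)
qed

text \<open>Replacing c by the mean m adds the constant c - m, whose p-integral is at most that of u
  - c by Jensen's inequality. Hence the factor 2 K, and the power 2^p from splitting the
  sum.\<close>

lemma oscillation_bound_imp_poincare_domain:
  fixes \<Omega> :: "'a::euclidean_space set"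
  assumes \<Omega>: "open \<Omega>" "bounded \<Omega>" "\<Omega> \<noteq> {}" and p: "p \<ge> 1" and osc: "oscillation_bound p \<Omega> K"
  shows "poincare_domain p \<Omega>"
proof -
  have K: "K > 0" using osc by (simp add: oscillation_bound_def)
  have \<Omega>b[measurable]: "\<Omega> \<in> sets borel" using \<Omega> by simp
  define V where "V = measure lborel \<Omega>"
  have V: "V > 0" and mV: "emeasure lborel \<Omega> = ennreal V"
    unfolding V_def by (rule measure_open_bounded_pos[OF \<Omega>], rule emeasure_open_bounded[OF \<Omega>(1,2)])
  define C where "C = 2 powr p * (2 * K)"
  have C: "C > 0" using K by (simp add: C_def)
  have "(LINT x:\<Omega>|lebesgue. \<bar>u x - mean_value \<Omega> u\<bar> powr p)
      \<le> C * (LINT x:\<Omega>|lebesgue. norm (weak_grad \<Omega> u x) powr p)" if u: "u \<in> W1p \<Omega> p" for u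
  proof -
    have uL: "u \<in> L1p \<Omega> p" and inLp: "in_Lp \<Omega> p u" using u by (simp_all add: W1p_def)
    have um: "set_borel_measurable lebesgue \<Omega> u" using inLp by (simp add: in_Lp_def)
    obtain u' g where r: "borel_weak_gradient \<Omega> u' g" "AE x in lborel. x \<in> \<Omega> \<longrightarrow> u x = u' x"
      "Lp_int p \<Omega> g < \<infinity>"
      "(LINT x:\<Omega>|lebesgue. norm (weak_grad \<Omega> u x) powr p) = enn2real (Lp_int p \<Omega> g)"
      "in_Lp \<Omega> p u \<longleftrightarrow> Lp_int p \<Omega> u' < \<infinity>"
      by (rule L1p_borel_rep[OF \<Omega>(1) uL]) (rule that; assumption)
    have [measurable]: "u' \<in> borel_measurable borel" by (rule borel_weak_gradientD(3)[OF r(1)])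
    obtain c where c: "Lp_int p \<Omega> (\<lambda>x. u' x - c) \<le> ennreal K * Lp_int p \<Omega> g"
      using osc r(1) unfolding oscillation_bound_def by blast
    define m where "m = (LINT x:\<Omega>|lborel. u' x) / V"
    have mean: "mean_value \<Omega> u = m"
      unfolding mean_value_def m_def V_def
      using set_integrable_borel_rep(2)[OF um _ \<Omega>b r(2)] by simp
    \<comment> \<open>Here u in L^p enters: on a set of finite measure it makes the mean a genuine
      integral.\<close>
    have int: "set_integrable lborel \<Omega> u'"
      using r(5) inLp mV by (intro set_integrable_if_powr[OF p]) (simp_all add: Lp_int_def)
    have int_c: "set_integrable lborel \<Omega> (\<lambda>x. c)"
      using mV unfolding set_integrable_def by (intro integrable_scaleR_left integrable_real_indicator) simp_all
    have "(LINT x:\<Omega>|lborel. u' x - c) = (LINT x:\<Omega>|lborel. u' x) - (LINT x:\<Omega>|lborel. c)"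
      by (rule set_integral_diff(2)[OF int int_c])
    also have "(LINT x:\<Omega>|lborel. c) = c * V"
      unfolding set_lebesgue_integral_def V_def by simp
    finally have mc: "(LINT x:\<Omega>|lborel. u' x - c) / V = m - c"
      using V by (simp add: m_def diff_divide_distrib)
    have "ennreal (V * \<bar>m - c\<bar> powr p) \<le> Lp_int p \<Omega> (\<lambda>x. u' x - c)"
      using jensen_powr[OF p _ _ _ V_def V, of "\<lambda>x. u' x - c"] mV
      unfolding mc by (simp add: Lp_int_def)
    then have const: "Lp_int p \<Omega> (\<lambda>x. c - m) \<le> Lp_int p \<Omega> (\<lambda>x. u' x - c)"
      unfolding Lp_int_const[OF \<Omega>b] mV using V
      by (simp add: ennreal_mult[symmetric] abs_minus_commute mult.commute)
    have "Lp_int p \<Omega> (\<lambda>x. u' x - m) = Lp_int p \<Omega> (\<lambda>x. (u' x - c) + (c - m))" by simp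
    also have "\<dots> \<le> ennreal (2 powr p) * (Lp_int p \<Omega> (\<lambda>x. u' x - c) + Lp_int p \<Omega> (\<lambda>x. c - m))"
      by (rule Lp_int_add_le) (use p in simp_all)
    also have "\<dots> \<le> ennreal (2 powr p) * (ennreal K * Lp_int p \<Omega> g + ennreal K * Lp_int p \<Omega> g)"
      by (intro mult_left_mono add_mono c order_trans[OF const c]) simp
    also have "\<dots> = ennreal C * Lp_int p \<Omega> g"
      unfolding C_def using K by (simp add: ennreal_mult mult_2[symmetric] mult.assoc)
    finally have bound: "Lp_int p \<Omega> (\<lambda>x. u' x - m) \<le> ennreal C * Lp_int p \<Omega> g" .
    have "(\<lambda>x. indicator \<Omega> x * m) \<in> borel_measurable lborel" by simp
    then have "(\<lambda>x. indicator \<Omega> x * m) \<in> borel_measurable lebesgue" by (rule measurable_completion)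
    from borel_measurable_diff[OF um[unfolded set_borel_measurable_def] this]
    have diffm: "set_borel_measurable lebesgue \<Omega> (\<lambda>x. u x - m)"
      by (simp add: set_borel_measurable_def algebra_simps)
    have "(LINT x:\<Omega>|lebesgue. norm (u x - m) powr p) = enn2real (Lp_int p \<Omega> (\<lambda>x. u' x - m))"
      by (rule Lp_int_rep(2)[OF diffm _ \<Omega>b]) (simp, use r(2) in \<open>eventually_elim, simp\<close>)
    also have "\<dots> \<le> enn2real (ennreal C * Lp_int p \<Omega> g)"
      using r(3) by (intro enn2real_mono bound) (simp add: ennreal_mult_less_top)
    also have "\<dots> = C * (LINT x:\<Omega>|lebesgue. norm (weak_grad \<Omega> u x) powr p)"
      using C by (simp add: r(4) enn2real_mult)
    finally show ?thesis using mean by simp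
  qed
  then show ?thesis unfolding poincare_domain_def using \<Omega>(2) C by blast
qed

section \<open>Extension domains\<close>

text \<open>No linearity is asked of the operator, so it can be assembled by choice from one
  extension per function with a common constant.\<close>

lemma extension_domainI:
  assumes "C > 0"
    and "\<And>u. u \<in> X \<Omega> \<Longrightarrow> \<exists>w. w \<in> Y UNIV \<and> (AE x in lebesgue. x \<in> \<Omega> \<longrightarrow> w x = u x) \<and> Yn UNIV w \<le> C * Xn \<Omega> u"
  shows "extension_domain X Xn Y Yn \<Omega>"
proof -
  have "\<forall>u\<in>X \<Omega>. \<exists>w. w \<in> Y UNIV \<and> (AE x in lebesgue. x \<in> \<Omega> \<longrightarrow> w x = u x) \<and> Yn UNIV w \<le> C * Xn \<Omega> u"
    using assms(2) by blast
  from bchoice[OF this] show ?thesis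
    unfolding extension_domain_def using assms(1) by blast
qed

text \<open>The bound puts u - c in L^p although u is not assumed to be there, so E is applicable to
  it. Adding c back leaves the gradient unchanged, and only the gradient part of the W-norm is
  kept.\<close>

lemma W_extension_imp_L_extension:
  fixes \<Omega> :: "'a::euclidean_space set"
  assumes \<Omega>: "open \<Omega>" and p: "p \<ge> 1" and q: "q \<ge> 1" and osc: "oscillation_bound p \<Omega> K"
    and W: "W_extension_domain \<Omega> p q"
  shows "L_extension_domain \<Omega> p q"
proof -
  have K: "K > 0" using osc by (simp add: oscillation_bound_def)
  obtain E C where C: "C > 0" and E: "\<forall>u\<in>W1p \<Omega> p. E u \<in> W1p UNIV q
      \<and> (AE x in lebesgue. x \<in> \<Omega> \<longrightarrow> E u x = u x) \<and> W1p_norm UNIV q (E u) \<le> C * W1p_norm \<Omega> p u"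
    using W unfolding W_extension_domain_def extension_domain_def by blast
  \<comment> \<open>The p-integrals of u - c and of the gradient together are at most K + 1 times
    that of the gradient.\<close>
  define C' where "C' = C * (K + 1) powr (1/p)"
  show ?thesis
    unfolding L_extension_domain_def
  proof (rule extension_domainI[of C'])
    show "C' > 0" using C K by (simp add: C'_def)
    fix u assume u: "u \<in> L1p \<Omega> p"
    obtain u' g where r: "borel_weak_gradient \<Omega> u' g" "AE x in lborel. x \<in> \<Omega> \<longrightarrow> u x = u' x"
      "Lp_int p \<Omega> g < \<infinity>"
      "(LINT x:\<Omega>|lebesgue. norm (weak_grad \<Omega> u x) powr p) = enn2real (Lp_int p \<Omega> g)"
      by (rule L1p_borel_rep[OF \<Omega> u]) (rule that; assumption)
    obtain c where c: "Lp_int p \<Omega> (\<lambda>x. u' x - c) \<le> ennreal K * Lp_int p \<Omega> g"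
      using osc r(1) unfolding oscillation_bound_def by blast
    \<comment> \<open>The operator is applied to this shifted Borel representative; agreement with u
      on \<open>\<Omega>\<close> is recovered almost everywhere at the end.\<close>
    define u0 where "u0 = (\<lambda>x. u' x - c)"
    have g0: "borel_weak_gradient \<Omega> u0 g"
      using borel_weak_gradient_add_const[OF r(1), of "- c"] by (simp add: u0_def)
    have KG: "ennreal K * Lp_int p \<Omega> g < \<infinity>" using r(3) by (simp add: ennreal_mult_less_top)
    then have fin0: "Lp_int p \<Omega> u0 < \<infinity>" using c unfolding u0_def by (rule order.strict_trans1[rotated])
    note s = borel_weak_gradient_L1p[OF \<Omega> g0 r(3)]
    define v where "v = E u0"
    have v: "v \<in> W1p UNIV q" "AE x in lebesgue. x \<in> \<Omega> \<longrightarrow> v x = u0 x"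
      "W1p_norm UNIV q v \<le> C * W1p_norm \<Omega> p u0"
      using E s(3)[OF fin0] unfolding v_def by simp_all
    have vL: "v \<in> L1p UNIV q" and vin: "in_Lp UNIV q v" using v(1) by (simp_all add: W1p_def)
    obtain v' gv where t: "borel_weak_gradient UNIV v' gv" "AE x in lborel. x \<in> UNIV \<longrightarrow> v x = v' x"
      "Lp_int q UNIV gv < \<infinity>"
      "in_Lp UNIV q v \<Longrightarrow> (LINT x:UNIV|lebesgue. \<bar>v x\<bar> powr q + norm (weak_grad UNIV v x) powr q)
        = enn2real (Lp_int q UNIV v') + enn2real (Lp_int q UNIV gv)"
      by (rule L1p_borel_rep[OF open_UNIV vL]) (rule that; assumption)
    define w where "w = (\<lambda>x. v' x + c)"
    have gw: "borel_weak_gradient UNIV w gv"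
      unfolding w_def by (rule borel_weak_gradient_add_const[OF t(1)])
    note sw = borel_weak_gradient_L1p[OF open_UNIV gw t(3)]
    have "AE x in lborel. x \<in> \<Omega> \<longrightarrow> w x = u x"
      using v(2)[unfolded AE_completion_iff] t(2) r(2)
      by eventually_elim (simp add: w_def u0_def)
    then have ae: "AE x in lebesgue. x \<in> \<Omega> \<longrightarrow> w x = u x" by (simp add: AE_completion_iff)
    have "L1p_norm UNIV q w = enn2real (Lp_int q UNIV gv) powr (1/q)" by (rule sw(2))
    also have "\<dots> \<le> (enn2real (Lp_int q UNIV v') + enn2real (Lp_int q UNIV gv)) powr (1/q)"
      using q by (intro powr_mono2) simp_all
    also have "\<dots> = W1p_norm UNIV q v" unfolding W1p_norm_def t(4)[OF vin] ..
    also have "\<dots> \<le> C * W1p_norm \<Omega> p u0" by (rule v(3))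
    also have "\<dots> = C * (enn2real (Lp_int p \<Omega> u0) + enn2real (Lp_int p \<Omega> g)) powr (1/p)"
      by (simp only: s(4)[OF fin0])
    also have "\<dots> \<le> C * ((K + 1) * enn2real (Lp_int p \<Omega> g)) powr (1/p)"
    proof (intro mult_left_mono powr_mono2)
      have "enn2real (Lp_int p \<Omega> u0) \<le> enn2real (ennreal K * Lp_int p \<Omega> g)"
        using KG c unfolding u0_def by (intro enn2real_mono) simp_all
      also have "\<dots> = K * enn2real (Lp_int p \<Omega> g)" using K by (simp add: enn2real_mult)
      finally show "enn2real (Lp_int p \<Omega> u0) + enn2real (Lp_int p \<Omega> g) \<le> (K + 1) * enn2real (Lp_int p \<Omega> g)"
        by (simp add: distrib_right)
    qed (use C p in simp_all)
    also have "\<dots> = C' * L1p_norm \<Omega> p u"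
      unfolding C'_def L1p_norm_def r(4) by (subst powr_mult) simp
    finally show "\<exists>w. w \<in> L1p UNIV q \<and> (AE x in lebesgue. x \<in> \<Omega> \<longrightarrow> w x = u x)
        \<and> L1p_norm UNIV q w \<le> C' * L1p_norm \<Omega> p u"
      using sw(1) ae by blast
  qed
qed

section \<open>Cutoff functions and comparison of L^q integrals\<close>

lemma smooth_cutoff:
  fixes S :: "'a::euclidean_space set"
  assumes "bounded S"
  obtains \<eta> R where "C_inf \<eta>" "S \<subseteq> ball 0 R" "\<And>x. x \<in> S \<Longrightarrow> \<eta> x = 1" "\<And>x. \<bar>\<eta> x\<bar> \<le> 1"
    "test_fun (ball 0 R) \<eta>"
proof -
  obtain s :: "real \<Rightarrow> real" where s: "\<And>t. t \<le> 0 \<Longrightarrow> s t = 0" "\<And>t. t \<ge> 1 \<Longrightarrow> s t = 1"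
    "\<And>t. 0 \<le> s t" "\<And>t. s t \<le> 1" "\<And>(a::'a) d. C_inf (\<lambda>x. s (a \<bullet> x + d))"
    using smooth_step_exists[where 'a = 'a] by metis
  obtain a where a: "S \<subseteq> cbox (- a) a"
    using bounded_subset_cbox_symmetric[OF assms] by blast
  \<comment> \<open>The margin 1 in every coordinate is the length over which the step climbs from 0
    to 1.\<close>
  define K where "K = cbox (- (a + One)) (a + One)"
  have "bounded K" by (simp add: K_def)
  then obtain R where R: "K \<subseteq> ball 0 R" using bounded_subset_ballD by blast
  \<comment> \<open>The two factors for a coordinate switch off below -a_i - 1 and above a_i + 1,
    and both equal 1 between -a_i and a_i.\<close>
  define \<eta> where "\<eta> x = (\<Prod>i\<in>Basis. s (i \<bullet> x + (a \<bullet> i + 1)) * s ((- i) \<bullet> x + (a \<bullet> i + 1)))" for x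
  have smooth: "C_inf \<eta>"
    unfolding \<eta>_def by (rule C_inf_prod[OF finite_Basis]) (rule C_inf_mult[OF s(5) s(5)])
  have zero: "\<eta> x = 0" if out: "x \<notin> K" for x
  proof -
    obtain i :: 'a where i: "i \<in> Basis" "x \<bullet> i < - (a \<bullet> i + 1) \<or> a \<bullet> i + 1 < x \<bullet> i"
      using out by (auto simp: K_def mem_box inner_add_left inner_diff_left not_le)
    then have "s (i \<bullet> x + (a \<bullet> i + 1)) * s ((- i) \<bullet> x + (a \<bullet> i + 1)) = 0"
      using s(1)[of "i \<bullet> x + (a \<bullet> i + 1)"] s(1)[of "(- i) \<bullet> x + (a \<bullet> i + 1)"]
      by (auto simp: inner_commute)
    then show ?thesis unfolding \<eta>_def using i(1) by (intro prod_zero) auto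
  qed
  have one: "\<eta> x = 1" if "x \<in> S" for x
  proof -
    have "x \<in> cbox (- a) a" using a that by blast
    then have box: "- (a \<bullet> i) \<le> x \<bullet> i" "x \<bullet> i \<le> a \<bullet> i" if "i \<in> Basis" for i
      using that by (simp_all add: mem_box)
    have "s (i \<bullet> x + (a \<bullet> i + 1)) * s ((- i) \<bullet> x + (a \<bullet> i + 1)) = 1" if "i \<in> Basis" for i
      using box[OF that] by (simp add: s(2) inner_commute[of i x])
    then show ?thesis unfolding \<eta>_def by simp
  qed
  have "S \<subseteq> K" using one zero by force
  moreover have "\<bar>\<eta> x\<bar> \<le> 1" for x
    unfolding \<eta>_def abs_prod using s(3,4)
    by (intro prod_le_1) (simp add: mult_le_one)
  moreover have "test_fun (ball 0 R) \<eta>"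
    by (rule test_funI[OF smooth _ R zero]) (simp add: K_def)
  ultimately show ?thesis using that[of \<eta> R] smooth one R by blast
qed

text \<open>Average \<open>\<bar>v(x)\<bar> \<le> \<bar>v(x) - v(y)\<bar> + \<bar>v(y)\<bar>\<close> over \<open>y\<close> in the subset \<open>\<Omega>\<close>.\<close>

lemma Lp_int_le_subset:
  fixes D :: "'a::euclidean_space set"
  assumes D: "open D" "convex D" "bounded D" and \<Omega>: "open \<Omega>" "\<Omega> \<noteq> {}" "\<Omega> \<subseteq> D" and q: "q \<ge> 1"
  obtains K where "K > 0" "\<And>v g. borel_weak_gradient D v g \<Longrightarrow>
    Lp_int q D v \<le> ennreal K * (Lp_int q D g + Lp_int q \<Omega> v)"
proof -
  obtain K where K: "K > 0" "\<And>u g. borel_weak_gradient D u g \<Longrightarrow>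
    (\<integral>\<^sup>+y\<in>D. Lp_int q D (\<lambda>x. u x - u y) \<partial>lborel) \<le> ennreal K * Lp_int q D g"
    by (rule convex_double_integral_le[OF D q]) (rule that; assumption)
  have b\<Omega>: "bounded \<Omega>" by (rule bounded_subset[OF D(3) \<Omega>(3)])
  have [measurable]: "\<Omega> \<in> sets borel" "D \<in> sets borel" using \<Omega> D by simp_all
  define V where "V = measure lborel \<Omega>"
  define W where "W = measure lborel D"
  have V: "V > 0" "emeasure lborel \<Omega> = ennreal V" unfolding V_def
    by (rule measure_open_bounded_pos[OF \<Omega>(1) b\<Omega> \<Omega>(2)], rule emeasure_open_bounded[OF \<Omega>(1) b\<Omega>])
  have W: "W \<ge> 0" "emeasure lborel D = ennreal W" unfolding W_def
    by (rule measure_nonneg, rule emeasure_open_bounded[OF D(1,3)])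
  \<comment> \<open>K comes from the double integral, W from integrating the constant |v(y)|^q over
    D, and the division by V from averaging over \<open>\<Omega>\<close>.\<close>
  define K' where "K' = 2 powr q * (K + W) / V"
  have K': "K' > 0" unfolding K'_def using K W V by (intro divide_pos_pos mult_pos_pos add_pos_nonneg) simp_all
  show ?thesis
  proof (rule that[OF K'])
    fix v g assume g: "borel_weak_gradient D v g"
    have [measurable]: "v \<in> borel_measurable borel" by (rule borel_weak_gradientD(3)[OF g])
    define G where "G = Lp_int q D g"
    define B where "B = Lp_int q \<Omega> v"
    have "Lp_int q D v * ennreal V = (\<integral>\<^sup>+y\<in>\<Omega>. Lp_int q D v \<partial>lborel)"
      by (simp add: nn_integral_cmult_indicator V)
    \<comment> \<open>In the first term y is allowed to run over all of D, which produces the double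
      integral already estimated.\<close>
    also have "\<dots> \<le> (\<integral>\<^sup>+y. ennreal (2 powr q) * (Lp_int q D (\<lambda>x. v x - v y) * indicator D y
        + ennreal W * (ennreal (norm (v y) powr q) * indicator \<Omega> y)) \<partial>lborel)"
    proof (rule nn_integral_mono)
      fix y
      show "Lp_int q D v * indicator \<Omega> y \<le> ennreal (2 powr q) * (Lp_int q D (\<lambda>x. v x - v y) * indicator D y
        + ennreal W * (ennreal (norm (v y) powr q) * indicator \<Omega> y))"
      proof (cases "y \<in> \<Omega>")
        case True
        then have "y \<in> D" using \<Omega>(3) by blast
        have "Lp_int q D v = Lp_int q D (\<lambda>x. (v x - v y) + v y)" by simp
        also have "\<dots> \<le> ennreal (2 powr q) * (Lp_int q D (\<lambda>x. v x - v y) + Lp_int q D (\<lambda>x. v y))"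
          by (rule Lp_int_add_le) (use q in simp_all)
        also have "Lp_int q D (\<lambda>x. v y) = ennreal W * ennreal (norm (v y) powr q)"
          by (subst Lp_int_const) (simp_all add: W mult.commute)
        finally show ?thesis using True \<open>y \<in> D\<close> by simp
      qed simp
    qed
    also have "\<dots> = ennreal (2 powr q) * ((\<integral>\<^sup>+y\<in>D. Lp_int q D (\<lambda>x. v x - v y) \<partial>lborel)
        + ennreal W * (\<integral>\<^sup>+y\<in>\<Omega>. ennreal (norm (v y) powr q) \<partial>lborel))"
      unfolding Lp_int_def
      by (simp add: nn_integral_cmult nn_integral_add)
    also have "\<dots> \<le> ennreal (2 powr q) * (ennreal K * G + ennreal W * B)"
      unfolding B_def G_def Lp_int_def[of q \<Omega>]
      by (intro mult_left_mono add_mono K(2)[OF g] order_refl) simp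
    also have "\<dots> \<le> ennreal (2 powr q) * (ennreal (K + W) * G + ennreal (K + W) * B)"
      using K(1) W(1) by (intro mult_left_mono add_mono mult_right_mono ennreal_leI) simp_all
    also have "\<dots> = ennreal (2 powr q * (K + W)) * (G + B)"
    proof -
      have "ennreal (2 powr q * (K + W)) = ennreal (2 powr q) * ennreal (K + W)"
        using K(1) W(1) by (intro ennreal_mult) simp_all
      then show ?thesis by (simp only: distrib_left mult.assoc)
    qed
    finally have main: "Lp_int q D v * ennreal V \<le> ennreal (2 powr q * (K + W)) * (G + B)" .
    have "Lp_int q D v = (Lp_int q D v * ennreal V) * ennreal (1 / V)"
      using V(1) by (simp add: mult.assoc ennreal_mult[symmetric])
    also have "\<dots> \<le> ennreal (2 powr q * (K + W)) * (G + B) * ennreal (1 / V)"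
      by (rule mult_right_mono[OF main]) simp
    also have "\<dots> = (ennreal (2 powr q * (K + W)) * ennreal (1 / V)) * (G + B)"
      by (simp add: mult_ac)
    also have "ennreal (2 powr q * (K + W)) * ennreal (1 / V) = ennreal K'"
      unfolding K'_def using V(1) K(1) W(1) by (subst ennreal_mult[symmetric]) simp_all
    finally show "Lp_int q D v \<le> ennreal K' * (Lp_int q D g + Lp_int q \<Omega> v)"
      unfolding G_def B_def .
  qed
qed

text \<open>Hoelder's inequality on a set of finite measure, obtained from Jensen's inequality for
  |f|^q with the exponent p/q >= 1.\<close>

lemma Lp_int_exponent_le:
  fixes f :: "'a::euclidean_space \<Rightarrow> real"
  assumes [measurable]: "f \<in> borel_measurable borel" and \<Omega>: "\<Omega> \<in> sets borel"
    and V: "V > 0" "emeasure lborel \<Omega> = ennreal V" and q: "1 \<le> q" "q \<le> p"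
    and fin: "Lp_int p \<Omega> f < \<infinity>"
  shows "Lp_int q \<Omega> f < \<infinity>"
    and "enn2real (Lp_int q \<Omega> f) powr (1/q)
      \<le> V powr (1/q) * (1 / V) powr (1/p) * enn2real (Lp_int p \<Omega> f) powr (1/p)"
proof -
  note [measurable] = \<Omega>
  have r: "p / q \<ge> 1" using q by simp
  have pw: "\<bar>\<bar>f x\<bar> powr q\<bar> powr (p / q) = norm (f x) powr p" for x
    using q by (simp add: powr_powr)
  have m: "(\<lambda>x. \<bar>f x\<bar> powr q) \<in> borel_measurable lborel" by simp
  have finV: "emeasure lborel \<Omega> < \<infinity>" using V by simp
  have "set_integrable lborel \<Omega> (\<lambda>x. \<bar>f x\<bar> powr q)"
    by (rule set_integrable_if_powr[OF r m _ finV])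
      (use fin \<Omega> in \<open>simp_all only: pw Lp_int_def sets_lborel\<close>)
  then have int: "integrable lborel (\<lambda>x. indicator \<Omega> x * \<bar>f x\<bar> powr q)"
    by (simp add: set_integrable_def)
  have nn: "(\<integral>\<^sup>+x. ennreal (indicator \<Omega> x * \<bar>f x\<bar> powr q) \<partial>lborel) = Lp_int q \<Omega> f"
    unfolding Lp_int_def by (rule nn_integral_cong) (simp add: indicator_def)
  have eq: "Lp_int q \<Omega> f = ennreal (LINT x:\<Omega>|lborel. \<bar>f x\<bar> powr q)"
    unfolding nn[symmetric] set_lebesgue_integral_def
    using nn_integral_eq_integral[OF int] by simp
  then show "Lp_int q \<Omega> f < \<infinity>" by simp
  define a where "a = enn2real (Lp_int q \<Omega> f)"
  define b where "b = enn2real (Lp_int p \<Omega> f)"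
  have a0: "a \<ge> 0" and b0: "b \<ge> 0" by (simp_all add: a_def b_def)
  have "0 \<le> (LINT x:\<Omega>|lborel. \<bar>f x\<bar> powr q)"
    unfolding set_lebesgue_integral_def by (rule integral_nonneg_AE) simp
  then have a: "(LINT x:\<Omega>|lborel. \<bar>f x\<bar> powr q) = a"
    unfolding a_def eq by simp
  have mV: "V = measure lborel \<Omega>" using V by (simp add: measure_def)
  have "ennreal (V * \<bar>a / V\<bar> powr (p / q)) \<le> Lp_int p \<Omega> f"
    using jensen_powr[OF r m _ finV mV V(1)] \<Omega> unfolding a pw Lp_int_def by simp
  then have "enn2real (ennreal (V * \<bar>a / V\<bar> powr (p / q))) \<le> b"
    unfolding b_def using fin by (intro enn2real_mono) simp_all
  then have "V * (a / V) powr (p / q) \<le> b"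
    using V(1) a0 by simp
  then have "(a / V) powr (p / q) \<le> b / V"
    using V(1) by (simp add: pos_le_divide_eq mult.commute)
  \<comment> \<open>Taking p-th roots turns the exponent p / q into 1 / q.\<close>
  then have "((a / V) powr (p / q)) powr (1 / p) \<le> (b / V) powr (1 / p)"
    using q by (intro powr_mono2) simp_all
  then have "(a / V) powr (1 / q) \<le> (b / V) powr (1 / p)"
    using q by (simp add: powr_powr)
  then have "V powr (1 / q) * (a / V) powr (1 / q) \<le> V powr (1 / q) * (b / V) powr (1 / p)"
    by (rule mult_left_mono) simp
  also have "V powr (1 / q) * (a / V) powr (1 / q) = a powr (1 / q)"
    using V(1) a0 by (simp add: powr_mult[symmetric])
  also have "(b / V) powr (1 / p) = (1 / V) powr (1 / p) * b powr (1 / p)"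
    using powr_mult[of "1 / V" b "1 / p"] by simp
  finally show "enn2real (Lp_int q \<Omega> f) powr (1/q)
      \<le> V powr (1/q) * (1 / V) powr (1/p) * enn2real (Lp_int p \<Omega> f) powr (1/p)"
    unfolding a_def b_def by (simp add: mult.assoc)
qed

lemma Lp_int_mult_le:
  fixes f :: "'a::euclidean_space \<Rightarrow> 'b::euclidean_space" and f' :: "'a \<Rightarrow> 'c::real_normed_vector"
  assumes [measurable]: "f \<in> borel_measurable borel" "D \<in> sets borel" and p: "p \<ge> 0" and M: "M \<ge> 0"
    and bound: "\<And>x. x \<in> D \<Longrightarrow> norm (f' x) \<le> M * norm (f x)" and off: "\<And>x. x \<notin> D \<Longrightarrow> f' x = 0"
  shows "Lp_int p UNIV f' \<le> ennreal (M powr p) * Lp_int p D f"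
proof -
  have "Lp_int p UNIV f' \<le> (\<integral>\<^sup>+x. ennreal (M powr p) * (ennreal (norm (f x) powr p) * indicator D x) \<partial>lborel)"
    unfolding Lp_int_def
  proof (rule nn_integral_mono)
    fix x
    show "ennreal (norm (f' x) powr p) * indicator UNIV x
      \<le> ennreal (M powr p) * (ennreal (norm (f x) powr p) * indicator D x)"
    proof (cases "x \<in> D")
      case True
      have "norm (f' x) powr p \<le> (M * norm (f x)) powr p"
        using bound[OF True] p by (intro powr_mono2) simp_all
      also have "\<dots> = M powr p * norm (f x) powr p" by (rule powr_mult)
      finally show ?thesis using True by (simp add: ennreal_mult[symmetric] ennreal_leI)
    qed (simp add: off)
  qed
  also have "\<dots> = ennreal (M powr p) * Lp_int p D f"
    unfolding Lp_int_def by (rule nn_integral_cmult) measurable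
  finally show ?thesis .
qed

text \<open>The product rule gives the gradient term v grad \<open>\<eta>\<close>, so the L^q bound
  for v on the ball is needed twice, for the function and for its gradient. On
  \<open>\<Omega>\<close> itself v equals u, and there q <= p and finite measure bound its q-norm by
  the p-norm.\<close>

lemma L_extension_imp_W_extension:
  fixes \<Omega> :: "'a::euclidean_space set"
  assumes \<Omega>: "open \<Omega>" "bounded \<Omega>" "\<Omega> \<noteq> {}" and q: "1 \<le> q" and pq: "q \<le> p"
    and L: "L_extension_domain \<Omega> p q"
  shows "W_extension_domain \<Omega> p q"
proof -
  have \<Omega>b[measurable]: "\<Omega> \<in> sets borel" using \<Omega> by simp
  obtain E C where C: "C > 0" and E: "\<forall>u\<in>L1p \<Omega> p. E u \<in> L1p UNIV q
      \<and> (AE x in lebesgue. x \<in> \<Omega> \<longrightarrow> E u x = u x) \<and> L1p_norm UNIV q (E u) \<le> C * L1p_norm \<Omega> p u"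
    using L unfolding L_extension_domain_def extension_domain_def by blast
  obtain \<eta> R where \<eta>: "C_inf \<eta>" "\<Omega> \<subseteq> ball 0 R" "\<And>x. x \<in> \<Omega> \<Longrightarrow> \<eta> x = 1" "\<And>x. \<bar>\<eta> x\<bar> \<le> 1"
    and \<eta>_test: "test_fun (ball 0 R) \<eta>"
    by (rule smooth_cutoff[OF \<Omega>(2)]) (rule that; assumption)
  define D where "D = ball (0::'a) R"
  have D: "open D" "convex D" "bounded D" "\<Omega> \<subseteq> D" and Db[measurable]: "D \<in> sets borel"
    using \<eta>(2) by (simp_all add: D_def)
  define d\<eta> where "d\<eta> x = (\<Sum>b\<in>Basis. dpart b \<eta> x *\<^sub>R b)" for x
  have off: "\<eta> x = 0" "dpart b \<eta> x = 0" if "x \<notin> D" for x b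
  proof -
    have "x \<notin> tsupport \<eta>" using that \<eta>_test unfolding D_def test_fun_def by blast
    then show "\<eta> x = 0" "dpart b \<eta> x = 0"
      by (rule tsupport_zero, rule test_fun_dpart_zero[OF \<eta>_test])
  qed
  have "\<exists>M. \<forall>x. \<bar>dpart b \<eta> x\<bar> \<le> M" if "b \<in> Basis" for b
    by (rule test_fun_bounded[OF test_fun_dpart[OF \<eta>_test that]]) (rule exI, rule allI)
  then obtain m where m: "\<And>b x. b \<in> Basis \<Longrightarrow> \<bar>dpart b \<eta> x\<bar> \<le> m b" by metis
  \<comment> \<open>A bound for the gradient of \<open>\<eta>\<close>: the sum of bounds for its
    partial derivatives.\<close>
  define M where "M = (\<Sum>b\<in>(Basis::'a set). m b)"
  have d\<eta>_le: "norm (d\<eta> x) \<le> M" for x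
    unfolding d\<eta>_def M_def by (rule sum_norm_le) (use m in simp)
  have M: "M \<ge> 0" using order_trans[OF norm_ge_zero d\<eta>_le] .
  obtain K where K: "K > 0" "\<And>v g. borel_weak_gradient D v g \<Longrightarrow>
      Lp_int q D v \<le> ennreal K * (Lp_int q D g + Lp_int q \<Omega> v)"
    by (rule Lp_int_le_subset[OF D(1-3) \<Omega>(1,3) D(4) q]) (rule that; assumption)
  define V where "V = measure lborel \<Omega>"
  have V: "V > 0" "emeasure lborel \<Omega> = ennreal V"
    unfolding V_def by (rule measure_open_bounded_pos[OF \<Omega>], rule emeasure_open_bounded[OF \<Omega>(1,2)])
  \<comment> \<open>The constant in Hoelder's inequality for passing from exponent p to q on
    \<open>\<Omega>\<close>.\<close>
  define c where "c = V powr (1/q) * (1 / V) powr (1/p)"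
  have c: "c \<ge> 0" by (simp add: c_def)
  \<comment> \<open>K bounds the q-integral of the product with the cutoff; the rest bounds its
    gradient, with 1 from \<open>\<eta>\<close> grad v and M^q K from v grad
    \<open>\<eta>\<close>.\<close>
  define T where "T = K + 2 powr q * (1 + M powr q * K)"
  have T: "T > 0" unfolding T_def using K by (intro add_pos_nonneg) simp_all
  define C' where "C' = (T * (C powr q + c powr q)) powr (1/q)"
  show ?thesis
    unfolding W_extension_domain_def
  proof (rule extension_domainI[of C'])
    have "C powr q + c powr q > 0" using C by (intro add_pos_nonneg) simp_all
    then show "C' > 0" unfolding C'_def using T by simp
    fix u assume u: "u \<in> W1p \<Omega> p"
    have uL: "u \<in> L1p \<Omega> p" and inLp: "in_Lp \<Omega> p u" using u by (simp_all add: W1p_def)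
    obtain u' g where r: "borel_weak_gradient \<Omega> u' g" "AE x in lborel. x \<in> \<Omega> \<longrightarrow> u x = u' x"
      "Lp_int p \<Omega> g < \<infinity>"
      "(LINT x:\<Omega>|lebesgue. norm (weak_grad \<Omega> u x) powr p) = enn2real (Lp_int p \<Omega> g)"
      "in_Lp \<Omega> p u \<longleftrightarrow> Lp_int p \<Omega> u' < \<infinity>"
      "in_Lp \<Omega> p u \<Longrightarrow> (LINT x:\<Omega>|lebesgue. \<bar>u x\<bar> powr p + norm (weak_grad \<Omega> u x) powr p)
        = enn2real (Lp_int p \<Omega> u') + enn2real (Lp_int p \<Omega> g)"
      by (rule L1p_borel_rep[OF \<Omega>(1) uL]) (rule that; assumption)
    have u'fin: "Lp_int p \<Omega> u' < \<infinity>" using r(5) inLp by simp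
    define N where "N = W1p_norm \<Omega> p u"
    have N: "N = (enn2real (Lp_int p \<Omega> u') + enn2real (Lp_int p \<Omega> g)) powr (1/p)"
      unfolding N_def W1p_norm_def r(6)[OF inLp] ..
    have N0: "N \<ge> 0" by (simp add: N)
    have p0: "0 \<le> 1 / p" using q pq by simp
    define v where "v = E u"
    have v: "v \<in> L1p UNIV q" "AE x in lebesgue. x \<in> \<Omega> \<longrightarrow> v x = u x"
      "L1p_norm UNIV q v \<le> C * L1p_norm \<Omega> p u"
      using E uL unfolding v_def by simp_all
    obtain v' gv where t: "borel_weak_gradient UNIV v' gv" "AE x in lborel. x \<in> UNIV \<longrightarrow> v x = v' x"
      "Lp_int q UNIV gv < \<infinity>"
      "(LINT x:UNIV|lebesgue. norm (weak_grad UNIV v x) powr q) = enn2real (Lp_int q UNIV gv)"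
      by (rule L1p_borel_rep[OF open_UNIV v(1)]) (rule that; assumption)
    have [measurable]: "v' \<in> borel_measurable borel" "gv \<in> borel_measurable borel"
      "u' \<in> borel_measurable borel" "\<eta> \<in> borel_measurable borel"
      by (rule borel_weak_gradientD(3)[OF t(1)], rule borel_weak_gradientD(2)[OF t(1)],
          rule borel_weak_gradientD(3)[OF r(1)], rule C_inf_measurable[OF \<eta>(1)])
    have [measurable]: "dpart b \<eta> \<in> borel_measurable borel" if "b \<in> Basis" for b
      by (rule C_inf_measurable[OF C_inf_dpart[OF \<eta>(1) that]])
    have d\<eta>_meas[measurable]: "d\<eta> \<in> borel_measurable borel" unfolding d\<eta>_def by measurable
    have ae: "AE x in lborel. x \<in> \<Omega> \<longrightarrow> v' x = u x"
      using v(2)[unfolded AE_completion_iff] t(2) by eventually_elim simp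
    then have "AE x in lborel. x \<in> \<Omega> \<longrightarrow> v' x = u' x"
      using r(2) by eventually_elim simp
    then have vu: "Lp_int q \<Omega> v' = Lp_int q \<Omega> u'" by (rule Lp_int_cong_AE)
    define A where "A = Lp_int q UNIV gv"
    define B where "B = Lp_int q \<Omega> u'"
    have A: "A < \<infinity>" using t(3) by (simp add: A_def)
    have B: "B < \<infinity>"
      unfolding B_def by (rule Lp_int_exponent_le(1)[OF _ \<Omega>b V q pq u'fin]) simp
    have "enn2real A powr (1/q) = L1p_norm UNIV q v"
      unfolding A_def L1p_norm_def t(4) ..
    also have "\<dots> \<le> C * L1p_norm \<Omega> p u" by (rule v(3))
    also have "\<dots> \<le> C * N"
      unfolding N L1p_norm_def r(4) using C p0 by (intro mult_left_mono powr_mono2) simp_all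
    \<comment> \<open>Norm bounds are raised to the power q because the contributions of function
      and gradient add as integrals.\<close>
    finally have "(enn2real A powr (1/q)) powr q \<le> (C * N) powr q"
      using q by (intro powr_mono2) simp_all
    then have A_le: "enn2real A \<le> C powr q * N powr q"
      using q by (simp add: powr_powr powr_mult)
    have "enn2real B powr (1/q) \<le> c * enn2real (Lp_int p \<Omega> u') powr (1/p)"
      unfolding B_def c_def by (rule Lp_int_exponent_le(2)[OF _ \<Omega>b V q pq u'fin]) simp
    also have "\<dots> \<le> c * N"
      unfolding N using c p0 by (intro mult_left_mono powr_mono2) simp_all
    finally have "(enn2real B powr (1/q)) powr q \<le> (c * N) powr q"
      using q by (intro powr_mono2) simp_all
    then have B_le: "enn2real B \<le> c powr q * N powr q"
      using q by (simp add: powr_powr powr_mult)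
    have "Lp_int q D v' \<le> ennreal K * (Lp_int q D gv + Lp_int q \<Omega> v')"
      by (rule K(2)[OF borel_weak_gradient_mono[OF t(1) subset_UNIV]])
    also have "\<dots> \<le> ennreal K * (A + B)"
      unfolding A_def B_def vu by (intro mult_left_mono add_mono Lp_int_mono_set) simp_all
    finally have Dv: "Lp_int q D v' \<le> ennreal K * (A + B)" .
    define w where "w x = \<eta> x * v' x" for x
    define gw where "gw x = \<eta> x *\<^sub>R gv x + v' x *\<^sub>R d\<eta> x" for x
    have gw: "borel_weak_gradient UNIV w gw"
      unfolding w_def gw_def d\<eta>_def by (rule borel_weak_gradient_mult[OF t(1) \<eta>(1)])
    have q0: "q \<ge> 0" using q by simp
    have mult_le: "\<bar>\<eta> x\<bar> * y \<le> 1 * y" if "y \<ge> 0" for x y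
      by (rule mult_right_mono[OF \<eta>(4) that])
    have "Lp_int q UNIV w \<le> ennreal (1 powr q) * Lp_int q D v'"
      by (rule Lp_int_mult_le) (use q0 off(1) mult_le in \<open>simp_all add: w_def abs_mult\<close>)
    then have w_le: "Lp_int q UNIV w \<le> ennreal K * (A + B)" using Dv by simp
    have 1: "Lp_int q UNIV (\<lambda>x. \<eta> x *\<^sub>R gv x) \<le> ennreal (1 powr q) * Lp_int q UNIV gv"
      by (rule Lp_int_mult_le) (use q0 mult_le in simp_all)
    have 2: "Lp_int q UNIV (\<lambda>x. v' x *\<^sub>R d\<eta> x) \<le> ennreal (M powr q) * Lp_int q D v'"
    proof (rule Lp_int_mult_le)
      show "norm (v' x *\<^sub>R d\<eta> x) \<le> M * norm (v' x)" for x
        using mult_right_mono[OF d\<eta>_le, of "\<bar>v' x\<bar>"] by (simp add: mult.commute)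
      show "v' x *\<^sub>R d\<eta> x = 0" if "x \<notin> D" for x
        using off(2)[OF that] by (simp add: d\<eta>_def)
    qed (use q0 M in simp_all)
    have "Lp_int q UNIV gw \<le> ennreal (2 powr q) *
        (Lp_int q UNIV (\<lambda>x. \<eta> x *\<^sub>R gv x) + Lp_int q UNIV (\<lambda>x. v' x *\<^sub>R d\<eta> x))"
      unfolding gw_def by (rule Lp_int_add_le) (use q0 in simp_all)
    also have "\<dots> \<le> ennreal (2 powr q) * ((A + B) + ennreal (M powr q) * (ennreal K * (A + B)))"
    proof (intro mult_left_mono add_mono)
      show "Lp_int q UNIV (\<lambda>x. \<eta> x *\<^sub>R gv x) \<le> A + B"
        using 1 by (simp add: A_def add_increasing2)
      show "Lp_int q UNIV (\<lambda>x. v' x *\<^sub>R d\<eta> x) \<le> ennreal (M powr q) * (ennreal K * (A + B))"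
        by (rule order_trans[OF 2]) (intro mult_left_mono Dv, simp)
    qed simp
    also have "\<dots> = ennreal (2 powr q * (1 + M powr q * K)) * (A + B)"
      using K(1) by (simp add: ennreal_mult distrib_right mult.assoc)
    finally have gw_le: "Lp_int q UNIV gw \<le> ennreal (2 powr q * (1 + M powr q * K)) * (A + B)" .
    have AB: "A + B < \<infinity>" using A B by simp
    have fin: "Lp_int q UNIV w < \<infinity>" "Lp_int q UNIV gw < \<infinity>"
      using w_le gw_le AB by (auto intro: order.strict_trans1 simp: ennreal_mult_less_top)
    note sw = borel_weak_gradient_L1p(3,4)[OF open_UNIV gw fin(2) fin(1)]
    have "enn2real (Lp_int q UNIV w) + enn2real (Lp_int q UNIV gw)
        \<le> K * (enn2real A + enn2real B) + 2 powr q * (1 + M powr q * K) * (enn2real A + enn2real B)"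
    proof (rule add_mono)
      have eAB: "enn2real (A + B) = enn2real A + enn2real B"
        by (rule enn2real_plus) (use A B in simp_all)
      show "enn2real (Lp_int q UNIV w) \<le> K * (enn2real A + enn2real B)"
        using enn2real_mono[OF w_le] AB K(1) by (simp add: ennreal_mult_less_top enn2real_mult eAB)
      show "enn2real (Lp_int q UNIV gw) \<le> 2 powr q * (1 + M powr q * K) * (enn2real A + enn2real B)"
        using enn2real_mono[OF gw_le] AB K(1) by (simp add: ennreal_mult_less_top enn2real_mult eAB)
    qed
    also have "\<dots> = T * (enn2real A + enn2real B)" by (simp add: T_def distrib_right)
    also have "\<dots> \<le> T * (C powr q * N powr q + c powr q * N powr q)"
      using T by (intro mult_left_mono add_mono A_le B_le) simp
    also have "\<dots> = (T * (C powr q + c powr q)) * N powr q" by (simp add: algebra_simps)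
    finally have sum_le: "enn2real (Lp_int q UNIV w) + enn2real (Lp_int q UNIV gw)
        \<le> (T * (C powr q + c powr q)) * N powr q" .
    have "W1p_norm UNIV q w = (enn2real (Lp_int q UNIV w) + enn2real (Lp_int q UNIV gw)) powr (1/q)"
      by (rule sw(2))
    also have "\<dots> \<le> ((T * (C powr q + c powr q)) * N powr q) powr (1/q)"
      using q by (intro powr_mono2 sum_le) simp_all
    also have "\<dots> = C' * (N powr q) powr (1/q)" unfolding C'_def by (rule powr_mult)
    also have "(N powr q) powr (1/q) = N" using q N0 by (simp add: powr_powr)
    finally have norm_le: "W1p_norm UNIV q w \<le> C' * W1p_norm \<Omega> p u" by (simp add: N_def)
    have "AE x in lborel. x \<in> \<Omega> \<longrightarrow> w x = u x"
      using ae by eventually_elim (simp add: w_def \<eta>(3))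
    then have "AE x in lebesgue. x \<in> \<Omega> \<longrightarrow> w x = u x" by (simp add: AE_completion_iff)
    then show "\<exists>w. w \<in> W1p UNIV q \<and> (AE x in lebesgue. x \<in> \<Omega> \<longrightarrow> w x = u x)
        \<and> W1p_norm UNIV q w \<le> C' * W1p_norm \<Omega> p u"
      using sw(1) norm_le by blast
  qed
qed

section \<open>Outward cuspidal domains\<close>

definition cusp :: "(real \<Rightarrow> real) \<Rightarrow> (real \<times> 'b::euclidean_space) set" where
  "cusp \<psi> = {(t, z). 0 < t \<and> t < 1 \<and> norm z < \<psi> t}"

lemma cusp_domain_eq: "cusp_domain \<psi> = cusp \<psi> \<union> ball (2, 0) (sqrt 2)"
  by (simp add: cusp_domain_def cusp_def)

text \<open>Two squares, one at most 1 and the other below 1, add up to less than the squared radius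
  2. So the ball contains the open unit tube around the axis for t from 1 to 3.\<close>

lemma mem_ball_cusp:
  fixes t :: real and z :: "'b::euclidean_space"
  assumes "\<bar>t - 2\<bar> \<le> 1" "norm z < 1"
  shows "(t, z) \<in> ball (2, 0) (sqrt 2)"
proof -
  have "(t - 2)\<^sup>2 \<le> 1" using assms(1) by (simp add: abs_square_le_1)
  moreover have "(norm z)\<^sup>2 < 1" using assms(2) by (simp add: abs_square_less_1)
  ultimately have "(2 - t)\<^sup>2 + (norm z)\<^sup>2 < 2" by (simp add: power2_commute)
  then show ?thesis by (simp add: dist_Pair_Pair dist_real_def)
qed

lemma admissible_cuspD:
  assumes "admissible_cusp \<psi>"
  shows "0 \<le> s \<Longrightarrow> s \<le> t \<Longrightarrow> \<psi> s \<le> \<psi> t" "0 \<le> t \<Longrightarrow> t \<le> 1 \<Longrightarrow> \<psi> t \<le> 1"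
    "0 < t \<Longrightarrow> (\<psi> \<longlongrightarrow> \<psi> t) (at_left t)"
  using assms unfolding admissible_cusp_def mono_on_def
  by (simp, metis atLeast_iff order_trans, simp)

text \<open>Room is needed to the left of t: with |z| < r < \<open>\<psi>\<close> t, left-continuity
  provides s < t with r < \<open>\<psi>\<close> s, and monotonicity then gives r <
  \<open>\<psi>\<close> on all of (s, 1).\<close>

lemma open_cusp:
  assumes "admissible_cusp \<psi>"
  shows "open (cusp \<psi> :: (real \<times> 'b::euclidean_space) set)"
  unfolding open_prod_def
proof (rule ballI)
  fix x :: "real \<times> 'b" assume "x \<in> cusp \<psi>"
  then obtain t z where x: "x = (t, z)" "0 < t" "t < 1" "norm z < \<psi> t"
    by (auto simp: cusp_def)
  obtain r where r: "norm z < r" "r < \<psi> t" using dense[OF x(4)] by blast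
  have "eventually (\<lambda>s. r < \<psi> s) (at_left t)"
    by (rule order_tendstoD(1)[OF admissible_cuspD(3)[OF assms x(2)] r(2)])
  then obtain b where b: "b < t" "\<And>s. b < s \<Longrightarrow> s < t \<Longrightarrow> r < \<psi> s"
    unfolding eventually_at_left_field by blast
  \<comment> \<open>A point to the left of t that is both positive and beyond b.\<close>
  define s where "s = (max b 0 + t) / 2"
  have s: "b < s" "0 < s" "s < t" using b(1) x(2) by (auto simp: s_def)
  have rs: "r < \<psi> s" by (rule b(2)[OF s(1,3)])
  have "{s<..<1} \<times> ball (0 :: 'b) r \<subseteq> cusp \<psi>"
  proof (rule subsetI)
    fix y :: "real \<times> 'b" assume "y \<in> {s<..<1} \<times> ball 0 r"
    then obtain t' z' where y: "y = (t', z')" "s < t'" "t' < 1" "norm z' < r" by auto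
    then show "y \<in> cusp \<psi>"
      using s rs admissible_cuspD(1)[OF assms, of s t'] by (simp add: cusp_def)
  qed
  moreover have "x \<in> {s<..<1} \<times> ball 0 r" using x s r by simp
  ultimately show "\<exists>A B. open A \<and> open B \<and> x \<in> A \<times> B \<and> A \<times> B \<subseteq> cusp \<psi>"
    by (intro exI[of _ "{s<..<1}"] exI[of _ "ball 0 r"]) simp
qed

text \<open>The cusp is attached to the ball along h = (1, 0). The moving point stays in the cusp as
  long as t + s < 1, because the profile is nondecreasing; from then on 1 <= t + s < 2 places it in
  the unit tube inside the ball.\<close>

lemma cusp_domain_oscillation_bound:
  fixes \<psi> :: "real \<Rightarrow> real"
  assumes \<psi>: "admissible_cusp \<psi>" and p: "p \<ge> 1"
  obtains K where "oscillation_bound p (cusp_domain \<psi> :: (real \<times> (real^'m)) set) K"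
proof -
  define D where "D = ball ((2, 0) :: real \<times> (real^'m)) (sqrt 2)"
  have D: "open D" "convex D" "bounded D" "D \<noteq> {}" by (simp_all add: D_def)
  obtain K where K: "oscillation_bound p D K"
    by (rule convex_oscillation_bound[OF D p])
  obtain K' where K': "oscillation_bound p (cusp \<psi> \<union> D) K'"
  proof (rule oscillation_bound_attach[OF D(1) K open_cusp[OF \<psi>] p])
    fix x :: "real \<times> (real^'m)" assume "x \<in> cusp \<psi>"
    then obtain t z where x: "x = (t, z)" "0 < t" "t < 1" "norm z < \<psi> t"
      by (auto simp: cusp_def)
    then have z1: "norm z < 1" using admissible_cuspD(2)[OF \<psi>, of t] by simp
    show "x + (1, 0) \<in> D"
      unfolding D_def x using mem_ball_cusp[of "t + 1" z] x z1 by simp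
    fix s :: real assume s: "0 \<le> s" "s \<le> 1"
    show "x + s *\<^sub>R (1, 0) \<in> cusp \<psi> \<union> D"
    proof (cases "t + s < 1")
      case True
      then show ?thesis
        using x s admissible_cuspD(1)[OF \<psi>, of t "t + s"] by (simp add: cusp_def)
    next
      case False
      then show ?thesis
        unfolding D_def using mem_ball_cusp[of "t + s" z] x s z1 by simp
    qed
  qed
  show ?thesis by (rule that) (use K' in \<open>simp add: cusp_domain_eq D_def\<close>)
qed

theorem theorem1p3:
  fixes \<psi> :: "real \<Rightarrow> real"
  assumes "admissible_cusp \<psi>"
  shows "(\<forall>p>1. poincare_domain p (cusp_domain \<psi> :: (real \<times> (real^'m)) set)) \<and>
         (\<forall>p q. 1 \<le> q \<and> q < p \<longrightarrow>
            (W_extension_domain (cusp_domain \<psi> :: (real \<times> (real^'m)) set) p q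
               \<longleftrightarrow> L_extension_domain (cusp_domain \<psi> :: (real \<times> (real^'m)) set) p q))"
proof (intro conjI allI impI)
  let ?\<Omega> = "cusp_domain \<psi> :: (real \<times> (real^'m)) set"
  have \<Omega>: "open ?\<Omega>"
    unfolding cusp_domain_eq by (intro open_Un open_cusp[OF assms] open_ball)
  have "cusp \<psi> \<subseteq> cball (0 :: real) 1 \<times> cball (0 :: real^'m) 1"
  proof (rule subsetI)
    fix x :: "real \<times> (real^'m)" assume "x \<in> cusp \<psi>"
    then obtain t z where x: "x = (t, z)" "0 < t" "t < 1" "norm z < \<psi> t"
      by (auto simp: cusp_def)
    then show "x \<in> cball 0 1 \<times> cball 0 1"
      using admissible_cuspD(2)[OF assms, of t] by simp
  qed
  then have "bounded (cusp \<psi> :: (real \<times> (real^'m)) set)"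
    by (rule bounded_subset[OF bounded_Times[OF bounded_cball bounded_cball]])
  then have bounded: "bounded ?\<Omega>"
    unfolding cusp_domain_eq by simp
  have "((2, 0) :: real \<times> (real^'m)) \<in> ball (2, 0) (sqrt 2)" by simp
  then have ne: "?\<Omega> \<noteq> {}" unfolding cusp_domain_eq by blast
  show "poincare_domain p ?\<Omega>" if "1 < p" for p
  proof -
    have p: "1 \<le> p" using that by simp
    obtain K where "oscillation_bound p ?\<Omega> K" by (rule cusp_domain_oscillation_bound[OF assms p])
    then show ?thesis by (rule oscillation_bound_imp_poincare_domain[OF \<Omega> bounded ne p])
  qed
  show "W_extension_domain ?\<Omega> p q \<longleftrightarrow> L_extension_domain ?\<Omega> p q" if pq: "1 \<le> q \<and> q < p" for p q
  proof
    have q: "1 \<le> q" and p: "1 \<le> p" and le: "q \<le> p" using pq by simp_all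
    obtain K where K: "oscillation_bound p ?\<Omega> K" by (rule cusp_domain_oscillation_bound[OF assms p])
    show "L_extension_domain ?\<Omega> p q" if "W_extension_domain ?\<Omega> p q"
      by (rule W_extension_imp_L_extension[OF \<Omega> p q K that])
    show "W_extension_domain ?\<Omega> p q" if "L_extension_domain ?\<Omega> p q"
      by (rule L_extension_imp_W_extension[OF \<Omega> bounded ne q le that])
  qed
qed

end
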